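(* Let $\mathfrak A$ be a $C^*$-algebra and $J$ an index set. Assigning to a stochastic process $(\mathfrak A,\mathcal H,\{\iota_j\}_{j\in J},\Omega)$ the state $\varphi$ on the free product $C^*$-algebra $\mathfrak B$ determined by $$\varphi\big(i_{j_1}(A_1)\cdots i_{j_n}(A_n)\big)=\langle\iota_{j_1}(A_1)\cdots\iota_{j_n}(A_n)\Omega,\Omega\rangle,\qquad n\ge 1,\ j_1,\dots,j_n\in J,\ A_1,\dots,A_n\in\mathfrak A,$$ gives a one-to-one correspondence between unitary equivalence classes of stochastic processes on $\mathfrak A$ indexed by $J$ and states on $\mathfrak B$. If $\mathfrak A$ has a unit and the processes are unital, the corresponding states on $\mathfrak B$ are those which factorize through the unital free product $C^*$-algebra $\mathfrak C$, i.e. which are of the form $\psi\circ\rho$ with $\psi$ a state on $\mathfrak C$. A class is given by an exchangeable stochastic process if and only if the corresponding state is symmetric.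
   Context: Free products. $\mathfrak B$ is the free product of copies of $\mathfrak A$ indexed by $J$ in the category of (not necessarily unital) $C^*$-algebras: it comes with $*$-homomorphisms $i_j:\mathfrak A\to\mathfrak B$, $j\in J$, whose ranges generate $\mathfrak B$, such that for every $C^*$-algebra $B$ and $*$-homomorphisms $\Phi_j:\mathfrak A\to B$ ($j\in J$) there is a unique $*$-homomorphism $\Phi:\mathfrak B\to B$ with $\Phi\circ i_j=\Phi_j$ for all $j$. If $\mathfrak A$ is unital, $\mathfrak C$ is the analogous free product in the category of unital $C^*$-algebras and unital $*$-homomorphisms, and $\rho:\mathfrak B\to\mathfrak C$ is the canonical surjective $*$-homomorphism sending $i_j(A)\in\mathfrak B$ to the canonical image of $A$ in the $j$-th copy inside $\mathfrak C$. $\mathbb P_J$ is the group of permutations of $J$ moving only finitely many elements. It acts on $\mathfrak B$ by automorphisms $\beta_g$ with $\beta_g(i_j(A))=i_{g(j)}(A)$. A state $\varphi$ on $\mathfrak B$ is symmetric if $\varphi\circ\beta_g=\varphi$ for all $g\in\mathbb P_J$. A stochastic process labelled by $J$ is a quadruple $(\mathfrak A,\mathcal H,\{\iota_j\}_{j\in J},\Omega)$ where $\mathfrak A$ is a $C^*$-algebra, $\mathcal H$ a Hilbert space, each $\iota_j:\mathfrak A\to\mathcal B(\mathcal H)$ a $*$-homomorphism, and $\Omega\in\mathcal H$ a unit vector which is cyclic for the von Neumann algebra $M:=\bigvee_{j\in J}\iota_j(\mathfrak A)=\big(\bigcup_{j\in J}\iota_j(\mathfrak A)\big)''$ acting on $\mathcal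 H$. It is exchangeable if $\langle\iota_{j_1}(A_1)\cdots\iota_{j_n}(A_n)\Omega,\Omega\rangle=\langle\iota_{g(j_1)}(A_1)\cdots\iota_{g(j_n)}(A_n)\Omega,\Omega\rangle$ for all $g\in\mathbb P_J$, $n\in\mathbb N$, $j_k\in J$, $A_k\in\mathfrak A$. If $\mathfrak A$ has unit $1$, the process is unital if $\iota_j(1)=I$ for all $j$. Two processes $(\mathfrak A,\mathcal H_i,\{\iota^{(i)}_j\},\Omega_i)$, $i=1,2$, are unitarily equivalent if there is a unitary $V:\mathcal H_1\to\mathcal H_2$ with $V\Omega_1=\Omega_2$ and $V\iota^{(1)}_j(A)V^*=\iota^{(2)}_j(A)$ for all $A\in\mathfrak A$, $j\in J$.
   Formalization: Processes are also required to be nondegenerate: no nonzero vector is annihilated by all ι_j(A). Without this the claim fails: for H = ℂ, ι_j = 0, Ω = 1 the bicommutant is ℂI and Ω is cyclic, but φ = 0 is not a state. *)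

theory Defs
  imports
    "HOL-Analysis.Analysis"
    "HOL-Library.Equipollence"
    "HOL-Library.Nonpos_Ints"
    "HOL-Combinatorics.Permutations"
    "HOL-Algebra.Module"
begin

section \<open>Complex vector spaces, C*-algebras\<close>

definition complex_ring :: "complex ring" where
  "complex_ring = \<lparr>carrier = UNIV, mult = (*), one = 1, zero = 0, add = (+)\<rparr>"

text \<open>The field \<open>one\<close> inherited from rings carries no meaning unless the algebra is
  explicitly assumed to be unital.\<close>

record 'a cstar = "(complex, 'a) module" +
  star :: "'a \<Rightarrow> 'a"
  cnorm :: "'a \<Rightarrow> real"

definition cstar_dist :: "'a cstar \<Rightarrow> 'a \<Rightarrow> 'a \<Rightarrow> real" where
  "cstar_dist A x y =
     (if x \<in> carrier A \<and> y \<in> carrier A then cnorm A (x \<ominus>\<^bsub>A\<^esub> y) else 0)"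

abbreviation cstar_topology :: "'a cstar \<Rightarrow> 'a topology" where
  "cstar_topology A \<equiv> Metric_space.mtopology (carrier A) (cstar_dist A)"

locale cstar_algebra = Module.module complex_ring A for A :: "'a cstar" (structure) +
  assumes mult_closed: "\<lbrakk>x \<in> carrier A; y \<in> carrier A\<rbrakk> \<Longrightarrow> x \<otimes>\<^bsub>A\<^esub> y \<in> carrier A"
    and mult_assoc: "\<lbrakk>x \<in> carrier A; y \<in> carrier A; z \<in> carrier A\<rbrakk> \<Longrightarrow>
      (x \<otimes>\<^bsub>A\<^esub> y) \<otimes>\<^bsub>A\<^esub> z = x \<otimes>\<^bsub>A\<^esub> (y \<otimes>\<^bsub>A\<^esub> z)"
    and mult_add_left: "\<lbrakk>x \<in> carrier A; y \<in> carrier A; z \<in> carrier A\<rbrakk> \<Longrightarrow>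
      (x \<oplus>\<^bsub>A\<^esub> y) \<otimes>\<^bsub>A\<^esub> z = (x \<otimes>\<^bsub>A\<^esub> z) \<oplus>\<^bsub>A\<^esub> (y \<otimes>\<^bsub>A\<^esub> z)"
    and mult_add_right: "\<lbrakk>x \<in> carrier A; y \<in> carrier A; z \<in> carrier A\<rbrakk> \<Longrightarrow>
      x \<otimes>\<^bsub>A\<^esub> (y \<oplus>\<^bsub>A\<^esub> z) = (x \<otimes>\<^bsub>A\<^esub> y) \<oplus>\<^bsub>A\<^esub> (x \<otimes>\<^bsub>A\<^esub> z)"
    and mult_smult_left: "\<lbrakk>x \<in> carrier A; y \<in> carrier A\<rbrakk> \<Longrightarrow>
      (c \<odot>\<^bsub>A\<^esub> x) \<otimes>\<^bsub>A\<^esub> y = c \<odot>\<^bsub>A\<^esub> (x \<otimes>\<^bsub>A\<^esub> y)"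
    and mult_smult_right: "\<lbrakk>x \<in> carrier A; y \<in> carrier A\<rbrakk> \<Longrightarrow>
      x \<otimes>\<^bsub>A\<^esub> (c \<odot>\<^bsub>A\<^esub> y) = c \<odot>\<^bsub>A\<^esub> (x \<otimes>\<^bsub>A\<^esub> y)"
    and star_closed: "x \<in> carrier A \<Longrightarrow> star A x \<in> carrier A"
    and star_star: "x \<in> carrier A \<Longrightarrow> star A (star A x) = x"
    and star_add: "\<lbrakk>x \<in> carrier A; y \<in> carrier A\<rbrakk> \<Longrightarrow>
      star A (x \<oplus>\<^bsub>A\<^esub> y) = star A x \<oplus>\<^bsub>A\<^esub> star A y"
    and star_smult: "x \<in> carrier A \<Longrightarrow> star A (c \<odot>\<^bsub>A\<^esub> x) = cnj c \<odot>\<^bsub>A\<^esub> star A x"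
    and star_mult: "\<lbrakk>x \<in> carrier A; y \<in> carrier A\<rbrakk> \<Longrightarrow>
      star A (x \<otimes>\<^bsub>A\<^esub> y) = star A y \<otimes>\<^bsub>A\<^esub> star A x"
    and cnorm_nonneg: "x \<in> carrier A \<Longrightarrow> 0 \<le> cnorm A x"
    and cnorm_eq_0: "x \<in> carrier A \<Longrightarrow> cnorm A x = 0 \<longleftrightarrow> x = \<zero>\<^bsub>A\<^esub>"
    and cnorm_triangle: "\<lbrakk>x \<in> carrier A; y \<in> carrier A\<rbrakk> \<Longrightarrow>
      cnorm A (x \<oplus>\<^bsub>A\<^esub> y) \<le> cnorm A x + cnorm A y"
    and cnorm_smult: "x \<in> carrier A \<Longrightarrow> cnorm A (c \<odot>\<^bsub>A\<^esub> x) = cmod c * cnorm A x"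
    and cnorm_mult: "\<lbrakk>x \<in> carrier A; y \<in> carrier A\<rbrakk> \<Longrightarrow>
      cnorm A (x \<otimes>\<^bsub>A\<^esub> y) \<le> cnorm A x * cnorm A y"
    and cnorm_cstar: "x \<in> carrier A \<Longrightarrow> cnorm A (star A x \<otimes>\<^bsub>A\<^esub> x) = (cnorm A x)\<^sup>2"
    and complete: "Metric_space.mcomplete (carrier A) (cstar_dist A)"

locale unital_cstar_algebra = cstar_algebra +
  assumes unit_closed: "\<one>\<^bsub>A\<^esub> \<in> carrier A"
    and unit_left: "x \<in> carrier A \<Longrightarrow> \<one>\<^bsub>A\<^esub> \<otimes>\<^bsub>A\<^esub> x = x"
    and unit_right: "x \<in> carrier A \<Longrightarrow> x \<otimes>\<^bsub>A\<^esub> \<one>\<^bsub>A\<^esub> = x"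

definition star_hom :: "'a cstar \<Rightarrow> 'b cstar \<Rightarrow> ('a \<Rightarrow> 'b) set" where
  "star_hom A B = {h \<in> hom A B \<inter> hom (add_monoid A) (add_monoid B).
     (\<forall>c. \<forall>x\<in>carrier A. h (c \<odot>\<^bsub>A\<^esub> x) = c \<odot>\<^bsub>B\<^esub> h x) \<and>
     (\<forall>x\<in>carrier A. h (star A x) = star B (h x))}"

definition unital_star_hom :: "'a cstar \<Rightarrow> 'b cstar \<Rightarrow> ('a \<Rightarrow> 'b) set" where
  "unital_star_hom A B = {h \<in> star_hom A B. h \<one>\<^bsub>A\<^esub> = \<one>\<^bsub>B\<^esub>}"

definition cstar_subalgebra :: "'a set \<Rightarrow> 'a cstar \<Rightarrow> bool" where
  "cstar_subalgebra S A \<longleftrightarrow> submodule S complex_ring A \<and>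
     (\<forall>x\<in>S. \<forall>y\<in>S. x \<otimes>\<^bsub>A\<^esub> y \<in> S) \<and> (\<forall>x\<in>S. star A x \<in> S) \<and>
     closedin (cstar_topology A) S"

text \<open>States are extensional, so that equality of states is equality on the carrier.\<close>

definition states :: "'a cstar \<Rightarrow> ('a \<Rightarrow> complex) set" where
  "states A = {f \<in> extensional (carrier A).
     (\<forall>x\<in>carrier A. \<forall>y\<in>carrier A. f (x \<oplus>\<^bsub>A\<^esub> y) = f x + f y) \<and>
     (\<forall>c. \<forall>x\<in>carrier A. f (c \<odot>\<^bsub>A\<^esub> x) = c * f x) \<and>
     (\<forall>x\<in>carrier A. f (star A x \<otimes>\<^bsub>A\<^esub> x) \<in> \<real>\<^sub>\<ge>\<^sub>0) \<and>
     bdd_above ((\<lambda>x. cmod (f x)) ` {x \<in> carrier A. cnorm A x \<le> 1}) \<and>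
     (SUP x\<in>{x \<in> carrier A. cnorm A x \<le> 1}. cmod (f x)) = 1}"

text \<open>Products of nonempty lists; no unit is available in general.\<close>

fun list_mult :: "('a, 'm) monoid_scheme \<Rightarrow> 'a list \<Rightarrow> 'a" where
  "list_mult A [] = undefined"
| "list_mult A [x] = x"
| "list_mult A (x # y # xs) = x \<otimes>\<^bsub>A\<^esub> list_mult A (y # xs)"


section \<open>Hilbert spaces and bounded operators\<close>

text \<open>Hilbert spaces are also carrier-based (the ring fields \<open>mult\<close> and \<open>one\<close> of the module
  record are irrelevant). The inner product is linear in the first argument.\<close>

record 'h hilbert = "(complex, 'h) module" +
  ip :: "'h \<Rightarrow> 'h \<Rightarrow> complex"

definition hnorm :: "'h hilbert \<Rightarrow> 'h \<Rightarrow> real" where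
  "hnorm H x = sqrt (Re (ip H x x))"

definition hdist :: "'h hilbert \<Rightarrow> 'h \<Rightarrow> 'h \<Rightarrow> real" where
  "hdist H x y =
     (if x \<in> carrier H \<and> y \<in> carrier H then hnorm H (x \<ominus>\<^bsub>H\<^esub> y) else 0)"

abbreviation hilbert_topology :: "'h hilbert \<Rightarrow> 'h topology" where
  "hilbert_topology H \<equiv> Metric_space.mtopology (carrier H) (hdist H)"

locale hilbert_space = Module.module complex_ring H for H :: "'h hilbert" (structure) +
  assumes ip_add: "\<lbrakk>x \<in> carrier H; y \<in> carrier H; z \<in> carrier H\<rbrakk> \<Longrightarrow>
      ip H (x \<oplus>\<^bsub>H\<^esub> y) z = ip H x z + ip H y z"
    and ip_smult: "\<lbrakk>x \<in> carrier H; y \<in> carrier H\<rbrakk> \<Longrightarrow> ip H (c \<odot>\<^bsub>H\<^esub> x) y = c * ip H x y"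
    and ip_cnj: "\<lbrakk>x \<in> carrier H; y \<in> carrier H\<rbrakk> \<Longrightarrow> ip H y x = cnj (ip H x y)"
    and ip_nonneg: "x \<in> carrier H \<Longrightarrow> ip H x x \<in> \<real>\<^sub>\<ge>\<^sub>0"
    and ip_eq_0: "\<lbrakk>x \<in> carrier H; ip H x x = 0\<rbrakk> \<Longrightarrow> x = \<zero>\<^bsub>H\<^esub>"
    and complete: "Metric_space.mcomplete (carrier H) (hdist H)"

definition bounded_maps :: "'h hilbert \<Rightarrow> 'k hilbert \<Rightarrow> ('h \<Rightarrow> 'k) set" where
  "bounded_maps H K = {T \<in> carrier H \<rightarrow>\<^sub>E carrier K.
     (\<forall>x\<in>carrier H. \<forall>y\<in>carrier H. T (x \<oplus>\<^bsub>H\<^esub> y) = T x \<oplus>\<^bsub>K\<^esub> T y) \<and>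
     (\<forall>c. \<forall>x\<in>carrier H. T (c \<odot>\<^bsub>H\<^esub> x) = c \<odot>\<^bsub>K\<^esub> T x) \<and>
     (\<exists>b. \<forall>x\<in>carrier H. hnorm K (T x) \<le> b * hnorm H x)}"

definition adjoint_map :: "'h hilbert \<Rightarrow> 'k hilbert \<Rightarrow> ('h \<Rightarrow> 'k) \<Rightarrow> ('k \<Rightarrow> 'h)" where
  "adjoint_map H K T = (\<lambda>y\<in>carrier K. THE x. x \<in> carrier H \<and>
     (\<forall>z\<in>carrier H. ip K (T z) y = ip H z x))"

definition bounded_ops :: "'h hilbert \<Rightarrow> ('h \<Rightarrow> 'h) cstar" where
  "bounded_ops H = \<lparr>
     carrier = bounded_maps H H,
     mult = (\<lambda>S T. compose (carrier H) S T),
     one = (\<lambda>x\<in>carrier H. x),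
     zero = (\<lambda>x\<in>carrier H. \<zero>\<^bsub>H\<^esub>),
     add = (\<lambda>S T. \<lambda>x\<in>carrier H. S x \<oplus>\<^bsub>H\<^esub> T x),
     smult = (\<lambda>c T. \<lambda>x\<in>carrier H. c \<odot>\<^bsub>H\<^esub> T x),
     star = adjoint_map H H,
     cnorm = (\<lambda>T. SUP x\<in>{x \<in> carrier H. hnorm H x \<le> 1}. hnorm H (T x))\<rparr>"

definition unitary_maps :: "'h hilbert \<Rightarrow> 'k hilbert \<Rightarrow> ('h \<Rightarrow> 'k) set" where
  "unitary_maps H K = {V \<in> bounded_maps H K.
     compose (carrier H) (adjoint_map H K V) V = (\<lambda>x\<in>carrier H. x) \<and>
     compose (carrier K) V (adjoint_map H K V) = (\<lambda>y\<in>carrier K. y)}"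

definition commutant :: "'h hilbert \<Rightarrow> ('h \<Rightarrow> 'h) set \<Rightarrow> ('h \<Rightarrow> 'h) set" where
  "commutant H S = {T \<in> carrier (bounded_ops H).
     \<forall>R\<in>S. T \<otimes>\<^bsub>bounded_ops H\<^esub> R = R \<otimes>\<^bsub>bounded_ops H\<^esub> T}"


section \<open>Free products\<close>

text \<open>HOL cannot quantify over types inside a formula, so the universal property is stated for
  the C*-algebras whose elements are taken from a type \<open>'d\<close>, indicated by the \<open>itself\<close>
  argument. A free product has the property for every choice of \<open>'d\<close>.\<close>

definition free_product ::
    "'d itself \<Rightarrow> 'j set \<Rightarrow> 'a cstar \<Rightarrow> 'b cstar \<Rightarrow> ('j \<Rightarrow> 'a \<Rightarrow> 'b) \<Rightarrow> bool" where
  "free_product _ J A B i \<longleftrightarrow>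
     cstar_algebra B \<and>
     (\<forall>j\<in>J. i j \<in> star_hom A B) \<and>
     (\<forall>S. cstar_subalgebra S B \<and> (\<Union>j\<in>J. i j ` carrier A) \<subseteq> S \<longrightarrow> S = carrier B) \<and>
     (\<forall>(D :: 'd cstar) \<Phi>. cstar_algebra D \<and> (\<forall>j\<in>J. \<Phi> j \<in> star_hom A D) \<longrightarrow>
        (\<exists>!\<Psi>. \<Psi> \<in> star_hom B D \<inter> extensional (carrier B) \<and>
              (\<forall>j\<in>J. \<forall>a\<in>carrier A. \<Psi> (i j a) = \<Phi> j a)))"

definition unital_free_product ::
    "'d itself \<Rightarrow> 'j set \<Rightarrow> 'a cstar \<Rightarrow> 'b cstar \<Rightarrow> ('j \<Rightarrow> 'a \<Rightarrow> 'b) \<Rightarrow> bool" where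
  "unital_free_product _ J A C k \<longleftrightarrow>
     unital_cstar_algebra C \<and>
     (\<forall>j\<in>J. k j \<in> unital_star_hom A C) \<and>
     (\<forall>S. cstar_subalgebra S C \<and> \<one>\<^bsub>C\<^esub> \<in> S \<and> (\<Union>j\<in>J. k j ` carrier A) \<subseteq> S \<longrightarrow>
        S = carrier C) \<and>
     (\<forall>(D :: 'd cstar) \<Phi>. unital_cstar_algebra D \<and> (\<forall>j\<in>J. \<Phi> j \<in> unital_star_hom A D) \<longrightarrow>
        (\<exists>!\<Psi>. \<Psi> \<in> unital_star_hom C D \<inter> extensional (carrier C) \<and>
              (\<forall>j\<in>J. \<forall>a\<in>carrier A. \<Psi> (k j a) = \<Phi> j a)))"

definition free_lift ::
    "'j set \<Rightarrow> 'a cstar \<Rightarrow> 'b cstar \<Rightarrow> ('j \<Rightarrow> 'a \<Rightarrow> 'b) \<Rightarrow> 'd cstar \<Rightarrow> ('j \<Rightarrow> 'a \<Rightarrow> 'd) \<Rightarrow> 'b \<Rightarrow> 'd" where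
  "free_lift J A B i D \<Phi> = (THE \<Psi>. \<Psi> \<in> star_hom B D \<inter> extensional (carrier B) \<and>
     (\<forall>j\<in>J. \<forall>a\<in>carrier A. \<Psi> (i j a) = \<Phi> j a))"

definition finitary_perms :: "'j set \<Rightarrow> ('j \<Rightarrow> 'j) set" where
  "finitary_perms J = {g. g permutes J \<and> finite {j. g j \<noteq> j}}"

text \<open>The action \<open>\<beta>\<^sub>g\<close>.\<close>

definition perm_aut ::
    "'j set \<Rightarrow> 'a cstar \<Rightarrow> 'b cstar \<Rightarrow> ('j \<Rightarrow> 'a \<Rightarrow> 'b) \<Rightarrow> ('j \<Rightarrow> 'j) \<Rightarrow> 'b \<Rightarrow> 'b" where
  "perm_aut J A B i g = free_lift J A B i B (\<lambda>j. i (g j))"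

definition symmetric_state ::
    "'j set \<Rightarrow> 'a cstar \<Rightarrow> 'b cstar \<Rightarrow> ('j \<Rightarrow> 'a \<Rightarrow> 'b) \<Rightarrow> ('b \<Rightarrow> complex) \<Rightarrow> bool" where
  "symmetric_state J A B i \<phi> \<longleftrightarrow>
     (\<forall>g\<in>finitary_perms J. \<forall>x\<in>carrier B. \<phi> (perm_aut J A B i g x) = \<phi> x)"


section \<open>Stochastic processes\<close>

text \<open>The Hilbert spaces of the processes have their elements in a type \<open>'h\<close>. Every
  Hilbert space occurs, up to isomorphism, for a large enough \<open>'h\<close>. The classes are in
  bijection with the states on \<open>B :: 'b cstar\<close> only if \<open>'h\<close> has room for the GNS
  spaces of \<open>B\<close>; these embed into \<open>'b \<Rightarrow> complex\<close> by sending \<open>\<xi>\<close> to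
  \<open>b \<mapsto> \<langle>\<xi>, \<pi>(b)\<Omega>\<rangle>\<close>.\<close>

record ('j, 'a, 'h) process =
  hspace :: "'h hilbert"
  rep :: "'j \<Rightarrow> 'a \<Rightarrow> 'h \<Rightarrow> 'h"
  vac :: 'h

definition process_vN :: "'j set \<Rightarrow> 'a cstar \<Rightarrow> ('j, 'a, 'h) process \<Rightarrow> ('h \<Rightarrow> 'h) set" where
  "process_vN J A p = commutant (hspace p) (commutant (hspace p) (\<Union>j\<in>J. rep p j ` carrier A))"

text \<open>The last conjunct says that the ranges of the homomorphisms act nondegenerately, which
  is what the identification of the von Neumann algebra they generate with the bicommutant
  presupposes. Without it the zero homomorphisms on a one-dimensional space would
  be a process (the bicommutant always contains the identity) whose functional is 0.\<close>

definition processes :: "'j set \<Rightarrow> 'a cstar \<Rightarrow> ('j, 'a, 'h) process set" where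
  "processes J A = {p. hilbert_space (hspace p) \<and>
     (\<forall>j\<in>J. rep p j \<in> star_hom A (bounded_ops (hspace p))) \<and>
     vac p \<in> carrier (hspace p) \<and> hnorm (hspace p) (vac p) = 1 \<and>
     hilbert_topology (hspace p) closure_of {T (vac p) | T. T \<in> process_vN J A p}
       = carrier (hspace p) \<and>
     (\<forall>x\<in>carrier (hspace p). (\<forall>j\<in>J. \<forall>a\<in>carrier A. rep p j a x = \<zero>\<^bsub>hspace p\<^esub>) \<longrightarrow>
        x = \<zero>\<^bsub>hspace p\<^esub>)}"

definition unitarily_equivalent ::
    "'j set \<Rightarrow> 'a cstar \<Rightarrow> ('j, 'a, 'h) process \<Rightarrow> ('j, 'a, 'k) process \<Rightarrow> bool" where
  "unitarily_equivalent J A p q \<longleftrightarrow>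
     (\<exists>V\<in>unitary_maps (hspace p) (hspace q). V (vac p) = vac q \<and>
        (\<forall>j\<in>J. \<forall>a\<in>carrier A. \<forall>y\<in>carrier (hspace q).
           V (rep p j a (adjoint_map (hspace p) (hspace q) V y)) = rep q j a y))"

definition process_equiv ::
    "'j set \<Rightarrow> 'a cstar \<Rightarrow> (('j, 'a, 'h) process \<times> ('j, 'a, 'h) process) set" where
  "process_equiv J A =
     {(p, q). p \<in> processes J A \<and> q \<in> processes J A \<and> unitarily_equivalent J A p q}"

text \<open>A word \<open>[(j\<^sub>1, a\<^sub>1), \<dots>, (j\<^sub>n, a\<^sub>n)]\<close>, \<open>n \<ge> 1\<close>, stands for the
  product of the \<open>a\<^sub>k\<close> in the \<open>j\<^sub>k\<close>-th copies of the algebra.\<close>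

definition words :: "'j set \<Rightarrow> 'a cstar \<Rightarrow> ('j \<times> 'a) list set" where
  "words J A = {w. w \<noteq> [] \<and> set w \<subseteq> J \<times> carrier A}"

definition word_mult :: "('b, 'm) monoid_scheme \<Rightarrow> ('j \<Rightarrow> 'a \<Rightarrow> 'b) \<Rightarrow> ('j \<times> 'a) list \<Rightarrow> 'b" where
  "word_mult B i w = list_mult B (map (\<lambda>(j, a). i j a) w)"

definition moment :: "('j, 'a, 'h) process \<Rightarrow> ('j \<times> 'a) list \<Rightarrow> complex" where
  "moment p w = ip (hspace p) (word_mult (bounded_ops (hspace p)) (rep p) w (vac p)) (vac p)"

definition exchangeable :: "'j set \<Rightarrow> 'a cstar \<Rightarrow> ('j, 'a, 'h) process \<Rightarrow> bool" where
  "exchangeable J A p \<longleftrightarrow>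
     (\<forall>g\<in>finitary_perms J. \<forall>w\<in>words J A. moment p w = moment p (map (\<lambda>(j, a). (g j, a)) w))"

definition unital_process :: "'j set \<Rightarrow> 'a cstar \<Rightarrow> ('j, 'a, 'h) process \<Rightarrow> bool" where
  "unital_process J A p \<longleftrightarrow> (\<forall>j\<in>J. rep p j \<one>\<^bsub>A\<^esub> = \<one>\<^bsub>bounded_ops (hspace p)\<^esub>)"

definition has_state ::
    "'j set \<Rightarrow> 'a cstar \<Rightarrow> 'b cstar \<Rightarrow> ('j \<Rightarrow> 'a \<Rightarrow> 'b) \<Rightarrow> ('j, 'a, 'h) process \<Rightarrow> ('b \<Rightarrow> complex) \<Rightarrow> bool"
  where
  "has_state J A B i p \<phi> \<longleftrightarrow>
     \<phi> \<in> states B \<and> (\<forall>w\<in>words J A. \<phi> (word_mult B i w) = moment p w)"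

definition process_state ::
    "'j set \<Rightarrow> 'a cstar \<Rightarrow> 'b cstar \<Rightarrow> ('j \<Rightarrow> 'a \<Rightarrow> 'b) \<Rightarrow> ('j, 'a, 'h) process \<Rightarrow> 'b \<Rightarrow> complex" where
  "process_state J A B i p = (THE \<phi>. has_state J A B i p \<phi>)"

definition class_state ::
    "'j set \<Rightarrow> 'a cstar \<Rightarrow> 'b cstar \<Rightarrow> ('j \<Rightarrow> 'a \<Rightarrow> 'b) \<Rightarrow> ('j, 'a, 'h) process set \<Rightarrow> 'b \<Rightarrow> complex" where
  "class_state J A B i K = the_elem (process_state J A B i ` K)"

end

theory Submission
  imports Defs
begin

text \<open>
  A process is a representation of the free product with a distinguished vector. By the universal
  property the homomorphisms \<open>\<iota>\<^sub>j\<close> are the restrictions to the copies of one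
  *-homomorphism \<open>\<Psi>\<close> from \<open>B\<close> to the bounded operators on \<open>H\<close>, and the moments are the values of
  the functional \<open>b \<mapsto> \<langle>\<Psi>(b)\<Omega>, \<Omega>\<rangle>\<close> on words. The words span a dense subspace of \<open>B\<close>, because
  their closed linear span is a C*-subalgebra (\<open>word_closure_eq\<close>). So two bounded functionals that
  agree on words are equal (\<open>functional_eq_if_eq_on_words\<close>), and the theorem becomes the
  correspondence of Gelfand, Naimark and Segal between states and cyclic representations.

  \<^item> The functional of a process is a state. Its norm is 1 because \<open>\<Omega>\<close> lies in the closure of
    \<open>\<Psi>(B)\<Omega>\<close> (\<open>vector_in_cl_orbit\<close>), so that the values at an approximate unit tend to
    \<open>\<langle>\<Omega>, \<Omega>\<rangle> = 1\<close> (\<open>vector_state\<close>).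

  \<^item> Processes with the same state are unitarily equivalent. The projection onto the closure of
    \<open>\<Psi>(B)\<Omega>\<close> commutes with the representation, hence with the von Neumann algebra for which \<open>\<Omega>\<close>
    is cyclic; so \<open>\<Psi>(B)\<Omega>\<close> is dense (\<open>cyclic\<close>). The state \<open>\<phi>\<close> determines the inner products
    \<open>\<langle>\<Psi>(b)\<Omega>, \<Psi>(c)\<Omega>\<rangle> = \<phi>(c\<^sup>* b)\<close>, and dense families with the same inner products are related by
    a unitary (\<open>unitary_of_equal_gram\<close>).

  \<^item> Every state \<open>\<phi>\<close> occurs: complete \<open>B\<close> for the form \<open>\<phi>(c\<^sup>* b)\<close>, let \<open>B\<close> act by left
    multiplication, and take for \<open>\<Omega>\<close> the limit of elements \<open>e\<^sub>n\<close> of the unit ball with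
    \<open>\<phi>(e\<^sub>n) \<rightarrow> 1\<close> (\<open>exists_vacuum_sequence\<close>).

  Exchangeability says that \<open>\<phi>\<close> and \<open>\<phi> \<circ> \<beta>\<^sub>g\<close> agree on words, which is symmetry. If the process is
  unital, the \<open>\<iota>\<^sub>j\<close> also extend to the unital free product, so that \<open>\<phi>\<close> factorizes through \<open>\<rho>\<close>.
  Conversely, \<open>\<rho>\<close> maps \<open>i\<^sub>j(1) b - b\<close> to 0, so \<open>\<phi> = \<psi> \<circ> \<rho>\<close> forces \<open>\<Psi>(i\<^sub>j(1))\<close> to fix the dense set
  \<open>\<Psi>(B)\<Omega>\<close>.

  The C*-algebra theory needed is obtained without spectra. If \<open>a\<close> is self-adjoint with norm less
  than 1, the contraction principle yields a self-adjoint \<open>c\<close> with \<open>2c - c\<^sup>2 = a\<close>, that is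
  \<open>(1 - c)\<^sup>2 = 1 - a\<close> (\<open>exists_one_minus_sqrt\<close>). Being algebraic, this relation is preserved by
  *-homomorphisms, and it exhibits \<open>y\<^sup>* y - y\<^sup>* a y\<close> as a square \<open>w\<^sup>* w\<close>. Norms are controlled by the
  observation that \<open>v + \<i> w\<close> and \<open>v - \<i> w\<close> both have squared norm equal to the norm of
  \<open>v\<^sup>* v + w\<^sup>* w\<close> as soon as \<open>v\<^sup>* w = w\<^sup>* v\<close> (\<open>cnorm_square_le_if_commute\<close>). Contractivity of
  *-homomorphisms, contractive approximate units and boundedness of the GNS operators follow.
\<close>

section \<open>Normed complex vector spaces on a carrier\<close>

lemma complex_ring_simps [simp]:
  "carrier complex_ring = UNIV" "mult complex_ring = (*)" "one complex_ring = 1"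
  "zero complex_ring = 0" "add complex_ring = (+)"
  by (simp_all add: complex_ring_def)

lemma cring_complex_ring: "cring complex_ring"
proof (intro cringI abelian_groupI)
  show "\<exists>y\<in>carrier complex_ring. y \<oplus>\<^bsub>complex_ring\<^esub> x = \<zero>\<^bsub>complex_ring\<^esub>" for x
    by (auto intro: exI[of _ "- x"])
qed (auto simp: comm_monoid_def comm_monoid_axioms_def monoid_def algebra_simps)

lemma complex_ring_a_inv [simp]: "a_inv complex_ring x = - x"
proof -
  interpret cring complex_ring by (rule cring_complex_ring)
  have "a_inv complex_ring x + x = 0"
    using l_neg[of x] by simp
  then show ?thesis
    by (simp add: eq_neg_iff_add_eq_0)
qed

locale complex_module = Module.module complex_ring V for V (structure)
begin

lemma smult_add_left:
  "x \<in> carrier V \<Longrightarrow> (c + d) \<odot> x = c \<odot> x \<oplus> d \<odot> x"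
  using smult_l_distr[of c d x] by simp

lemma smult_add_right:
  "x \<in> carrier V \<Longrightarrow> y \<in> carrier V \<Longrightarrow>
    c \<odot> (x \<oplus> y) = c \<odot> x \<oplus> c \<odot> y"
  using smult_r_distr[of c x y] by simp

lemma smult_smult [simp]:
  "x \<in> carrier V \<Longrightarrow> c \<odot> (d \<odot> x) = (c * d) \<odot> x"
  using smult_assoc1[of c d x] by simp

lemma smult_1 [simp]: "x \<in> carrier V \<Longrightarrow> 1 \<odot> x = x"
  using smult_one[of x] by simp

lemma smult_in [simp, intro]: "x \<in> carrier V \<Longrightarrow> c \<odot> x \<in> carrier V"
  by simp

lemma smult_0 [simp]: "x \<in> carrier V \<Longrightarrow> 0 \<odot> x = \<zero>"
  using smult_l_null[of x] by simp

lemma smult_zero [simp]: "c \<odot> \<zero> = \<zero>"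
  using smult_r_null[of c] by simp

lemma minus_eq_smult: "x \<in> carrier V \<Longrightarrow> \<ominus> x = (-1) \<odot> x"
  using smult_l_minus[of 1 x] by simp

lemma diff_eq_smult:
  "x \<in> carrier V \<Longrightarrow> y \<in> carrier V \<Longrightarrow> x \<ominus> y = x \<oplus> (-1) \<odot> y"
  by (simp add: a_minus_def minus_eq_smult)

lemma smult_diff_right:
  assumes "x \<in> carrier V" "y \<in> carrier V"
  shows "c \<odot> (x \<ominus> y) = c \<odot> x \<ominus> c \<odot> y"
  using assms by (simp add: diff_eq_smult smult_add_right)

text \<open>Normal forms of sums and differences, for the \<open>algebra\<close> proof method.\<close>

lemmas module_simprules [algebra ring "zero V" "add V" "a_inv V" "a_minus V"] =
  M.a_closed M.zero_closed M.a_inv_closed M.minus_closed M.a_assoc M.l_zero M.l_neg M.a_comm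
  M.minus_eq M.r_zero M.r_neg M.r_neg2 M.r_neg1 M.minus_add M.minus_minus M.add.inv_one M.a_lcomm

lemma diff_0_iff:
  assumes "x \<in> carrier V" "y \<in> carrier V"
  shows "x \<ominus> y = \<zero> \<longleftrightarrow> x = y"
proof
  assume "x \<ominus> y = \<zero>"
  moreover have "x = (x \<ominus> y) \<oplus> y"
    using assms by algebra
  ultimately show "x = y"
    using assms by simp
next
  assume "x = y"
  then show "x \<ominus> y = \<zero>"
    using assms by algebra
qed

lemma diff_self [simp]: "x \<in> carrier V \<Longrightarrow> x \<ominus> x = \<zero>"
  by (simp add: diff_0_iff)

lemma diff_zero [simp]: "x \<in> carrier V \<Longrightarrow> x \<ominus> \<zero> = x"
  by (simp add: diff_eq_smult)

end

text \<open>Seminorms are separated from norms since the form of a state induces only a seminorm on the algebra.\<close>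

locale complex_seminormed = complex_module +
  fixes N :: "'b \<Rightarrow> real"
  assumes N_nonneg: "x \<in> carrier V \<Longrightarrow> 0 \<le> N x"
    and N_triangle: "\<lbrakk>x \<in> carrier V; y \<in> carrier V\<rbrakk> \<Longrightarrow> N (x \<oplus> y) \<le> N x + N y"
    and N_smult: "x \<in> carrier V \<Longrightarrow> N (c \<odot> x) = cmod c * N x"
begin

lemma N_zero [simp]: "N \<zero> = 0"
  using N_smult[of "\<zero>" 0] by simp

lemma N_diff_commute:
  assumes "x \<in> carrier V" "y \<in> carrier V"
  shows "N (x \<ominus> y) = N (y \<ominus> x)"
proof -
  have "y \<ominus> x = (-1) \<odot> (x \<ominus> y)"
    using assms by (simp add: diff_eq_smult smult_add_right M.a_comm)
  then show ?thesis
    using assms by (simp add: N_smult)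
qed

lemma diff_add_diff:
  assumes "x \<in> carrier V" "y \<in> carrier V" "z \<in> carrier V"
  shows "(x \<ominus> y) \<oplus> (y \<ominus> z) = x \<ominus> z"
  using assms by algebra

lemma N_triangle_diff:
  assumes "x \<in> carrier V" "y \<in> carrier V" "z \<in> carrier V"
  shows "N (x \<ominus> z) \<le> N (x \<ominus> y) + N (y \<ominus> z)"
  using N_triangle[of "x \<ominus> y" "y \<ominus> z"] assms
  by (simp add: diff_add_diff)

lemma N_minus_le:
  assumes "x \<in> carrier V" "y \<in> carrier V"
  shows "N (x \<ominus> y) \<le> N x + N y"
  using N_triangle[of x "(-1) \<odot> y"] assms by (simp add: diff_eq_smult N_smult)

lemma N_le_diff:
  assumes "x \<in> carrier V" "y \<in> carrier V"
  shows "N x \<le> N (x \<ominus> y) + N y"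
  using N_triangle_diff[of x y "\<zero>"] assms by simp

end

locale complex_normed = complex_seminormed +
  assumes N_eq_0: "x \<in> carrier V \<Longrightarrow> N x = 0 \<longleftrightarrow> x = \<zero>"
begin

definition ndist :: "'a \<Rightarrow> 'a \<Rightarrow> real" where
  "ndist x y = (if x \<in> carrier V \<and> y \<in> carrier V then N (x \<ominus> y) else 0)"

lemma metric: "Metric_space (carrier V) ndist"
proof
  show "0 \<le> ndist x y" for x y
    by (auto simp: ndist_def intro: N_nonneg)
  show "ndist x y = ndist y x" for x y
    by (auto simp: ndist_def intro: N_diff_commute)
qed (auto simp: ndist_def N_eq_0 diff_0_iff N_triangle_diff)

sublocale ms: Metric_space "carrier V" ndist
  by (rule metric)

lemma closure_of_iff:
  assumes "S \<subseteq> carrier V"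
  shows "x \<in> ms.mtopology closure_of S \<longleftrightarrow>
    x \<in> carrier V \<and> (\<forall>e>0. \<exists>y\<in>S. N (x \<ominus> y) < e)"
proof -
  have "y \<in> ms.mball x r \<longleftrightarrow> N (x \<ominus> y) < r" if "x \<in> carrier V" "y \<in> S" for y r
    using that assms by (auto simp: ndist_def)
  then show ?thesis
    unfolding ms.metric_closure_of by blast
qed

lemma closedin_iff:
  "closedin ms.mtopology S \<longleftrightarrow>
    S \<subseteq> carrier V \<and>
    (\<forall>x\<in>carrier V. (\<forall>e>0. \<exists>y\<in>S. N (x \<ominus> y) < e) \<longrightarrow> x \<in> S)"
proof (cases "S \<subseteq> carrier V")
  case True
  have "closedin ms.mtopology S \<longleftrightarrow> ms.mtopology closure_of S \<subseteq> S"
    using True closure_of_subset_eq[of S ms.mtopology] by simp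
  also have "\<dots> \<longleftrightarrow> (\<forall>x\<in>carrier V. (\<forall>e>0. \<exists>y\<in>S. N (x \<ominus> y) < e) \<longrightarrow> x \<in> S)"
    using closure_of_iff[OF True] by blast
  finally show ?thesis
    using True by simp
next
  case False
  then show ?thesis
    using closedin_subset[of ms.mtopology S] by auto
qed

lemma mcomplete_iff:
  "ms.mcomplete \<longleftrightarrow> (\<forall>s. (\<forall>n. s n \<in> carrier V) \<and>
     (\<forall>e>0. \<exists>M. \<forall>m\<ge>M. \<forall>n\<ge>M. N (s m \<ominus> s n) < e) \<longrightarrow>
     (\<exists>l\<in>carrier V. (\<lambda>n. N (s n \<ominus> l)) \<longlonglongrightarrow> 0))"
proof -
  have C: "ms.MCauchy s \<longleftrightarrow> (\<forall>n. s n \<in> carrier V) \<and>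
     (\<forall>e>0. \<exists>M. \<forall>m\<ge>M. \<forall>n\<ge>M. N (s m \<ominus> s n) < e)" for s
  proof (cases "\<forall>n. s n \<in> carrier V")
    case True
    then show ?thesis
      unfolding ms.MCauchy_def ndist_def by (simp add: image_subset_iff)
  qed (auto simp: ms.MCauchy_def image_subset_iff)
  have L: "limitin ms.mtopology s l sequentially \<longleftrightarrow>
      l \<in> carrier V \<and> (\<lambda>n. N (s n \<ominus> l)) \<longlonglongrightarrow> 0"
    if "\<forall>n. s n \<in> carrier V" for s l
    unfolding ms.limit_metric_sequentially ndist_def LIMSEQ_iff
    using that N_nonneg by (auto simp: abs_of_nonneg)
  show ?thesis
    unfolding ms.mcomplete_def C using L by (simp add: Bex_def)
qed

lemma limit_exists:
  assumes complete: "ms.mcomplete" and s: "\<And>n. s n \<in> carrier V"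
    and r: "r \<longlonglongrightarrow> 0" and le: "\<And>m n. N (s m \<ominus> s n) \<le> r m + r n"
  shows "\<exists>l\<in>carrier V. (\<lambda>n. N (s n \<ominus> l)) \<longlonglongrightarrow> 0"
proof -
  have "\<exists>M. \<forall>m\<ge>M. \<forall>n\<ge>M. N (s m \<ominus> s n) < e" if "e > 0" for e
  proof -
    obtain M where M: "\<And>n. n \<ge> M \<Longrightarrow> r n < e / 2"
      using order_tendstoD(2)[OF r, of "e / 2"] \<open>e > 0\<close> by (auto simp: eventually_sequentially)
    have "N (s m \<ominus> s n) < e" if "m \<ge> M" "n \<ge> M" for m n
      using le[of m n] M[OF that(1)] M[OF that(2)] by linarith
    then show ?thesis by blast
  qed
  then show ?thesis
    using complete s unfolding mcomplete_iff by blast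
qed

text \<open>The contraction principle on a closed set \<open>S\<close>. Cutting down to \<open>S\<close> is what makes the fixed
  point self-adjoint and commuting with prescribed elements in the applications.\<close>

lemma contraction_fixed_point:
  assumes complete: "ms.mcomplete"
    and closed: "closedin ms.mtopology S" and "x0 \<in> S"
    and T: "\<And>x. x \<in> S \<Longrightarrow> T x \<in> S"
    and contr: "\<And>x y. \<lbrakk>x \<in> S; y \<in> S\<rbrakk> \<Longrightarrow> N (T x \<ominus> T y) \<le> r * N (x \<ominus> y)"
    and r: "0 \<le> r" "r < 1"
  shows "\<exists>x\<in>S. T x = x"
proof -
  define s where "s n = (T ^^ n) x0" for n
  define K where "K = N (s 1 \<ominus> s 0)"
  have sS: "s n \<in> S" for n
    by (induction n) (auto simp: s_def \<open>x0 \<in> S\<close> T)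
  have SV: "S \<subseteq> carrier V"
    using closed by (simp add: closedin_iff)
  have sV [simp]: "s n \<in> carrier V" for n
    using sS SV by blast
  have sSuc: "s (Suc n) = T (s n)" for n
    by (simp add: s_def)
  have K: "0 \<le> K"
    unfolding K_def by (intro N_nonneg) simp
  have step: "N (s (Suc n) \<ominus> s n) \<le> r ^ n * K" for n
  proof (induction n)
    case (Suc n)
    have "N (s (Suc (Suc n)) \<ominus> s (Suc n)) \<le> r * N (s (Suc n) \<ominus> s n)"
      using contr[OF sS[of "Suc n"] sS[of n]] by (simp only: sSuc)
    also have "\<dots> \<le> r * (r ^ n * K)"
      using Suc r by (intro mult_left_mono) auto
    finally show ?case by simp
  qed (simp add: K_def)
  \<comment> \<open>Summing the geometric series of the step widths, with the remainder kept explicit for induction.\<close>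
  have far: "N (s (n + k) \<ominus> s n) \<le> r ^ n * K / (1 - r) * (1 - r ^ k)" for n k
  proof (induction k)
    case (Suc k)
    have "N (s (n + Suc k) \<ominus> s n)
        \<le> N (s (Suc (n + k)) \<ominus> s (n + k)) + N (s (n + k) \<ominus> s n)"
      using N_triangle_diff[of "s (Suc (n + k))" "s (n + k)" "s n"] by simp
    also have "\<dots> \<le> r ^ (n + k) * K + r ^ n * K / (1 - r) * (1 - r ^ k)"
      using step[of "n + k"] Suc by linarith
    also have "\<dots> = r ^ n * K / (1 - r) * (1 - r ^ Suc k)"
      using r by (simp add: field_simps power_add)
    finally show ?case .
  qed simp
  have far': "N (s m \<ominus> s n) \<le> r ^ n * K / (1 - r)" if "n \<le> m" for m n
  proof -
    have "N (s m \<ominus> s n) \<le> r ^ n * K / (1 - r) * (1 - r ^ (m - n))"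
      using far[of n "m - n"] that by simp
    also have "\<dots> \<le> r ^ n * K / (1 - r) * 1"
      using r K by (intro mult_left_mono) auto
    finally show ?thesis by simp
  qed
  have lim0: "(\<lambda>n. r ^ n * K / (1 - r)) \<longlonglongrightarrow> 0"
    using r by (intro tendsto_eq_intros LIMSEQ_power_zero refl) auto
  have "\<exists>M. \<forall>m\<ge>M. \<forall>n\<ge>M. N (s m \<ominus> s n) < e" if "e > 0" for e
  proof -
    obtain M where M: "\<And>n. n \<ge> M \<Longrightarrow> r ^ n * K / (1 - r) < e"
      using order_tendstoD(2)[OF lim0 \<open>e > 0\<close>] by (auto simp: eventually_sequentially)
    have "N (s m \<ominus> s n) < e" if "m \<ge> M" "n \<ge> M" for m n
    proof (cases "n \<le> m")
      case True
      then show ?thesis using far'[OF True] M[of n] that by linarith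
    next
      case False
      then show ?thesis
        using far'[of m n] M[of m] that N_diff_commute[of "s m" "s n"] by simp
    qed
    then show ?thesis by blast
  qed
  then obtain l where l: "l \<in> carrier V" and lim: "(\<lambda>n. N (s n \<ominus> l)) \<longlonglongrightarrow> 0"
    using complete sV unfolding mcomplete_iff by blast
  have near: "\<exists>n. N (l \<ominus> s n) < e \<and> N (l \<ominus> s (Suc n)) < e" if "e > 0" for e
  proof -
    have "\<forall>\<^sub>F n in sequentially. N (s n \<ominus> l) < e \<and> N (s (Suc n) \<ominus> l) < e"
      using order_tendstoD(2)[OF lim that] order_tendstoD(2)[OF LIMSEQ_Suc[OF lim] that]
      by (rule eventually_conj)
    then show ?thesis
      using l by (auto simp: eventually_sequentially N_diff_commute)
  qed
  have lS: "l \<in> S"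
    using closed l near sS unfolding closedin_iff by blast
  have Tl [simp]: "T l \<in> carrier V"
    using T[OF lS] SV by blast
  have "N (T l \<ominus> l) \<le> e" if "e > 0" for e
  proof -
    obtain n where n: "N (l \<ominus> s n) < e / 2" "N (l \<ominus> s (Suc n)) < e / 2"
      using near[of "e / 2"] \<open>e > 0\<close> by auto
    have "N (T l \<ominus> l) \<le> N (T l \<ominus> T (s n)) + N (T (s n) \<ominus> l)"
      using l SV T sS by (intro N_triangle_diff) auto
    moreover have "N (T l \<ominus> T (s n)) \<le> 1 * N (l \<ominus> s n)"
      using contr[OF lS sS[of n]] mult_right_mono[of r 1 "N (l \<ominus> s n)"] r l N_nonneg
      by force
    moreover have "N (T (s n) \<ominus> l) < e / 2"
      using n(2) l N_diff_commute[of "s (Suc n)" l] by (simp add: sSuc [symmetric])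
    ultimately show ?thesis
      using n(1) by linarith
  qed
  then have "N (T l \<ominus> l) \<le> 0"
    by (rule field_le_epsilon) simp
  then have "N (T l \<ominus> l) = 0"
    using N_nonneg[of "T l \<ominus> l"] l by simp
  then have "T l = l"
    using l Tl by (simp add: N_eq_0 diff_0_iff)
  then show ?thesis
    using lS by blast
qed

end

section \<open>Elementary C*-algebra theory\<close>

text \<open>Equations survive limits: a quantity bounded by multiples of arbitrarily small distances is not
  positive.\<close>

lemma le_zero_if_small:
  fixes t :: real
  assumes "\<And>e. e > 0 \<Longrightarrow> \<exists>d. 0 \<le> d \<and> d < e \<and> t \<le> C * d"
  shows "t \<le> 0"
proof (rule field_le_epsilon)
  fix e :: real assume "e > 0"
  then obtain d where d: "0 \<le> d" "d < e / (\<bar>C\<bar> + 1)" "t \<le> C * d"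
    using assms[of "e / (\<bar>C\<bar> + 1)"] by auto
  have "C * d \<le> (\<bar>C\<bar> + 1) * d"
    using d(1) by (intro mult_right_mono) auto
  also have "\<dots> \<le> e"
    using d(2) by (simp add: field_simps)
  finally show "t \<le> 0 + e"
    using d(3) by simp
qed

context cstar_algebra
begin

sublocale complex_module A ..

sublocale complex_normed A "cnorm A"
  by unfold_locales (auto simp: cnorm_nonneg cnorm_eq_0 cnorm_triangle cnorm_smult)

lemma cstar_dist_eq: "cstar_dist A = ndist"
  by (intro ext) (simp add: cstar_dist_def ndist_def)

lemma mcomplete: "ms.mcomplete"
  using complete by (simp add: cstar_dist_eq)

declare mult_closed [simp, intro] star_closed [simp, intro] star_star [simp]

lemma zero_mult [simp]: "x \<in> carrier A \<Longrightarrow> \<zero> \<otimes> x = \<zero>"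
  using mult_smult_left[of "\<zero>" x 0] by simp

lemma mult_zero [simp]: "x \<in> carrier A \<Longrightarrow> x \<otimes> \<zero> = \<zero>"
  using mult_smult_right[of x "\<zero>" 0] by simp

lemma minus_mult: "\<lbrakk>x \<in> carrier A; y \<in> carrier A\<rbrakk> \<Longrightarrow> (\<ominus> x) \<otimes> y = \<ominus> (x \<otimes> y)"
  by (simp add: minus_eq_smult mult_smult_left)

lemma mult_minus: "\<lbrakk>x \<in> carrier A; y \<in> carrier A\<rbrakk> \<Longrightarrow> x \<otimes> (\<ominus> y) = \<ominus> (x \<otimes> y)"
  by (simp add: minus_eq_smult mult_smult_right)

text \<open>The normal forms of a ring, without those rules that mention a unit.\<close>

lemmas cstar_simprules [algebra ring "zero A" "add A" "a_inv A" "a_minus A" "mult A"] =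
  M.a_closed M.zero_closed M.a_inv_closed M.minus_closed M.a_assoc M.l_zero M.l_neg M.a_comm
  M.minus_eq M.r_zero M.r_neg M.r_neg2 M.r_neg1 M.minus_add M.minus_minus M.add.inv_one M.a_lcomm
  mult_closed mult_assoc mult_add_left mult_add_right zero_mult mult_zero minus_mult mult_minus

lemma star_zero [simp]: "star A \<zero> = \<zero>"
  using star_smult[of "\<zero>" 0] by simp

lemma star_minus: "x \<in> carrier A \<Longrightarrow> star A (\<ominus> x) = \<ominus> star A x"
  by (simp add: minus_eq_smult star_smult)

lemma star_diff:
  "\<lbrakk>x \<in> carrier A; y \<in> carrier A\<rbrakk> \<Longrightarrow> star A (x \<ominus> y) = star A x \<ominus> star A y"
  by (simp add: a_minus_def star_add star_minus)

lemma diff_mult: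
  "\<lbrakk>x \<in> carrier A; y \<in> carrier A; z \<in> carrier A\<rbrakk> \<Longrightarrow> (x \<ominus> y) \<otimes> z = x \<otimes> z \<ominus> y \<otimes> z"
  by algebra

lemma mult_diff:
  "\<lbrakk>x \<in> carrier A; y \<in> carrier A; z \<in> carrier A\<rbrakk> \<Longrightarrow> x \<otimes> (y \<ominus> z) = x \<otimes> y \<ominus> x \<otimes> z"
  by algebra

lemma cnorm_star [simp]:
  assumes x: "x \<in> carrier A"
  shows "cnorm A (star A x) = cnorm A x"
proof -
  have le: "cnorm A x \<le> cnorm A (star A x)" if x: "x \<in> carrier A" for x
  proof (cases "cnorm A x = 0")
    case False
    have "cnorm A x * cnorm A x \<le> cnorm A (star A x) * cnorm A x"
      using cnorm_mult[of "star A x" x] cnorm_cstar[OF x] x by (simp add: power2_eq_square)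
    then show ?thesis
      using False cnorm_nonneg[OF x] by simp
  qed (use x cnorm_nonneg in simp)
  show ?thesis
    using le[OF x] le[of "star A x"] x by simp
qed

lemma cnorm_star_diff:
  "\<lbrakk>x \<in> carrier A; y \<in> carrier A\<rbrakk> \<Longrightarrow> cnorm A (star A x \<ominus> star A y) = cnorm A (x \<ominus> y)"
  using cnorm_star[of "x \<ominus> y"] by (simp add: star_diff del: cnorm_star)

text \<open>The hypothesis makes the mixed terms cancel in \<open>(v + \<i> w)\<^sup>* (v + \<i> w)\<close> and in
  \<open>(v - \<i> w)\<^sup>* (v - \<i> w)\<close>, so both equal \<open>v\<^sup>* v + w\<^sup>* w\<close>, and \<open>v\<close> is the mean of the two
  vectors. This replaces the estimate \<open>0 \<le> p \<le> p + q \<Longrightarrow> \<parallel>p\<parallel> \<le> \<parallel>p + q\<parallel>\<close>, whose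
  general form needs positivity theory.\<close>

lemma cnorm_square_le_if_commute:
  assumes v: "v \<in> carrier A" and w: "w \<in> carrier A"
    and comm: "star A v \<otimes> w = star A w \<otimes> v"
  shows "(cnorm A v)\<^sup>2 \<le> cnorm A (star A v \<otimes> v \<oplus> star A w \<otimes> w)"
proof -
  define z where "z = star A v \<otimes> v \<oplus> star A w \<otimes> w"
  have eq: "star A (v \<oplus> s \<odot> w) \<otimes> (v \<oplus> s \<odot> w) = z"
    if s: "cnj s = - s" "s * s = - 1" for s
  proof -
    have "star A (v \<oplus> s \<odot> w) \<otimes> (v \<oplus> s \<odot> w)
        = (star A v \<otimes> v \<oplus> star A w \<otimes> w) \<oplus> (s \<odot> (star A v \<otimes> w) \<oplus> (- s) \<odot> (star A v \<otimes> w))"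
      using v w s comm
      by (simp add: star_add star_smult mult_add_left mult_add_right mult_smult_left
          mult_smult_right smult_add_right smult_add_left M.a_ac)
    also have "\<dots> = z"
      using v w by (simp add: smult_add_left [symmetric] z_def)
    finally show ?thesis .
  qed
  have norm_eq: "cnorm A (v \<oplus> s \<odot> w) = sqrt (cnorm A z)"
    if s: "cnj s = - s" "s * s = - 1" for s
  proof -
    have "(cnorm A (v \<oplus> s \<odot> w))\<^sup>2 = cnorm A z"
      using cnorm_cstar[of "v \<oplus> s \<odot> w"] eq[OF s] v w by simp
    then show ?thesis
      using cnorm_nonneg[of "v \<oplus> s \<odot> w"] v w by (intro real_sqrt_unique [symmetric]) simp_all
  qed
  \<comment> \<open>\<open>v\<close> is the mean of \<open>v + \<i> w\<close> and \<open>v - \<i> w\<close>.\<close>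
  have "(v \<oplus> \<i> \<odot> w) \<oplus> (v \<oplus> (- \<i>) \<odot> w) = 2 \<odot> v"
  proof -
    have "(v \<oplus> \<i> \<odot> w) \<oplus> (v \<oplus> (- \<i>) \<odot> w) = (1 \<odot> v \<oplus> 1 \<odot> v) \<oplus> (\<i> \<odot> w \<oplus> (- \<i>) \<odot> w)"
      using v w by (simp add: M.a_ac)
    also have "\<dots> = 2 \<odot> v"
      using v w by (simp add: smult_add_left [symmetric] del: smult_1)
    finally show ?thesis .
  qed
  then have "2 * cnorm A v = cnorm A ((v \<oplus> \<i> \<odot> w) \<oplus> (v \<oplus> (- \<i>) \<odot> w))"
    using v by (simp add: cnorm_smult)
  also have "\<dots> \<le> 2 * sqrt (cnorm A z)"
    using cnorm_triangle[of "v \<oplus> \<i> \<odot> w" "v \<oplus> (- \<i>) \<odot> w"] norm_eq[of \<i>] norm_eq[of "- \<i>"] v w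
    by simp
  finally have "cnorm A v \<le> sqrt (cnorm A z)"
    by simp
  then have "(cnorm A v)\<^sup>2 \<le> (sqrt (cnorm A z))\<^sup>2"
    using cnorm_nonneg[OF v] by (rule power_mono)
  also have "(sqrt (cnorm A z))\<^sup>2 = cnorm A z"
    using v w by (simp add: z_def cnorm_nonneg)
  finally show ?thesis
    by (simp add: z_def)
qed

lemma cnorm_le_if_squares_add:
  assumes v: "v \<in> carrier A" and w: "w \<in> carrier A" and y: "y \<in> carrier A"
    and comm: "star A v \<otimes> w = star A w \<otimes> v"
    and sum: "star A v \<otimes> v \<oplus> star A w \<otimes> w = star A y \<otimes> y"
  shows "cnorm A v \<le> cnorm A y" "cnorm A w \<le> cnorm A y"
proof -
  have "(cnorm A v)\<^sup>2 \<le> (cnorm A y)\<^sup>2"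
    using cnorm_square_le_if_commute[OF v w comm] sum y by (simp add: cnorm_cstar)
  then show "cnorm A v \<le> cnorm A y"
    using cnorm_nonneg[OF y] by (rule power2_le_imp_le)
  have "(cnorm A w)\<^sup>2 \<le> (cnorm A y)\<^sup>2"
    using cnorm_square_le_if_commute[OF w v comm [symmetric]] sum y M.a_comm[of "star A w \<otimes> w"] v w
    by (simp add: cnorm_cstar)
  then show "cnorm A w \<le> cnorm A y"
    using cnorm_nonneg[OF y] by (rule power2_le_imp_le)
qed

definition commutes_with :: "'a \<Rightarrow> 'a \<Rightarrow> bool" where
  "commutes_with a c \<longleftrightarrow> (\<forall>y\<in>carrier A. a \<otimes> y = y \<otimes> a \<longrightarrow> c \<otimes> y = y \<otimes> c)"

text \<open>These are the closed sets in which the two fixed points below are found. Commuting with the whole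
  commutant of \<open>a\<close>, rather than with \<open>a\<close>, allows to conclude that \<open>c\<close> commutes with a square
  root of \<open>a\<close>.\<close>

lemma closedin_real_commuting:
  assumes a: "a \<in> carrier A"
  shows "closedin ms.mtopology
    {c \<in> carrier A. star A c = c \<and> commutes_with a c}"
  unfolding closedin_iff
proof (intro conjI ballI impI CollectI)
  fix x assume x: "x \<in> carrier A"
    and near: "\<forall>e>0. \<exists>y\<in>{c \<in> carrier A. star A c = c \<and> commutes_with a c}. cnorm A (x \<ominus> y) < e"
  have "cnorm A (x \<ominus> star A x) \<le> 0"
  proof (rule le_zero_if_small)
    fix e :: real assume "e > 0"
    then obtain y where y: "y \<in> carrier A" "star A y = y" "cnorm A (x \<ominus> y) < e"
      using near by auto
    have "cnorm A (x \<ominus> star A x) \<le> cnorm A (x \<ominus> y) + cnorm A (star A y \<ominus> star A x)"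
      using N_triangle_diff[of x y "star A x"] x y by simp
    also have "cnorm A (star A y \<ominus> star A x) = cnorm A (x \<ominus> y)"
      using x y cnorm_star_diff[of y x] N_diff_commute[of x y] by simp
    finally show "\<exists>d. 0 \<le> d \<and> d < e \<and> cnorm A (x \<ominus> star A x) \<le> 2 * d"
      using y x cnorm_nonneg[of "x \<ominus> y"] by (intro exI[of _ "cnorm A (x \<ominus> y)"]) simp
  qed
  then show "star A x = x"
    using x cnorm_nonneg[of "x \<ominus> star A x"] by (simp add: cnorm_eq_0 diff_0_iff)
  show "commutes_with a x"
    unfolding commutes_with_def
  proof (intro ballI impI)
    fix z assume z: "z \<in> carrier A" and az: "a \<otimes> z = z \<otimes> a"
    have "cnorm A (x \<otimes> z \<ominus> z \<otimes> x) \<le> 0"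
    proof (rule le_zero_if_small)
      fix e :: real assume "e > 0"
      then obtain y where y: "y \<in> carrier A" "y \<otimes> z = z \<otimes> y" "cnorm A (x \<ominus> y) < e"
        using near z az unfolding commutes_with_def by auto
      have "x \<otimes> z \<ominus> z \<otimes> x = (x \<ominus> y) \<otimes> z \<oplus> z \<otimes> (y \<ominus> x)"
      proof -
        have "(x \<ominus> y) \<otimes> z \<oplus> z \<otimes> (y \<ominus> x) = (x \<otimes> z \<ominus> y \<otimes> z) \<oplus> (z \<otimes> y \<ominus> z \<otimes> x)"
          using x y z by algebra
        also have "\<dots> = x \<otimes> z \<ominus> z \<otimes> x"
          unfolding y(2) using x y(1) z by algebra
        finally show ?thesis by simp
      qed
      then have "cnorm A (x \<otimes> z \<ominus> z \<otimes> x) \<le> cnorm A ((x \<ominus> y) \<otimes> z) + cnorm A (z \<otimes> (y \<ominus> x))"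
        using x y z by (simp add: cnorm_triangle)
      also have "\<dots> \<le> cnorm A (x \<ominus> y) * cnorm A z + cnorm A z * cnorm A (y \<ominus> x)"
        using x y z by (intro add_mono cnorm_mult) auto
      also have "\<dots> = 2 * cnorm A z * cnorm A (x \<ominus> y)"
        using x y N_diff_commute[of x y] by simp
      finally show "\<exists>d. 0 \<le> d \<and> d < e \<and> cnorm A (x \<otimes> z \<ominus> z \<otimes> x) \<le> 2 * cnorm A z * d"
        using y x cnorm_nonneg[of "x \<ominus> y"] by (intro exI[of _ "cnorm A (x \<ominus> y)"]) simp
    qed
    then show "x \<otimes> z = z \<otimes> x"
      using x z cnorm_nonneg[of "x \<otimes> z \<ominus> z \<otimes> x"] by (simp add: cnorm_eq_0 diff_0_iff)
  qed
qed (use assms in auto)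

lemma closedin_cnorm_ball: "closedin ms.mtopology {c \<in> carrier A. cnorm A c \<le> r}"
  unfolding closedin_iff
proof (intro conjI ballI impI CollectI)
  fix x assume x: "x \<in> carrier A"
    and near: "\<forall>e>0. \<exists>y\<in>{c \<in> carrier A. cnorm A c \<le> r}. cnorm A (x \<ominus> y) < e"
  show "cnorm A x \<le> r"
  proof (rule field_le_epsilon)
    fix e :: real assume "e > 0"
    then obtain y where "y \<in> carrier A" "cnorm A y \<le> r" "cnorm A (x \<ominus> y) < e"
      using near by auto
    then show "cnorm A x \<le> r + e"
      using N_le_diff[of x y] x by simp
  qed
qed auto

lemma commutes_with_add:
  "\<lbrakk>commutes_with a c; commutes_with a d; c \<in> carrier A; d \<in> carrier A\<rbrakk>
    \<Longrightarrow> commutes_with a (c \<oplus> d)"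
  by (simp add: commutes_with_def mult_add_left mult_add_right)

lemma commutes_with_smult:
  "\<lbrakk>commutes_with a c; c \<in> carrier A\<rbrakk> \<Longrightarrow> commutes_with a (s \<odot> c)"
  by (simp add: commutes_with_def mult_smult_left mult_smult_right)

lemma commutes_with_mult:
  assumes "commutes_with a c" "commutes_with a d" "c \<in> carrier A" "d \<in> carrier A"
  shows "commutes_with a (c \<otimes> d)"
  unfolding commutes_with_def
proof (intro ballI impI)
  fix y assume y: "y \<in> carrier A" "a \<otimes> y = y \<otimes> a"
  then have cd: "c \<otimes> y = y \<otimes> c" "d \<otimes> y = y \<otimes> d"
    using assms by (auto simp: commutes_with_def)
  have "(c \<otimes> d) \<otimes> y = c \<otimes> (y \<otimes> d)"
    using assms y by (simp add: mult_assoc cd)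
  also have "\<dots> = (c \<otimes> y) \<otimes> d"
    using assms y by (simp add: mult_assoc)
  also have "\<dots> = y \<otimes> (c \<otimes> d)"
    using assms y by (simp add: mult_assoc cd(1))
  finally show "c \<otimes> d \<otimes> y = y \<otimes> (c \<otimes> d)" .
qed

text \<open>The element is \<open>c = 1 - \<surd>(1 - a)\<close>, written so that no unit occurs. It is the fixed point of
  \<open>c \<mapsto> (a + c\<^sup>2)/2\<close>, a contraction of the ball whose radius \<open>r = 1 - \<surd>(1 - \<parallel>a\<parallel>)\<close> solves the
  corresponding scalar equation.\<close>

lemma exists_one_minus_sqrt:
  assumes a: "a \<in> carrier A" "star A a = a" and less: "cnorm A a < 1"
  shows "\<exists>c\<in>carrier A. star A c = c \<and> commutes_with a c \<and> c \<oplus> c = a \<oplus> c \<otimes> c"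
proof -
  define r where "r = 1 - sqrt (1 - cnorm A a)"
  have r: "0 \<le> r" "r < 1" "(cnorm A a + r * r) / 2 = r"
  proof -
    show "0 \<le> r"
      using cnorm_nonneg[OF a(1)] by (simp add: r_def)
    show "r < 1"
      using less by (simp add: r_def)
    have "sqrt (1 - cnorm A a) * sqrt (1 - cnorm A a) = 1 - cnorm A a"
      using less by (intro real_sqrt_mult_self[THEN trans]) simp
    then show "(cnorm A a + r * r) / 2 = r"
      unfolding r_def left_diff_distrib right_diff_distrib by (simp add: field_simps)
  qed
  define S where "S = {c \<in> carrier A. cnorm A c \<le> r} \<inter>
    {c \<in> carrier A. star A c = c \<and> commutes_with a c}"
  define T where "T c = (1/2) \<odot> (a \<oplus> c \<otimes> c)" for c
  have "\<exists>c\<in>S. T c = c"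
  proof (rule contraction_fixed_point[OF mcomplete, where r = r])
    show "closedin ms.mtopology S"
      unfolding S_def using closedin_real_commuting[OF a(1)] closedin_cnorm_ball
      by (rule closedin_Int[rotated])
    show "\<zero> \<in> S"
      using r by (simp add: S_def commutes_with_def)
    show "T c \<in> S" if "c \<in> S" for c
    proof -
      have c: "c \<in> carrier A" "cnorm A c \<le> r" "star A c = c" "commutes_with a c"
        using that by (auto simp: S_def)
      have "cnorm A (a \<oplus> c \<otimes> c) \<le> cnorm A a + cnorm A c * cnorm A c"
        using cnorm_triangle[of a "c \<otimes> c"] cnorm_mult[of c c] a c by simp
      also have "\<dots> \<le> cnorm A a + r * r"
        using c cnorm_nonneg by (intro add_left_mono mult_mono) (auto simp: r)
      finally have "cnorm A (T c) \<le> r"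
        using a c r(3) by (simp add: T_def cnorm_smult)
      moreover have "commutes_with a a"
        by (simp add: commutes_with_def)
      ultimately show ?thesis
        using a c by (simp add: S_def T_def star_smult star_add star_mult commutes_with_smult
            commutes_with_add commutes_with_mult)
    qed
    show "cnorm A (T c \<ominus> T d) \<le> r * cnorm A (c \<ominus> d)" if "c \<in> S" "d \<in> S" for c d
    proof -
      have c: "c \<in> carrier A" "cnorm A c \<le> r" and d: "d \<in> carrier A" "cnorm A d \<le> r"
        using that by (auto simp: S_def)
      have "(a \<oplus> c \<otimes> c) \<ominus> (a \<oplus> d \<otimes> d) = c \<otimes> (c \<ominus> d) \<oplus> (c \<ominus> d) \<otimes> d"
        using a(1) c(1) d(1) by algebra
      then have "T c \<ominus> T d = (1/2) \<odot> (c \<otimes> (c \<ominus> d) \<oplus> (c \<ominus> d) \<otimes> d)"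
        using a(1) c(1) d(1) by (simp add: T_def smult_diff_right [symmetric])
      then have "cnorm A (T c \<ominus> T d) = cnorm A (c \<otimes> (c \<ominus> d) \<oplus> (c \<ominus> d) \<otimes> d) / 2"
        using c(1) d(1) by (simp add: cnorm_smult)
      also have "\<dots> \<le> (cnorm A (c \<otimes> (c \<ominus> d)) + cnorm A ((c \<ominus> d) \<otimes> d)) / 2"
        using c d by (simp add: cnorm_triangle)
      also have "\<dots> \<le> (cnorm A c * cnorm A (c \<ominus> d) + cnorm A (c \<ominus> d) * cnorm A d) / 2"
        using c d cnorm_mult[of c "c \<ominus> d"] cnorm_mult[of "c \<ominus> d" d] by simp
      also have "\<dots> \<le> (r * cnorm A (c \<ominus> d) + cnorm A (c \<ominus> d) * r) / 2"
        using c d cnorm_nonneg[of "c \<ominus> d"]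
        by (intro divide_right_mono add_mono mult_left_mono mult_right_mono) auto
      finally show ?thesis
        by simp
    qed
  qed (use r in auto)
  then obtain c where c: "c \<in> carrier A" "star A c = c" "commutes_with a c" "T c = c"
    by (auto simp: S_def)
  have "c \<oplus> c = 2 \<odot> T c"
    using smult_add_left[of c 1 1] c by simp
  also have "\<dots> = a \<oplus> c \<otimes> c"
    using a c(1) by (simp add: T_def)
  finally show ?thesis
    using c by blast
qed

text \<open>In a unitization \<open>h + \<i> (1 - c)\<close> would be unitary, for \<open>h\<^sup>2 + (1 - c)\<^sup>2 = 1\<close>. Its real and
  imaginary part, \<open>h\<close> and \<open>1 - c\<close>, act as contractions by left multiplication.\<close>

lemma multiplier_contractive:
  assumes h: "h \<in> carrier A" "star A h = h" and c: "c \<in> carrier A" "star A c = c"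
    and comm: "c \<otimes> h = h \<otimes> c" and eq: "c \<oplus> c = h \<otimes> h \<oplus> c \<otimes> c"
    and y: "y \<in> carrier A"
  shows "cnorm A (h \<otimes> y) \<le> cnorm A y" "cnorm A (y \<ominus> c \<otimes> y) \<le> cnorm A y"
proof -
  let ?v = "h \<otimes> y" and ?w = "y \<ominus> c \<otimes> y" and ?y = "star A y"
  have sv: "star A ?v = ?y \<otimes> h" and sw: "star A ?w = ?y \<ominus> ?y \<otimes> c"
    using h c y by (simp_all add: star_mult star_diff)
  have y': "?y \<in> carrier A"
    using y by simp
  have "star A ?v \<otimes> ?w = ?y \<otimes> h \<otimes> y \<ominus> ?y \<otimes> (h \<otimes> c) \<otimes> y"
    unfolding sv using h(1) c(1) y y' by algebra
  also have "\<dots> = star A ?w \<otimes> ?v"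
    unfolding sw comm [symmetric] using h(1) c(1) y y' by algebra
  finally have 1: "star A ?v \<otimes> ?w = star A ?w \<otimes> ?v" .
  have "star A ?v \<otimes> ?v \<oplus> star A ?w \<otimes> ?w =
      ?y \<otimes> y \<ominus> ?y \<otimes> (c \<oplus> c) \<otimes> y \<oplus> ?y \<otimes> (h \<otimes> h \<oplus> c \<otimes> c) \<otimes> y"
    unfolding sv sw using h(1) c(1) y y' by algebra
  also have "\<dots> = ?y \<otimes> y"
    unfolding eq using h(1) c(1) y y' by algebra
  finally have 2: "star A ?v \<otimes> ?v \<oplus> star A ?w \<otimes> ?w = star A y \<otimes> y" .
  show "cnorm A (h \<otimes> y) \<le> cnorm A y" "cnorm A (y \<ominus> c \<otimes> y) \<le> cnorm A y"
    using cnorm_le_if_squares_add[OF _ _ y 1 2] h c y by auto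
qed

lemma cnorm_le_1_if_contractive:
  assumes h: "h \<in> carrier A" "star A h = h"
    and le: "\<And>y. y \<in> carrier A \<Longrightarrow> cnorm A (h \<otimes> y) \<le> K * cnorm A y"
  shows "cnorm A h \<le> K \<or> h = \<zero>"
proof (cases "h = \<zero>")
  case False
  then have pos: "cnorm A h > 0"
    using cnorm_nonneg[OF h(1)] cnorm_eq_0[OF h(1)] by linarith
  have "cnorm A h * cnorm A h \<le> K * cnorm A h"
    using le[OF h(1)] cnorm_cstar[OF h(1)] h by (simp add: power2_eq_square)
  then show ?thesis
    using pos by simp
qed simp

lemma exists_multiplier_sqrt:
  assumes h: "h \<in> carrier A" "star A h = h" "cnorm A h < 1"
  shows "\<exists>c\<in>carrier A. star A c = c \<and> c \<otimes> h = h \<otimes> c \<and> c \<oplus> c = h \<otimes> h \<oplus> c \<otimes> c"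
proof -
  have "cnorm A (h \<otimes> h) < 1"
    using cnorm_cstar[OF h(1)] h(2,3) cnorm_nonneg[OF h(1)] by (simp add: abs_square_less_1)
  then obtain c where c: "c \<in> carrier A" "star A c = c" "commutes_with (h \<otimes> h) c"
      "c \<oplus> c = h \<otimes> h \<oplus> c \<otimes> c"
    using exists_one_minus_sqrt[of "h \<otimes> h"] h by (auto simp: star_mult)
  have "c \<otimes> h = h \<otimes> c"
    using c(3) h by (simp add: commutes_with_def mult_assoc)
  then show ?thesis
    using c by blast
qed

lemma cnorm_minus_square_mult_le:
  assumes h: "h \<in> carrier A" "star A h = h" "cnorm A h < 1" and y: "y \<in> carrier A"
  shows "cnorm A (y \<ominus> h \<otimes> (h \<otimes> y)) \<le> cnorm A y"
proof -
  obtain c where c: "c \<in> carrier A" "star A c = c" "c \<otimes> h = h \<otimes> c"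
      and eq: "c \<oplus> c = h \<otimes> h \<oplus> c \<otimes> c"
    using exists_multiplier_sqrt[OF h] by blast
  let ?w = "y \<ominus> c \<otimes> y"
  have "?w \<ominus> c \<otimes> ?w = y \<ominus> (c \<oplus> c) \<otimes> y \<oplus> (c \<otimes> c) \<otimes> y"
    using c(1) y by algebra
  also have "\<dots> = y \<ominus> h \<otimes> (h \<otimes> y)"
    unfolding eq using c(1) h(1) y by algebra
  finally have "cnorm A (y \<ominus> h \<otimes> (h \<otimes> y)) = cnorm A (?w \<ominus> c \<otimes> ?w)"
    by simp
  also have "\<dots> \<le> cnorm A ?w"
    using multiplier_contractive(2)[OF h(1,2) c eq, of ?w] c y by simp
  also have "\<dots> \<le> cnorm A y"
    using multiplier_contractive(2)[OF h(1,2) c eq y] .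
  finally show ?thesis .
qed

text \<open>The element is \<open>e = k\<^sup>2 (1 + k\<^sup>2)\<^sup>-\<^sup>1\<close>. The element \<open>1 + k\<^sup>2\<close> need not be close to 1; but with
  \<open>K > \<parallel>k\<parallel>\<close> the operator \<open>y \<mapsto> K\<^sup>2 y - k\<^sup>2 y\<close> has norm at most \<open>K\<^sup>2\<close> by
  \<open>cnorm_minus_square_mult_le\<close>, so the Neumann iteration for \<open>(K\<^sup>2 + 1) - (K\<^sup>2 - k\<^sup>2)\<close> converges.\<close>

lemma exists_resolvent:
  assumes k: "k \<in> carrier A" "star A k = k"
  shows "\<exists>e\<in>carrier A. star A e = e \<and> e \<otimes> k = k \<otimes> e \<and> e \<oplus> k \<otimes> (k \<otimes> e) = k \<otimes> k"
proof -
  define K where "K = cnorm A k + 1"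
  have K: "K > 0" "cnorm A k < K"
    using cnorm_nonneg[OF k(1)] by (auto simp: K_def)
  define t :: complex where "t = of_real (1 / (K\<^sup>2 + 1))"
  have t: "cmod t = 1 / (K\<^sup>2 + 1)" "t * (of_real K)\<^sup>2 + t = 1" "cnj t = t"
  proof -
    have "of_real (1 / (K\<^sup>2 + 1) * K\<^sup>2 + 1 / (K\<^sup>2 + 1)) = (1 :: complex)"
      by (simp only: of_real_eq_1_iff) (simp add: field_simps add_nonneg_eq_0_iff)
    then show "t * (of_real K)\<^sup>2 + t = 1"
      by (simp add: t_def)
    show "cmod t = 1 / (K\<^sup>2 + 1)"
      unfolding t_def norm_of_real by simp
  qed (simp add: t_def)
  define u :: complex where "u = (of_real K)\<^sup>2"
  have u: "cmod u = K\<^sup>2" "cnj u = u" "u \<noteq> 0"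
    using K by (auto simp: u_def norm_power)
  define S where "S = {e \<in> carrier A. star A e = e \<and> commutes_with k e}"
  \<comment> \<open>\<open>u = K\<^sup>2\<close> and \<open>t = 1/(K\<^sup>2 + 1)\<close> as complex scalars; \<open>L\<close> is multiplication by \<open>K\<^sup>2 - k\<^sup>2\<close>.\<close>
  define L where "L e = u \<odot> e \<ominus> k \<otimes> (k \<otimes> e)" for e
  define T where "T e = t \<odot> (k \<otimes> k \<oplus> L e)" for e
  have L_closed [simp]: "L e \<in> carrier A" if "e \<in> carrier A" for e
    using that k by (simp add: L_def)
  have L_norm: "cnorm A (L y) \<le> K\<^sup>2 * cnorm A y" if y: "y \<in> carrier A" for y
  proof -
    let ?h = "of_real (1 / K) \<odot> k"
    have "star A ?h = ?h"
      using k by (simp add: star_smult)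
    moreover have "cnorm A ?h < 1"
      using k K by (simp add: cnorm_smult norm_divide)
    ultimately have "cnorm A (y \<ominus> ?h \<otimes> (?h \<otimes> y)) \<le> cnorm A y"
      using k y by (intro cnorm_minus_square_mult_le) auto
    moreover have "L y = u \<odot> (y \<ominus> ?h \<otimes> (?h \<otimes> y))"
      using k y u(3)
      by (simp add: L_def smult_diff_right mult_smult_left mult_smult_right u_def power2_eq_square)
    ultimately show ?thesis
      using k y u(1) by (simp add: cnorm_smult mult_left_mono)
  qed
  have "\<exists>e\<in>S. T e = e"
  proof (rule contraction_fixed_point[OF mcomplete, where r = "K\<^sup>2 / (K\<^sup>2 + 1)"])
    show "closedin ms.mtopology S"
      unfolding S_def by (rule closedin_real_commuting[OF k(1)])
    show "\<zero> \<in> S"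
      by (simp add: S_def commutes_with_def)
    show "T e \<in> S" if "e \<in> S" for e
    proof -
      have e: "e \<in> carrier A" "star A e = e" "commutes_with k e"
        using that by (auto simp: S_def)
      have ek: "e \<otimes> k = k \<otimes> e"
        using e(3) k by (simp add: commutes_with_def)
      have "(e \<otimes> k) \<otimes> k = k \<otimes> (k \<otimes> e)"
        unfolding ek using k e ek by (simp add: mult_assoc)
      then have "star A (T e) = T e"
        using k e t(3) u(2)
        by (simp add: T_def L_def star_smult star_add star_diff star_mult mult_assoc)
      moreover have "commutes_with k k"
        by (simp add: commutes_with_def)
      then have "commutes_with k (T e)"
        unfolding T_def L_def using k e
        by (simp add: diff_eq_smult commutes_with_smult commutes_with_add commutes_with_mult)
      ultimately show ?thesis
        using k e by (simp add: S_def T_def)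
    qed
    show "cnorm A (T x \<ominus> T y) \<le> K\<^sup>2 / (K\<^sup>2 + 1) * cnorm A (x \<ominus> y)" if "x \<in> S" "y \<in> S" for x y
    proof -
      have x: "x \<in> carrier A" and y: "y \<in> carrier A"
        using that by (auto simp: S_def)
      have "L (x \<ominus> y) = (k \<otimes> k \<oplus> L x) \<ominus> (k \<otimes> k \<oplus> L y)"
      proof -
        have "L (x \<ominus> y) = u \<odot> x \<ominus> u \<odot> y \<ominus> k \<otimes> (k \<otimes> (x \<ominus> y))"
          using x y by (simp add: L_def smult_diff_right)
        also have "\<dots> = (k \<otimes> k \<oplus> L x) \<ominus> (k \<otimes> k \<oplus> L y)"
          unfolding L_def using smult_in[OF x, of u] smult_in[OF y, of u] x y k(1) by algebra
        finally show ?thesis .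
      qed
      then have "T x \<ominus> T y = t \<odot> L (x \<ominus> y)"
        using x y k by (simp add: T_def smult_diff_right)
      then show ?thesis
        using L_norm[of "x \<ominus> y"] x y t(1)
        by (simp add: cnorm_smult divide_right_mono)
    qed
  qed (use K in \<open>auto simp: divide_simps add_pos_nonneg\<close>)
  then obtain e where e: "e \<in> carrier A" "star A e = e" "commutes_with k e" "T e = e"
    by (auto simp: S_def)
  have ek: "e \<otimes> k = k \<otimes> e"
    using e(3) k by (simp add: commutes_with_def)
  have "e \<oplus> k \<otimes> (k \<otimes> e) = k \<otimes> k"
  proof -
    have "u + 1 \<noteq> 0"
    proof
      assume "u + 1 = 0"
      then have "of_real (K\<^sup>2 + 1) = (0 :: complex)" by (simp add: u_def)
      then have "K\<^sup>2 + 1 = 0" by (simp only: of_real_eq_0_iff)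
      then show False by (simp add: add_nonneg_eq_0_iff)
    qed
    moreover have "t * (u + 1) = 1"
      using t(2) by (simp add: u_def algebra_simps)
    ultimately have "(u + 1) * t = 1"
      by (simp add: mult.commute)
    then have "(u + 1) \<odot> T e = k \<otimes> k \<oplus> L e"
      using k e(1) by (simp add: T_def)
    then have "(u + 1) \<odot> e = k \<otimes> k \<oplus> L e"
      by (simp add: e(4))
    then have "u \<odot> e \<oplus> e = k \<otimes> k \<oplus> (u \<odot> e \<ominus> k \<otimes> (k \<otimes> e))"
      using e by (simp add: smult_add_left L_def)
    then have *: "u \<odot> e \<oplus> e \<oplus> k \<otimes> (k \<otimes> e) \<ominus> u \<odot> e =
        k \<otimes> k \<oplus> (u \<odot> e \<ominus> k \<otimes> (k \<otimes> e)) \<oplus> k \<otimes> (k \<otimes> e) \<ominus> u \<odot> e"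
      by simp
    have "e \<oplus> k \<otimes> (k \<otimes> e) = u \<odot> e \<oplus> e \<oplus> k \<otimes> (k \<otimes> e) \<ominus> u \<odot> e"
      using k(1) e(1) smult_in[OF e(1), of u] by algebra
    also have "\<dots> = k \<otimes> k"
      unfolding * using k(1) e(1) smult_in[OF e(1), of u] by algebra
    finally show ?thesis .
  qed
  then show ?thesis
    using e ek by blast
qed

text \<open>With \<open>k = h/d\<close>, let \<open>e = k\<^sup>2/(1 + k\<^sup>2)\<close> and \<open>f = k - k e = k/(1 + k\<^sup>2)\<close>. The Cayley transform
  \<open>(1 + \<i> k)/(1 - \<i> k)\<close> has real part \<open>1 - 2e\<close> and imaginary part \<open>2f\<close>. Both are therefore
  contractions. This bounds \<open>e\<close>, and also \<open>h - e h = d f\<close>.\<close>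

lemma approximate_unit_selfadjoint:
  assumes h: "h \<in> carrier A" "star A h = h" and d: "d > 0"
  shows "\<exists>e\<in>carrier A. star A e = e \<and> e \<otimes> h = h \<otimes> e \<and> cnorm A e \<le> 1 \<and> cnorm A (h \<ominus> e \<otimes> h) \<le> d"
proof -
  define k where "k = of_real (1 / d) \<odot> h"
  have k: "k \<in> carrier A" "star A k = k"
    using h by (auto simp: k_def star_smult)
  have hk: "h = of_real d \<odot> k"
    using h d by (simp add: k_def)
  obtain e where e: "e \<in> carrier A" "star A e = e" and ek: "e \<otimes> k = k \<otimes> e"
      and eq: "e \<oplus> k \<otimes> (k \<otimes> e) = k \<otimes> k"
    using exists_resolvent[OF k] by blast
  define f where "f = k \<ominus> k \<otimes> e"
  have f: "f \<in> carrier A" "star A f = f"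
    using k e by (auto simp: f_def star_diff star_mult ek)
  have kf: "k \<otimes> f = e"
  proof -
    have "k \<otimes> f = (k \<otimes> k) \<ominus> k \<otimes> (k \<otimes> e)"
      unfolding f_def using k(1) e(1) by algebra
    also have "\<dots> = e"
      unfolding eq [symmetric] using k(1) e(1) by algebra
    finally show ?thesis .
  qed
  have ef: "e \<otimes> f = f \<otimes> e"
  proof -
    have "e \<otimes> f = e \<otimes> k \<ominus> (e \<otimes> k) \<otimes> e"
      unfolding f_def using k(1) e(1) by algebra
    also have "\<dots> = f \<otimes> e"
      unfolding ek f_def using k(1) e(1) by algebra
    finally show ?thesis .
  qed
  have kf': "f = k \<ominus> e \<otimes> k"
    by (simp add: f_def ek)
  have ff: "f \<otimes> f = e \<ominus> e \<otimes> e"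
  proof -
    have "f \<otimes> f = (k \<ominus> e \<otimes> k) \<otimes> f"
      by (simp add: kf' [symmetric])
    also have "\<dots> = k \<otimes> f \<ominus> e \<otimes> (k \<otimes> f)"
      using k(1) e(1) f(1) by algebra
    finally show ?thesis
      by (simp add: kf)
  qed
  \<comment> \<open>With \<open>g = 2e\<close> and \<open>q = 2f\<close>, the relation \<open>q\<^sup>2 + (1 - g)\<^sup>2 = 1\<close> holds because \<open>f\<^sup>2 = e - e\<^sup>2\<close>.\<close>
  define g q where "g = e \<oplus> e" and "q = f \<oplus> f"
  have g: "g \<in> carrier A" "star A g = g" and q: "q \<in> carrier A" "star A q = q"
    using e f by (auto simp: g_def q_def star_add)
  have gq: "g \<otimes> q = q \<otimes> g"
    using e(1) f(1) by (simp add: g_def q_def mult_add_left mult_add_right ef)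
  have "q \<otimes> q \<oplus> g \<otimes> g = (f \<otimes> f \<oplus> f \<otimes> f) \<oplus> (f \<otimes> f \<oplus> f \<otimes> f) \<oplus> g \<otimes> g"
    using f(1) g(1) unfolding q_def by (simp add: mult_add_left mult_add_right M.a_ac)
  also have "\<dots> = g \<oplus> g"
    unfolding ff g_def using e(1) by algebra
  finally have gg: "g \<oplus> g = q \<otimes> q \<oplus> g \<otimes> g" ..
  have bounds: "cnorm A (y \<ominus> g \<otimes> y) \<le> cnorm A y" "cnorm A (q \<otimes> y) \<le> cnorm A y"
    if y: "y \<in> carrier A" for y
    using multiplier_contractive[OF q g gq gg y] by auto
  have two: "z \<oplus> z = 2 \<odot> z" if "z \<in> carrier A" for z
    using smult_add_left[of z 1 1] that by simp
  have "cnorm A (e \<otimes> y) \<le> 1 * cnorm A y" if y: "y \<in> carrier A" for y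
  proof -
    have "e \<otimes> y \<oplus> e \<otimes> y = y \<ominus> (y \<ominus> g \<otimes> y)"
      unfolding g_def using e(1) y by algebra
    then have "2 * cnorm A (e \<otimes> y) = cnorm A (y \<ominus> (y \<ominus> g \<otimes> y))"
      using two[of "e \<otimes> y"] e y cnorm_smult[of "e \<otimes> y" 2] by simp
    also have "\<dots> \<le> cnorm A y + cnorm A y"
      using N_minus_le[of y "y \<ominus> g \<otimes> y"] bounds(1)[OF y] g y by simp
    finally show ?thesis by simp
  qed
  then have "cnorm A e \<le> 1"
    using cnorm_le_1_if_contractive[OF e, of 1] by auto
  moreover have "cnorm A (f \<otimes> y) \<le> 1 * cnorm A y" if y: "y \<in> carrier A" for y
    using bounds(2)[OF y] two[of "f \<otimes> y"] f y mult_add_left[of f f y] q_def cnorm_smult[of "f \<otimes> y" 2] cnorm_nonneg[of "f \<otimes> y"]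
    by simp
  then have "cnorm A f \<le> 1"
    using cnorm_le_1_if_contractive[OF f, of 1] by auto
  moreover have "h \<ominus> e \<otimes> h = of_real d \<odot> f"
    using k e by (simp add: hk kf' mult_smult_right smult_diff_right)
  then have "cnorm A (h \<ominus> e \<otimes> h) = d * cnorm A f"
    using f d by (simp add: cnorm_smult)
  moreover have "e \<otimes> h = h \<otimes> e"
    using k e ek by (simp add: hk mult_smult_right mult_smult_left)
  ultimately show ?thesis
    using e d by (intro bexI[of _ e]) (auto simp: mult_left_le)
qed

text \<open>Apply the self-adjoint case to \<open>x x\<^sup>*\<close>; the square of the norm of \<open>x - e x\<close> is the norm of
  \<open>(1 - e) x x\<^sup>* (1 - e)\<close>.\<close>

lemma approximate_unit:
  assumes x: "x \<in> carrier A" and d: "d > 0"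
  shows "\<exists>e\<in>carrier A. star A e = e \<and> cnorm A e \<le> 1 \<and> cnorm A (x \<ominus> e \<otimes> x) < d"
proof -
  define h where "h = x \<otimes> star A x"
  have h: "h \<in> carrier A" "star A h = h"
    using x by (auto simp: h_def star_mult)
  obtain e where e: "e \<in> carrier A" "star A e = e" "e \<otimes> h = h \<otimes> e" "cnorm A e \<le> 1"
      and le: "cnorm A (h \<ominus> e \<otimes> h) \<le> d\<^sup>2 / 4"
    using approximate_unit_selfadjoint[OF h, of "d\<^sup>2 / 4"] d by auto
  \<comment> \<open>Passing to the adjoint puts \<open>x x\<^sup>*\<close> rather than \<open>x\<^sup>* x\<close> in the middle of \<open>z\<^sup>* z\<close>.\<close>
  define z where "z = star A (x \<ominus> e \<otimes> x)"
  have z: "z = star A x \<ominus> star A x \<otimes> e" "z \<in> carrier A"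
    using x e by (auto simp: z_def star_diff star_mult)
  have "star A z \<otimes> z = (h \<ominus> e \<otimes> h) \<ominus> (h \<ominus> e \<otimes> h) \<otimes> e"
  proof -
    have "star A z = x \<ominus> e \<otimes> x" using x e by (simp add: z_def)
    then show ?thesis
      unfolding z(1) h_def using x e(1) star_closed[OF x] by algebra
  qed
  then have "(cnorm A z)\<^sup>2 = cnorm A ((h \<ominus> e \<otimes> h) \<ominus> (h \<ominus> e \<otimes> h) \<otimes> e)"
    using cnorm_cstar[OF z(2)] by simp
  also have "\<dots> \<le> cnorm A (h \<ominus> e \<otimes> h) + cnorm A (h \<ominus> e \<otimes> h) * cnorm A e"
    using N_minus_le[of "h \<ominus> e \<otimes> h" "(h \<ominus> e \<otimes> h) \<otimes> e"] cnorm_mult[of "h \<ominus> e \<otimes> h" e] h e by simp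
  also have "\<dots> \<le> d\<^sup>2 / 4 + d\<^sup>2 / 4 * 1"
    using le e cnorm_nonneg[of e] by (intro add_mono mult_mono) auto
  also have "\<dots> < d\<^sup>2"
    using d by simp
  finally have "cnorm A z < d"
    using d by (simp add: power2_less_imp_less)
  moreover have "cnorm A z = cnorm A (x \<ominus> e \<otimes> x)"
    using x e by (simp add: z_def)
  ultimately show ?thesis
    using e by auto
qed

text \<open>The operator inequality \<open>x\<^sup>* x \<le> K\<^sup>2\<close> in the form in which positive functionals can use it: the
  difference, multiplied by \<open>y\<^sup>*\<close> and \<open>y\<close>, is a square. If \<open>(1 - c)\<^sup>2 = 1 - x\<^sup>* x / K\<^sup>2\<close>,
  then \<open>w = K (1 - c) y\<close>.\<close>

lemma exists_square_complement:
  assumes x: "x \<in> carrier A" and K: "K > cnorm A x" and y: "y \<in> carrier A"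
  shows "\<exists>w\<in>carrier A. star A w \<otimes> w =
    of_real (K\<^sup>2) \<odot> (star A y \<otimes> y) \<ominus> star A (x \<otimes> y) \<otimes> (x \<otimes> y)"
proof -
  have Kpos: "K > 0"
    using K cnorm_nonneg[OF x] by linarith
  define a where "a = of_real (1 / K\<^sup>2) \<odot> (star A x \<otimes> x)"
  have a: "a \<in> carrier A" "star A a = a"
    using x by (auto simp: a_def star_smult star_mult)
  have "(cnorm A x)\<^sup>2 < K\<^sup>2"
    using K cnorm_nonneg[OF x] by (intro power_strict_mono) auto
  then have "cnorm A a < 1"
    using x Kpos by (simp add: a_def cnorm_smult cnorm_cstar norm_divide norm_power)
  then obtain c where c: "c \<in> carrier A" "star A c = c" and eq: "c \<oplus> c = a \<oplus> c \<otimes> c"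
    using exists_one_minus_sqrt[OF a] by blast
  define w where "w = y \<ominus> c \<otimes> y"
  let ?y = "star A y"
  have w: "w \<in> carrier A"
    using y c by (simp add: w_def)
  have y': "?y \<in> carrier A"
    using y by simp
  have "star A w \<otimes> w = (?y \<ominus> ?y \<otimes> c) \<otimes> (y \<ominus> c \<otimes> y)"
    using y c by (simp add: w_def star_diff star_mult)
  also have "\<dots> = ?y \<otimes> y \<ominus> ?y \<otimes> (c \<oplus> c) \<otimes> y \<oplus> ?y \<otimes> (c \<otimes> c) \<otimes> y"
    using y y' c(1) by algebra
  also have "\<dots> = ?y \<otimes> y \<ominus> ?y \<otimes> a \<otimes> y"
    unfolding eq using y y' c(1) a(1) by algebra
  finally have ww: "star A w \<otimes> w = ?y \<otimes> y \<ominus> ?y \<otimes> a \<otimes> y" .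
  have "star A (of_real K \<odot> w) \<otimes> (of_real K \<odot> w) = of_real (K\<^sup>2) \<odot> (star A w \<otimes> w)"
    using w by (simp add: star_smult mult_smult_left mult_smult_right power2_eq_square)
  also have "\<dots> = of_real (K\<^sup>2) \<odot> (?y \<otimes> y) \<ominus> star A (x \<otimes> y) \<otimes> (x \<otimes> y)"
    using x y a Kpos unfolding ww
    by (simp add: smult_diff_right a_def mult_smult_left mult_smult_right star_mult mult_assoc)
  finally show ?thesis
    using w by (intro bexI[of _ "of_real K \<odot> w"]) auto
qed

end

lemma star_homD:
  assumes "h \<in> star_hom A B"
  shows "x \<in> carrier A \<Longrightarrow> h x \<in> carrier B"
    and "\<lbrakk>x \<in> carrier A; y \<in> carrier A\<rbrakk> \<Longrightarrow> h (x \<otimes>\<^bsub>A\<^esub> y) = h x \<otimes>\<^bsub>B\<^esub> h y"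
    and "\<lbrakk>x \<in> carrier A; y \<in> carrier A\<rbrakk> \<Longrightarrow> h (x \<oplus>\<^bsub>A\<^esub> y) = h x \<oplus>\<^bsub>B\<^esub> h y"
    and "x \<in> carrier A \<Longrightarrow> h (c \<odot>\<^bsub>A\<^esub> x) = c \<odot>\<^bsub>B\<^esub> h x"
    and "x \<in> carrier A \<Longrightarrow> h (star A x) = star B (h x)"
  using assms by (auto simp: star_hom_def hom_def)

lemma star_homI:
  assumes "\<And>x. x \<in> carrier A \<Longrightarrow> h x \<in> carrier B"
    and "\<And>x y. \<lbrakk>x \<in> carrier A; y \<in> carrier A\<rbrakk> \<Longrightarrow> h (x \<otimes>\<^bsub>A\<^esub> y) = h x \<otimes>\<^bsub>B\<^esub> h y"
    and "\<And>x y. \<lbrakk>x \<in> carrier A; y \<in> carrier A\<rbrakk> \<Longrightarrow> h (x \<oplus>\<^bsub>A\<^esub> y) = h x \<oplus>\<^bsub>B\<^esub> h y"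
    and "\<And>c x. x \<in> carrier A \<Longrightarrow> h (c \<odot>\<^bsub>A\<^esub> x) = c \<odot>\<^bsub>B\<^esub> h x"
    and "\<And>x. x \<in> carrier A \<Longrightarrow> h (star A x) = star B (h x)"
  shows "h \<in> star_hom A B"
  using assms by (auto simp: star_hom_def hom_def)

locale cstar_hom = A: cstar_algebra A + B: cstar_algebra B
  for A :: "'a cstar" and B :: "'b cstar" and h +
  assumes hom: "h \<in> star_hom A B"
begin

lemmas hom_simps [simp] = star_homD[OF hom]

lemma hom_zero [simp]: "h \<zero>\<^bsub>A\<^esub> = \<zero>\<^bsub>B\<^esub>"
  using hom_simps(4)[of "\<zero>\<^bsub>A\<^esub>" 0] hom_simps(1)[of "\<zero>\<^bsub>A\<^esub>"] by (simp del: hom_simps)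

lemma hom_diff:
  "\<lbrakk>x \<in> carrier A; y \<in> carrier A\<rbrakk> \<Longrightarrow> h (x \<ominus>\<^bsub>A\<^esub> y) = h x \<ominus>\<^bsub>B\<^esub> h y"
  by (simp add: A.diff_eq_smult B.diff_eq_smult)

text \<open>The element \<open>c\<close> with \<open>(1 - c)\<^sup>2 = 1 - x\<^sup>2\<close> is mapped to an element with the same algebraic
  relation to \<open>h x\<close>, and this relation alone implies that \<open>h x\<close> is a contraction.\<close>

lemma contractive_selfadjoint:
  assumes x: "x \<in> carrier A" "star A x = x" "cnorm A x < 1"
  shows "cnorm B (h x) \<le> 1"
proof -
  obtain c where c: "c \<in> carrier A" "star A c = c" "c \<otimes>\<^bsub>A\<^esub> x = x \<otimes>\<^bsub>A\<^esub> c"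
      "c \<oplus>\<^bsub>A\<^esub> c = x \<otimes>\<^bsub>A\<^esub> x \<oplus>\<^bsub>A\<^esub> c \<otimes>\<^bsub>A\<^esub> c"
    using A.exists_multiplier_sqrt[OF x] by blast
  have eqs: "h c \<otimes>\<^bsub>B\<^esub> h x = h x \<otimes>\<^bsub>B\<^esub> h c"
      "h c \<oplus>\<^bsub>B\<^esub> h c = h x \<otimes>\<^bsub>B\<^esub> h x \<oplus>\<^bsub>B\<^esub> h c \<otimes>\<^bsub>B\<^esub> h c"
    using arg_cong[OF c(3), of h] arg_cong[OF c(4), of h] c(1) x(1) by simp_all
  have sx: "star B (h x) = h x" "star B (h c) = h c"
    using hom_simps(5)[of x] hom_simps(5)[of c] c x by simp_all
  have "cnorm B (h x \<otimes>\<^bsub>B\<^esub> y) \<le> 1 * cnorm B y" if "y \<in> carrier B" for y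
    using B.multiplier_contractive(1)[OF _ sx(1) _ sx(2) eqs that] c(1) x(1) by simp
  then show ?thesis
    using B.cnorm_le_1_if_contractive[OF _ sx(1), of 1] x(1) by auto
qed

theorem contractive:
  assumes x: "x \<in> carrier A"
  shows "cnorm B (h x) \<le> cnorm A x"
proof -
  have sa: "cnorm B (h y) \<le> cnorm A y" if y: "y \<in> carrier A" "star A y = y" for y
  proof (rule field_le_epsilon)
    fix e :: real assume "e > 0"
    define K where "K = cnorm A y + e"
    have K: "K > 0" "cnorm A y < K"
      using A.cnorm_nonneg[OF y(1)] \<open>e > 0\<close> by (auto simp: K_def)
    have "cnorm B (h (of_real (1 / K) \<odot>\<^bsub>A\<^esub> y)) \<le> 1"
      using y K by (intro contractive_selfadjoint)
        (auto simp: A.star_smult A.cnorm_smult norm_divide)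
    then show "cnorm B (h y) \<le> cnorm A y + e"
      using y K by (simp add: B.cnorm_smult norm_divide K_def [symmetric])
  qed
  have "(cnorm B (h x))\<^sup>2 \<le> (cnorm A x)\<^sup>2"
    using sa[of "star A x \<otimes>\<^bsub>A\<^esub> x"] x A.cnorm_cstar[OF x] B.cnorm_cstar[of "h x"]
    by (simp add: A.star_mult)
  then show ?thesis
    using A.cnorm_nonneg[OF x] by (rule power2_le_imp_le)
qed

end

section \<open>Inner products and Hilbert spaces\<close>

text \<open>The discriminant argument behind the Cauchy-Schwarz inequality, isolated because it also gives
  near-orthogonality for almost minimal distances in \<open>orthogonal_projection\<close>.\<close>

lemma quadratic_bound:
  fixes a c :: real and b :: complex
  assumes nonneg: "\<And>t. 0 \<le> a - 2 * Re (cnj t * b) + (cmod t)\<^sup>2 * c" and c: "0 \<le> c"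
  shows "(cmod b)\<^sup>2 \<le> a * c"
proof (cases "c = 0")
  case True
  have "b = 0"
  proof (rule ccontr)
    assume "b \<noteq> 0"
    define s where "s = (a + 1) / (2 * (cmod b)\<^sup>2)"
    have "Re (cnj (of_real s * b) * b) = s * (cmod b)\<^sup>2"
      unfolding cmod_power2 by (simp add: power2_eq_square algebra_simps)
    then have "0 \<le> a - 2 * (s * (cmod b)\<^sup>2)"
      using nonneg[of "of_real s * b"] True by simp
    then show False
      using \<open>b \<noteq> 0\<close> by (simp add: s_def)
  qed
  then show ?thesis
    using nonneg[of 0] True by simp
next
  case False
  then have c: "c > 0"
    using c by simp
  have 1: "Re (cnj (b / of_real c) * b) = (cmod b)\<^sup>2 / c"
    unfolding cmod_power2 by (simp add: power2_eq_square field_simps add_divide_distrib)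
  have 2: "(cmod (b / of_real c))\<^sup>2 * c = (cmod b)\<^sup>2 / c"
    using c by (simp add: norm_divide power_divide power2_eq_square)
  show ?thesis
    using nonneg[of "b / of_real c"] c unfolding 1 2 by (simp add: field_simps)
qed

locale semi_ip = complex_module +
  fixes s :: "'a \<Rightarrow> 'a \<Rightarrow> complex"
  assumes s_add_left: "\<lbrakk>x \<in> carrier V; y \<in> carrier V; z \<in> carrier V\<rbrakk> \<Longrightarrow>
      s (x \<oplus> y) z = s x z + s y z"
    and s_smult_left: "\<lbrakk>x \<in> carrier V; y \<in> carrier V\<rbrakk> \<Longrightarrow> s (c \<odot> x) y = c * s x y"
    and s_cnj: "\<lbrakk>x \<in> carrier V; y \<in> carrier V\<rbrakk> \<Longrightarrow> s y x = cnj (s x y)"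
    and s_nonneg: "x \<in> carrier V \<Longrightarrow> s x x \<in> \<real>\<^sub>\<ge>\<^sub>0"
begin

definition sn :: "'a \<Rightarrow> real" where
  "sn x = sqrt (Re (s x x))"

lemma s_add_right:
  "\<lbrakk>x \<in> carrier V; y \<in> carrier V; z \<in> carrier V\<rbrakk> \<Longrightarrow> s z (x \<oplus> y) = s z x + s z y"
  using s_cnj[of "x \<oplus> y" z] s_cnj[of x z] s_cnj[of y z] s_add_left[of x y z] by simp

lemma s_smult_right:
  "\<lbrakk>x \<in> carrier V; y \<in> carrier V\<rbrakk> \<Longrightarrow> s y (c \<odot> x) = cnj c * s y x"
  using s_cnj[of "c \<odot> x" y] s_cnj[of x y] s_smult_left[of x y c] by simp

lemma s_zero_left [simp]: "x \<in> carrier V \<Longrightarrow> s \<zero> x = 0"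
  using s_smult_left[of "\<zero>" x 0] by simp

lemma s_zero_right [simp]: "x \<in> carrier V \<Longrightarrow> s x \<zero> = 0"
  using s_smult_right[of "\<zero>" x 0] by simp

lemma s_diff_left:
  "\<lbrakk>x \<in> carrier V; y \<in> carrier V; z \<in> carrier V\<rbrakk> \<Longrightarrow> s (x \<ominus> y) z = s x z - s y z"
  by (simp add: diff_eq_smult s_add_left s_smult_left)

lemma s_diff_right:
  "\<lbrakk>x \<in> carrier V; y \<in> carrier V; z \<in> carrier V\<rbrakk> \<Longrightarrow> s z (x \<ominus> y) = s z x - s z y"
  by (simp add: diff_eq_smult s_add_right s_smult_right)

lemmas s_linear = s_add_left s_add_right s_smult_left s_smult_right s_diff_left s_diff_right

lemma Re_s_nonneg: "x \<in> carrier V \<Longrightarrow> 0 \<le> Re (s x x)"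
  using s_nonneg[of x] by (simp add: complex_nonneg_Reals_iff)

lemma sn_nonneg: "x \<in> carrier V \<Longrightarrow> 0 \<le> sn x"
  using Re_s_nonneg[of x] by (simp add: sn_def)

lemma sn_square: "x \<in> carrier V \<Longrightarrow> (sn x)\<^sup>2 = Re (s x x)"
  using Re_s_nonneg[of x] by (simp add: sn_def)

lemma s_self: "x \<in> carrier V \<Longrightarrow> s x x = of_real ((sn x)\<^sup>2)"
  using s_nonneg[of x] by (simp add: sn_square complex_eq_iff complex_nonneg_Reals_iff)

lemma sn_square_diff_smult:
  assumes x: "x \<in> carrier V" and z: "z \<in> carrier V"
  shows "(sn (x \<ominus> t \<odot> z))\<^sup>2 = (sn x)\<^sup>2 - 2 * Re (cnj t * s x z) + (cmod t)\<^sup>2 * (sn z)\<^sup>2"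
proof -
  have "s (x \<ominus> t \<odot> z) (x \<ominus> t \<odot> z) =
      s x x - (cnj t * s x z + cnj (cnj t * s x z)) + (t * cnj t) * s z z"
  proof -
    have "s z x = cnj (s x z)"
      by (rule s_cnj[OF x z])
    then show ?thesis
      using x z by (simp add: s_linear) (simp add: algebra_simps)
  qed
  also have "\<dots> = of_real ((sn x)\<^sup>2 - 2 * Re (cnj t * s x z) + (cmod t)\<^sup>2 * (sn z)\<^sup>2)"
    unfolding complex_add_cnj s_self[OF x] s_self[OF z] complex_norm_square [symmetric] by simp
  finally show ?thesis
    using x z by (simp add: sn_square)
qed

lemma cauchy_schwarz:
  assumes x: "x \<in> carrier V" and y: "y \<in> carrier V"
  shows "cmod (s x y) \<le> sn x * sn y"
proof -
  have "(cmod (s x y))\<^sup>2 \<le> (sn x)\<^sup>2 * (sn y)\<^sup>2"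
  proof (rule quadratic_bound)
    show "0 \<le> (sn x)\<^sup>2 - 2 * Re (cnj t * s x y) + (cmod t)\<^sup>2 * (sn y)\<^sup>2" for t
      unfolding sn_square_diff_smult[OF x y, symmetric] by simp
  qed simp
  then have "(cmod (s x y))\<^sup>2 \<le> (sn x * sn y)\<^sup>2"
    by (simp add: power_mult_distrib)
  then show ?thesis
    by (rule power2_le_imp_le) (use sn_nonneg[OF x] sn_nonneg[OF y] in simp)
qed

lemma sn_triangle:
  assumes x: "x \<in> carrier V" and y: "y \<in> carrier V"
  shows "sn (x \<oplus> y) \<le> sn x + sn y"
proof -
  have "(sn (x \<oplus> y))\<^sup>2 = (sn x)\<^sup>2 + 2 * Re (s x y) + (sn y)\<^sup>2"
    using x y s_cnj[of x y] by (simp add: sn_square s_linear)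
  also have "\<dots> \<le> (sn x)\<^sup>2 + 2 * (sn x * sn y) + (sn y)\<^sup>2"
    using cauchy_schwarz[OF x y] complex_Re_le_cmod[of "s x y"] by simp
  also have "\<dots> = (sn x + sn y)\<^sup>2"
    by (simp add: power2_sum)
  finally show ?thesis
    by (rule power2_le_imp_le) (use sn_nonneg[OF x] sn_nonneg[OF y] in simp)
qed

lemma sn_smult: "x \<in> carrier V \<Longrightarrow> sn (c \<odot> x) = cmod c * sn x"
proof -
  assume x: "x \<in> carrier V"
  have "s (c \<odot> x) (c \<odot> x) = of_real ((cmod c)\<^sup>2 * (sn x)\<^sup>2)"
    using x s_self[OF x] complex_norm_square[of c] by (simp add: s_linear mult_ac)
  then have "(sn (c \<odot> x))\<^sup>2 = (cmod c * sn x)\<^sup>2"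
    using x by (simp add: sn_square power_mult_distrib)
  then show ?thesis
    using x sn_nonneg by (simp add: power2_eq_iff_nonneg)
qed

sublocale sn: complex_seminormed V sn
  by unfold_locales (auto simp: sn_nonneg sn_triangle sn_smult)

end

context hilbert_space
begin

sublocale complex_module H ..

sublocale semi_ip H "ip H"
  by unfold_locales (auto simp: ip_add ip_smult ip_nonneg intro: ip_cnj)

lemma hnorm_eq_sn: "hnorm H = sn"
  by (intro ext) (simp add: hnorm_def sn_def)

sublocale complex_normed H "hnorm H"
proof
  show "hnorm H x = 0 \<longleftrightarrow> x = \<zero>" if "x \<in> carrier H" for x
    using that s_self[of x] ip_eq_0[of x] by (auto simp: hnorm_eq_sn)
qed (auto simp: hnorm_eq_sn sn_nonneg sn_triangle sn_smult)

lemma hdist_eq: "hdist H = ndist"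
  by (intro ext) (simp add: hdist_def ndist_def)

lemma mcomplete: "ms.mcomplete"
  using complete by (simp add: hdist_eq)

lemmas ip_CS = cauchy_schwarz [folded hnorm_eq_sn]
lemmas ip_self = s_self [folded hnorm_eq_sn]
lemmas hnorm_square_diff_smult = sn_square_diff_smult [folded hnorm_eq_sn]

lemma ip_eqI:
  assumes "x \<in> carrier H" "y \<in> carrier H" "\<And>z. z \<in> carrier H \<Longrightarrow> ip H z x = ip H z y"
  shows "x = y"
proof -
  have "ip H (x \<ominus> y) (x \<ominus> y) = 0"
    using assms(3)[of "x \<ominus> y"] assms(1,2) by (simp add: s_diff_right)
  then show ?thesis
    using assms ip_eq_0[of "x \<ominus> y"] by (simp add: diff_0_iff)
qed

lemma ip_eqI_left:
  assumes "x \<in> carrier H" "y \<in> carrier H" "\<And>z. z \<in> carrier H \<Longrightarrow> ip H x z = ip H y z"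
  shows "x = y"
  using assms(1,2)
proof (rule ip_eqI)
  fix z assume "z \<in> carrier H"
  then show "ip H z x = ip H z y"
    using assms s_cnj[of x z] s_cnj[of y z] by simp
qed

lemma tendsto_ip_left:
  assumes u: "\<And>n. u n \<in> carrier H" and l: "l \<in> carrier H" and z: "z \<in> carrier H"
    and lim: "(\<lambda>n. hnorm H (u n \<ominus> l)) \<longlonglongrightarrow> 0"
  shows "(\<lambda>n. ip H (u n) z) \<longlonglongrightarrow> ip H l z"
proof (rule LIM_zero_cancel, rule Lim_null_comparison)
  show "\<forall>\<^sub>F n in sequentially. norm (ip H (u n) z - ip H l z) \<le> hnorm H (u n \<ominus> l) * hnorm H z"
    using ip_CS[of "u _ \<ominus> l" z] u l z by (simp add: s_diff_left)
  show "(\<lambda>n. hnorm H (u n \<ominus> l) * hnorm H z) \<longlonglongrightarrow> 0"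
    using tendsto_mult_left_zero[OF lim] .
qed

lemma tendsto_hnorm:
  assumes u: "\<And>n. u n \<in> carrier H" and l: "l \<in> carrier H"
    and lim: "(\<lambda>n. hnorm H (u n \<ominus> l)) \<longlonglongrightarrow> 0"
  shows "(\<lambda>n. hnorm H (u n)) \<longlonglongrightarrow> hnorm H l"
proof (rule LIM_zero_cancel, rule Lim_null_comparison)
  have "\<bar>hnorm H (u n) - hnorm H l\<bar> \<le> hnorm H (u n \<ominus> l)" for n
    using N_le_diff[of "u n" l] N_le_diff[of l "u n"] N_diff_commute[of l "u n"] u l by simp
  then show "\<forall>\<^sub>F n in sequentially. norm (hnorm H (u n) - hnorm H l) \<le> hnorm H (u n \<ominus> l)"
    by simp
qed (use lim in auto)

lemma tendsto_ip:
  assumes u: "\<And>n. u n \<in> carrier H" and l: "l \<in> carrier H"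
    and v: "\<And>n. v n \<in> carrier H" and m: "m \<in> carrier H"
    and limu: "(\<lambda>n. hnorm H (u n \<ominus> l)) \<longlonglongrightarrow> 0" and limv: "(\<lambda>n. hnorm H (v n \<ominus> m)) \<longlonglongrightarrow> 0"
  shows "(\<lambda>n. ip H (u n) (v n)) \<longlonglongrightarrow> ip H l m"
proof -
  have "(\<lambda>n. ip H (u n) (v n \<ominus> m)) \<longlonglongrightarrow> 0"
  proof (rule Lim_null_comparison)
    show "\<forall>\<^sub>F n in sequentially. norm (ip H (u n) (v n \<ominus> m)) \<le> hnorm H (u n) * hnorm H (v n \<ominus> m)"
      using ip_CS u v m by simp
    show "(\<lambda>n. hnorm H (u n) * hnorm H (v n \<ominus> m)) \<longlonglongrightarrow> 0"
      using tendsto_mult[OF tendsto_hnorm[OF u l limu] limv] by simp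
  qed
  then have "(\<lambda>n. ip H (u n) (v n \<ominus> m) + ip H (u n) m) \<longlonglongrightarrow> 0 + ip H l m"
    by (intro tendsto_add tendsto_ip_left u l m limu)
  then show ?thesis
    using u v m by (simp add: s_diff_right)
qed

text \<open>For \<open>u \<in> M\<close> whose squared distance to \<open>x\<close> exceeds the infimum \<open>D\<close> by at most
  \<open>r\<^sup>2\<close>, the discriminant argument yields \<open>|\<langle>x - u, z\<rangle>| \<le> r \<parallel>z\<parallel>\<close> on \<open>M\<close>. Applied to differences
  of such \<open>u\<close> it shows that a minimizing sequence is Cauchy, and in the limit that \<open>x - m\<close> is
  orthogonal to \<open>M\<close>. The set \<open>M\<close> is an arbitrary linear subspace, so \<open>m\<close> lies only in its closure.\<close>

lemma orthogonal_projection: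
  assumes MH: "M \<subseteq> carrier H" and "\<zero> \<in> M"
    and add: "\<And>x y. \<lbrakk>x \<in> M; y \<in> M\<rbrakk> \<Longrightarrow> x \<oplus> y \<in> M"
    and smult: "\<And>c x. x \<in> M \<Longrightarrow> c \<odot> x \<in> M"
    and x: "x \<in> carrier H"
  shows "\<exists>m\<in>carrier H. (\<forall>e>0. \<exists>y\<in>M. hnorm H (m \<ominus> y) < e) \<and> (\<forall>z\<in>M. ip H (x \<ominus> m) z = 0)"
proof -
  define D where "D = (INF u\<in>M. (hnorm H (x \<ominus> u))\<^sup>2)"
  have bdd: "bdd_below ((\<lambda>u. (hnorm H (x \<ominus> u))\<^sup>2) ` M)"
    by (rule bdd_belowI2[of _ 0]) simp
  have D: "D \<le> (hnorm H (x \<ominus> u))\<^sup>2" if "u \<in> M" for u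
    unfolding D_def using bdd that by (rule cINF_lower)
  have key: "(cmod (ip H (x \<ominus> u) z))\<^sup>2 \<le> ((hnorm H (x \<ominus> u))\<^sup>2 - D) * (hnorm H z)\<^sup>2"
    if u: "u \<in> M" and z: "z \<in> M" for u z
  proof (rule quadratic_bound)
    fix t
    have uz: "u \<in> carrier H" "z \<in> carrier H"
      using u z MH by auto
    have "x \<ominus> (u \<oplus> t \<odot> z) = (x \<ominus> u) \<ominus> t \<odot> z"
      using x uz smult_in[OF uz(2), of t] by algebra
    then show "0 \<le> (hnorm H (x \<ominus> u))\<^sup>2 - D - 2 * Re (cnj t * ip H (x \<ominus> u) z) + (cmod t)\<^sup>2 * (hnorm H z)\<^sup>2"
      using D[OF add[OF u smult[OF z, of t]]] hnorm_square_diff_smult[of "x \<ominus> u" z t] x uz by simp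
  qed simp
  have "\<exists>u\<in>M. (hnorm H (x \<ominus> u))\<^sup>2 < D + 1 / real (Suc n)" for n
    using cINF_less_iff[OF _ bdd, of "D + 1 / real (Suc n)"] \<open>\<zero> \<in> M\<close> by (auto simp: D_def)
  then obtain u where uM: "\<And>n. u n \<in> M" and u: "\<And>n. (hnorm H (x \<ominus> u n))\<^sup>2 < D + 1 / real (Suc n)"
    by metis
  have uH [simp]: "u n \<in> carrier H" for n
    using uM MH by blast
  \<comment> \<open>The \<open>n\<close>-th term of the minimizing sequence misses \<open>D\<close> by less than \<open>r(n)\<^sup>2\<close>.\<close>
  define r where "r n = sqrt (1 / real (Suc n))" for n
  have r: "r \<longlonglongrightarrow> 0"
    unfolding r_def using tendsto_real_sqrt[OF LIMSEQ_inverse_real_of_nat] by (simp add: inverse_eq_divide)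
  have small: "cmod (ip H (x \<ominus> u n) z) \<le> r n * hnorm H z" if z: "z \<in> M" for n z
  proof (rule power2_le_imp_le)
    have "(cmod (ip H (x \<ominus> u n) z))\<^sup>2 \<le> ((hnorm H (x \<ominus> u n))\<^sup>2 - D) * (hnorm H z)\<^sup>2"
      by (rule key[OF uM z])
    also have "\<dots> \<le> (1 / real (Suc n)) * (hnorm H z)\<^sup>2"
      using u[of n] by (intro mult_right_mono) auto
    also have "\<dots> = (r n * hnorm H z)\<^sup>2"
      by (simp add: r_def power_mult_distrib)
    finally show "(cmod (ip H (x \<ominus> u n) z))\<^sup>2 \<le> (r n * hnorm H z)\<^sup>2" .
    show "0 \<le> r n * hnorm H z"
      using z MH N_nonneg by (auto simp: r_def)
  qed
  have diff: "y \<ominus> z \<in> M" if "y \<in> M" "z \<in> M" for y z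
    using that add[OF that(1) smult[OF that(2), of "-1"]] MH by (simp add: diff_eq_smult subset_iff)
  have "hnorm H (u m \<ominus> u n) \<le> r m + r n" for m n
  proof -
    define z where "z = u m \<ominus> u n"
    have z: "z \<in> M" "z \<in> carrier H"
      using diff uM MH by (auto simp: z_def)
    have "(hnorm H z)\<^sup>2 = cmod (ip H z z)"
      using ip_self[OF z(2)] by (simp add: norm_power)
    also have "ip H z z = ip H (x \<ominus> u n) z - ip H (x \<ominus> u m) z"
      using z(2) x by (simp add: s_diff_left z_def)
    also have "cmod \<dots> \<le> r n * hnorm H z + r m * hnorm H z"
      using norm_triangle_ineq4[of "ip H (x \<ominus> u n) z" "ip H (x \<ominus> u m) z"]
        small[OF z(1), of n] small[OF z(1), of m] by linarith
    finally have "hnorm H z * hnorm H z \<le> (r m + r n) * hnorm H z"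
      by (simp add: power2_eq_square algebra_simps)
    moreover have "0 \<le> r m + r n"
      by (simp add: r_def)
    ultimately show ?thesis
      using N_nonneg[OF z(2)] unfolding z_def by (cases "hnorm H (u m \<ominus> u n) = 0") auto
  qed
  then obtain m where m: "m \<in> carrier H" and lim: "(\<lambda>n. hnorm H (u n \<ominus> m)) \<longlonglongrightarrow> 0"
    using limit_exists[OF mcomplete _ r, of u] by auto
  have "\<exists>y\<in>M. hnorm H (m \<ominus> y) < e" if e: "e > 0" for e
  proof -
    obtain n where "hnorm H (u n \<ominus> m) < e"
      using order_tendstoD(2)[OF lim e] by (auto simp: eventually_sequentially)
    then show ?thesis
      using uM m N_diff_commute[of m "u n"] by (intro bexI[of _ "u n"]) simp_all
  qed
  moreover have "ip H (x \<ominus> m) z = 0" if z: "z \<in> M" for z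
  proof -
    have zH: "z \<in> carrier H"
      using z MH by auto
    have "(\<lambda>n. ip H x z - ip H (u n) z) \<longlonglongrightarrow> ip H x z - ip H m z"
      by (intro tendsto_diff tendsto_const tendsto_ip_left lim m zH uH)
    then have "(\<lambda>n. ip H (x \<ominus> u n) z) \<longlonglongrightarrow> ip H (x \<ominus> m) z"
      using x m zH by (simp add: s_diff_left)
    moreover have "(\<lambda>n. ip H (x \<ominus> u n) z) \<longlonglongrightarrow> 0"
    proof (rule Lim_null_comparison)
      show "\<forall>\<^sub>F n in sequentially. norm (ip H (x \<ominus> u n) z) \<le> r n * hnorm H z"
        using small[OF z] by simp
      show "(\<lambda>n. r n * hnorm H z) \<longlonglongrightarrow> 0"
        using tendsto_mult_left_zero[OF r] .
    qed
    ultimately show ?thesis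
      by (rule LIMSEQ_unique)
  qed
  ultimately show ?thesis
    using m by blast
qed

text \<open>If \<open>F x \<noteq> 0\<close>, the component of \<open>x\<close> orthogonal to the kernel of \<open>F\<close> represents \<open>F\<close> up to
  a scalar.\<close>

lemma riesz_representation:
  assumes add: "\<And>x y. \<lbrakk>x \<in> carrier H; y \<in> carrier H\<rbrakk> \<Longrightarrow> F (x \<oplus> y) = F x + F y"
    and smult: "\<And>c x. x \<in> carrier H \<Longrightarrow> F (c \<odot> x) = c * F x"
    and bounded: "\<And>x. x \<in> carrier H \<Longrightarrow> cmod (F x) \<le> K * hnorm H x"
  shows "\<exists>w\<in>carrier H. \<forall>z\<in>carrier H. F z = ip H z w"
proof (cases "\<forall>x\<in>carrier H. F x = 0")
  case True
  then show ?thesis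
    by (intro bexI[of _ "\<zero>"]) auto
next
  case False
  then obtain x where x: "x \<in> carrier H" "F x \<noteq> 0"
    by blast
  have F_diff: "F (y \<ominus> z) = F y - F z" if "y \<in> carrier H" "z \<in> carrier H" for y z
    using that by (simp add: diff_eq_smult add smult)
  define M where "M = {y \<in> carrier H. F y = 0}"
  have "\<exists>m\<in>carrier H. (\<forall>e>0. \<exists>y\<in>M. hnorm H (m \<ominus> y) < e) \<and> (\<forall>z\<in>M. ip H (x \<ominus> m) z = 0)"
  proof (rule orthogonal_projection)
    show "\<zero> \<in> M"
      using smult[of "\<zero>" 0] by (simp add: M_def)
  qed (auto simp: M_def add smult x)
  then obtain m where m: "m \<in> carrier H" and near: "\<And>e. e > 0 \<Longrightarrow> \<exists>y\<in>M. hnorm H (m \<ominus> y) < e"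
      and orth: "\<And>z. z \<in> M \<Longrightarrow> ip H (x \<ominus> m) z = 0"
    by blast
  have "cmod (F m) \<le> 0"
  proof (rule le_zero_if_small)
    fix e :: real assume "e > 0"
    then obtain y where y: "y \<in> carrier H" "F y = 0" "hnorm H (m \<ominus> y) < e"
      using near by (auto simp: M_def)
    have "cmod (F m) \<le> K * hnorm H (m \<ominus> y)"
      using bounded[of "m \<ominus> y"] F_diff[OF m y(1)] y m by simp
    then show "\<exists>d. 0 \<le> d \<and> d < e \<and> cmod (F m) \<le> K * d"
      using y m N_nonneg[of "m \<ominus> y"] by (intro exI[of _ "hnorm H (m \<ominus> y)"]) simp
  qed
  then have Fm: "F m = 0"
    by simp
  define u where "u = x \<ominus> m"
  have u: "u \<in> carrier H" "F u \<noteq> 0"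
    using x m Fm by (auto simp: u_def F_diff)
  have u0: "ip H u u \<noteq> 0"
    using u ip_eq_0[OF u(1)] smult[of "\<zero>" 0] by auto
  \<comment> \<open>The scalar is fixed by \<open>F u = \<langle>u, w\<rangle>\<close>; every \<open>z\<close> differs from a multiple of \<open>u\<close> by an element of the kernel.\<close>
  define w where "w = cnj (F u / ip H u u) \<odot> u"
  have "F z = ip H z w" if z: "z \<in> carrier H" for z
  proof -
    have "z \<ominus> (F z / F u) \<odot> u \<in> M"
      using z u by (simp add: M_def F_diff smult)
    then have "ip H u (z \<ominus> (F z / F u) \<odot> u) = 0"
      using orth by (simp add: u_def)
    then have "ip H (z \<ominus> (F z / F u) \<odot> u) u = 0"
      using s_cnj[of u "z \<ominus> (F z / F u) \<odot> u"] z u by simp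
    then have "ip H z u = F z / F u * ip H u u"
      using z u by (simp add: s_linear)
    then show ?thesis
      using z u u0 by (simp add: w_def s_linear)
  qed
  moreover have "w \<in> carrier H"
    using u by (simp add: w_def)
  ultimately show ?thesis
    by blast
qed

end

section \<open>Bounded operators\<close>

lemma bounded_mapsI:
  assumes "\<And>x. x \<in> carrier H \<Longrightarrow> T x \<in> carrier K" "T \<in> extensional (carrier H)"
    and "\<And>x y. \<lbrakk>x \<in> carrier H; y \<in> carrier H\<rbrakk> \<Longrightarrow> T (x \<oplus>\<^bsub>H\<^esub> y) = T x \<oplus>\<^bsub>K\<^esub> T y"
    and "\<And>c x. x \<in> carrier H \<Longrightarrow> T (c \<odot>\<^bsub>H\<^esub> x) = c \<odot>\<^bsub>K\<^esub> T x"
    and "\<And>x. x \<in> carrier H \<Longrightarrow> hnorm K (T x) \<le> b * hnorm H x"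
  shows "T \<in> bounded_maps H K"
proof -
  have "T \<in> carrier H \<rightarrow>\<^sub>E carrier K"
    using assms(1,2) by (simp add: PiE_def)
  moreover have "\<exists>b. \<forall>x\<in>carrier H. hnorm K (T x) \<le> b * hnorm H x"
    using assms(5) by blast
  ultimately show ?thesis
    using assms(3,4) by (simp add: bounded_maps_def)
qed

lemma bounded_mapsD:
  assumes "T \<in> bounded_maps H K"
  shows "x \<in> carrier H \<Longrightarrow> T x \<in> carrier K" "T \<in> extensional (carrier H)"
    and "\<lbrakk>x \<in> carrier H; y \<in> carrier H\<rbrakk> \<Longrightarrow> T (x \<oplus>\<^bsub>H\<^esub> y) = T x \<oplus>\<^bsub>K\<^esub> T y"
    and "x \<in> carrier H \<Longrightarrow> T (c \<odot>\<^bsub>H\<^esub> x) = c \<odot>\<^bsub>K\<^esub> T x"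
    and "\<exists>b. \<forall>x\<in>carrier H. hnorm K (T x) \<le> b * hnorm H x"
  using assms by (simp_all add: bounded_maps_def PiE_def Pi_def)

lemma bounded_maps_eqI:
  assumes "S \<in> bounded_maps H K" "T \<in> bounded_maps H K" "\<And>x. x \<in> carrier H \<Longrightarrow> S x = T x"
  shows "S = T"
  using assms bounded_mapsD(2) by (intro extensionalityI[of S "carrier H" T]) auto

locale hilbert_pair = H: hilbert_space H + K: hilbert_space K
  for H :: "'h hilbert" and K :: "'k hilbert"
begin

lemma bounded_maps_bound:
  assumes "T \<in> bounded_maps H K"
  obtains b where "0 \<le> b" "\<And>x. x \<in> carrier H \<Longrightarrow> hnorm K (T x) \<le> b * hnorm H x"
proof -
  obtain b where b: "\<forall>x\<in>carrier H. hnorm K (T x) \<le> b * hnorm H x"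
    using bounded_mapsD(5)[OF assms] by blast
  have "hnorm K (T x) \<le> \<bar>b\<bar> * hnorm H x" if "x \<in> carrier H" for x
    using b that H.N_nonneg[OF that] mult_right_mono[of b "\<bar>b\<bar>" "hnorm H x"] by force
  then show ?thesis
    using that[of "\<bar>b\<bar>"] by simp
qed

lemma bounded_maps_diff:
  assumes T: "T \<in> bounded_maps H K" and x: "x \<in> carrier H" and y: "y \<in> carrier H"
  shows "T (x \<ominus>\<^bsub>H\<^esub> y) = T x \<ominus>\<^bsub>K\<^esub> T y"
  using x y bounded_mapsD[OF T] by (simp add: H.diff_eq_smult K.diff_eq_smult)

lemma bounded_maps_zero:
  assumes T: "T \<in> bounded_maps H K"
  shows "T \<zero>\<^bsub>H\<^esub> = \<zero>\<^bsub>K\<^esub>"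
  using bounded_mapsD(4)[OF T, of "\<zero>\<^bsub>H\<^esub>" 0] bounded_mapsD(1)[OF T, of "\<zero>\<^bsub>H\<^esub>"] by simp

lemma adjoint_map:
  assumes T: "T \<in> bounded_maps H K" and y: "y \<in> carrier K"
  shows adjoint_map_closed: "adjoint_map H K T y \<in> carrier H"
    and adjoint_map_ip: "z \<in> carrier H \<Longrightarrow> ip K (T z) y = ip H z (adjoint_map H K T y)"
proof -
  note TD = bounded_mapsD[OF T]
  obtain b where b: "0 \<le> b" "\<And>x. x \<in> carrier H \<Longrightarrow> hnorm K (T x) \<le> b * hnorm H x"
    using bounded_maps_bound[OF T] by blast
  have "\<exists>w\<in>carrier H. \<forall>z\<in>carrier H. ip K (T z) y = ip H z w"
  proof (rule H.riesz_representation)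
    fix x assume x: "x \<in> carrier H"
    have "cmod (ip K (T x) y) \<le> hnorm K (T x) * hnorm K y"
      using K.ip_CS TD(1)[OF x] y by blast
    also have "\<dots> \<le> b * hnorm H x * hnorm K y"
      using b(2)[OF x] K.N_nonneg[OF y] by (intro mult_right_mono)
    finally show "cmod (ip K (T x) y) \<le> (b * hnorm K y) * hnorm H x"
      by (simp add: algebra_simps)
  qed (use TD y in \<open>simp_all add: K.s_linear\<close>)
  then obtain w where w: "w \<in> carrier H" "\<And>z. z \<in> carrier H \<Longrightarrow> ip K (T z) y = ip H z w"
    by blast
  have "adjoint_map H K T y = w"
    unfolding adjoint_map_def using y w by (auto intro!: the_equality H.ip_eqI)
  then show "adjoint_map H K T y \<in> carrier H"
    "z \<in> carrier H \<Longrightarrow> ip K (T z) y = ip H z (adjoint_map H K T y)"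
    using w by auto
qed

lemma adjoint_map_eqI:
  assumes T: "T \<in> bounded_maps H K" and y: "y \<in> carrier K" and w: "w \<in> carrier H"
    and eq: "\<And>z. z \<in> carrier H \<Longrightarrow> ip K (T z) y = ip H z w"
  shows "adjoint_map H K T y = w"
  using adjoint_map[OF T y] w eq by (intro H.ip_eqI) auto

lemma adjoint_bound:
  assumes T: "T \<in> bounded_maps H K" and y: "y \<in> carrier K" and "0 \<le> b"
    and b: "\<And>x. x \<in> carrier H \<Longrightarrow> hnorm K (T x) \<le> b * hnorm H x"
  shows "hnorm H (adjoint_map H K T y) \<le> b * hnorm K y"
proof -
  let ?w = "adjoint_map H K T y"
  have w: "?w \<in> carrier H"
    by (rule adjoint_map_closed[OF T y])
  have "(hnorm H ?w)\<^sup>2 = cmod (ip K (T ?w) y)"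
    using adjoint_map_ip[OF T y w] H.ip_self[OF w] by (simp add: norm_power)
  also have "\<dots> \<le> hnorm K (T ?w) * hnorm K y"
    using K.ip_CS bounded_mapsD(1)[OF T w] y by blast
  also have "\<dots> \<le> b * hnorm H ?w * hnorm K y"
    using b[OF w] K.N_nonneg[OF y] by (intro mult_right_mono)
  finally have "hnorm H ?w * hnorm H ?w \<le> (b * hnorm K y) * hnorm H ?w"
    by (simp add: power2_eq_square algebra_simps)
  then show ?thesis
    using H.N_nonneg[OF w] K.N_nonneg[OF y] \<open>0 \<le> b\<close> by (cases "hnorm H ?w = 0") auto
qed

lemma adjoint_in_bounded_maps:
  assumes T: "T \<in> bounded_maps H K"
  shows "adjoint_map H K T \<in> bounded_maps K H"
proof -
  note TD = bounded_mapsD[OF T] and ad = adjoint_map[OF T]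
  obtain b where b: "0 \<le> b" "\<And>x. x \<in> carrier H \<Longrightarrow> hnorm K (T x) \<le> b * hnorm H x"
    using bounded_maps_bound[OF T] by blast
  show ?thesis
  proof (rule bounded_mapsI)
    show "adjoint_map H K T \<in> extensional (carrier K)"
      by (simp add: adjoint_map_def)
    show "adjoint_map H K T (x \<oplus>\<^bsub>K\<^esub> y) = adjoint_map H K T x \<oplus>\<^bsub>H\<^esub> adjoint_map H K T y"
      if "x \<in> carrier K" "y \<in> carrier K" for x y
      using that ad TD(1) by (intro adjoint_map_eqI[OF T]) (auto simp: H.s_linear K.s_linear)
    show "adjoint_map H K T (c \<odot>\<^bsub>K\<^esub> x) = c \<odot>\<^bsub>H\<^esub> adjoint_map H K T x"
      if "x \<in> carrier K" for x c
      using that ad TD(1) by (intro adjoint_map_eqI[OF T]) (auto simp: H.s_linear K.s_linear)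
    show "hnorm H (adjoint_map H K T y) \<le> b * hnorm K y" if "y \<in> carrier K" for y
      using adjoint_bound[OF T that b] .
  qed (use ad in auto)
qed

end

lemma bounded_ops_simps [simp]:
  "carrier (bounded_ops H) = bounded_maps H H"
  "mult (bounded_ops H) = compose (carrier H)"
  "one (bounded_ops H) = (\<lambda>x\<in>carrier H. x)"
  "zero (bounded_ops H) = (\<lambda>x\<in>carrier H. \<zero>\<^bsub>H\<^esub>)"
  "add (bounded_ops H) = (\<lambda>S T. \<lambda>x\<in>carrier H. S x \<oplus>\<^bsub>H\<^esub> T x)"
  "smult (bounded_ops H) = (\<lambda>c T. \<lambda>x\<in>carrier H. c \<odot>\<^bsub>H\<^esub> T x)"
  "star (bounded_ops H) = adjoint_map H H"
  "cnorm (bounded_ops H) = (\<lambda>T. SUP x\<in>{x \<in> carrier H. hnorm H x \<le> 1}. hnorm H (T x))"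
  by (simp_all add: bounded_ops_def)

context hilbert_space
begin

sublocale hilbert_pair H H ..

abbreviation "B \<equiv> bounded_ops H"

lemma op_closed: "T \<in> bounded_maps H H \<Longrightarrow> x \<in> carrier H \<Longrightarrow> T x \<in> carrier H"
  by (rule bounded_mapsD(1))

lemmas op_eqI = bounded_maps_eqI [of _ H H]

lemma op_bdd_above:
  assumes T: "T \<in> bounded_maps H H"
  shows "bdd_above ((\<lambda>x. hnorm H (T x)) ` {x \<in> carrier H. hnorm H x \<le> 1})"
proof -
  obtain b where b: "0 \<le> b" "\<And>x. x \<in> carrier H \<Longrightarrow> hnorm H (T x) \<le> b * hnorm H x"
    using bounded_maps_bound[OF T] by blast
  show ?thesis
  proof (rule bdd_aboveI2[of _ _ b])
    fix x assume "x \<in> {x \<in> carrier H. hnorm H x \<le> 1}"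
    then show "hnorm H (T x) \<le> b"
      using b(2)[of x] mult_left_le[OF _ b(1), of "hnorm H x"] by simp
  qed
qed

lemma op_norm_le:
  assumes "\<And>x. x \<in> carrier H \<Longrightarrow> hnorm H (T x) \<le> b * hnorm H x" and "0 \<le> b"
  shows "cnorm B T \<le> b"
proof -
  have "(SUP x\<in>{x \<in> carrier H. hnorm H x \<le> 1}. hnorm H (T x)) \<le> b"
  proof (rule cSUP_least)
    show "{x \<in> carrier H. hnorm H x \<le> 1} \<noteq> {}"
      by (auto intro!: exI[of _ "\<zero>"])
    show "hnorm H (T x) \<le> b" if "x \<in> {x \<in> carrier H. hnorm H x \<le> 1}" for x
      using assms(1)[of x] that mult_left_le[OF _ assms(2), of "hnorm H x"] by simp
  qed
  then show ?thesis by simp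
qed

lemma op_norm_nonneg:
  assumes T: "T \<in> bounded_maps H H"
  shows "0 \<le> cnorm B T"
  using cSUP_upper[OF _ op_bdd_above[OF T], of "\<zero>"] bounded_maps_zero[OF T] by simp

lemma op_norm_bound:
  assumes T: "T \<in> bounded_maps H H" and x: "x \<in> carrier H"
  shows "hnorm H (T x) \<le> cnorm B T * hnorm H x"
proof (cases "hnorm H x = 0")
  case True
  then show ?thesis
    using x bounded_maps_zero[OF T] by (simp add: N_eq_0)
next
  case False
  then have pos: "hnorm H x > 0"
    using N_nonneg[OF x] by simp
  let ?y = "of_real (1 / hnorm H x) \<odot> x"
  have "hnorm H (T ?y) \<le> cnorm B T"
    unfolding bounded_ops_simps
    using x pos by (intro cSUP_upper[OF _ op_bdd_above[OF T]]) (simp add: N_smult norm_divide)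
  then show ?thesis
    using x pos bounded_mapsD[OF T] by (simp add: N_smult norm_divide field_simps)
qed

lemma op_norm_compose_bound:
  assumes S: "S \<in> bounded_maps H H" and T: "T \<in> bounded_maps H H" and x: "x \<in> carrier H"
  shows "hnorm H (S (T x)) \<le> cnorm B S * cnorm B T * hnorm H x"
proof -
  have "hnorm H (S (T x)) \<le> cnorm B S * hnorm H (T x)"
    by (rule op_norm_bound[OF S op_closed[OF T x]])
  also have "\<dots> \<le> cnorm B S * (cnorm B T * hnorm H x)"
    using op_norm_bound[OF T x] op_norm_nonneg[OF S] by (rule mult_left_mono)
  finally show ?thesis
    by (simp only: mult.assoc)
qed

lemma ops_add [simp]:
  assumes S: "S \<in> bounded_maps H H" and T: "T \<in> bounded_maps H H"
  shows "(\<lambda>x\<in>carrier H. S x \<oplus> T x) \<in> bounded_maps H H"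
proof (rule bounded_mapsI)
  note SD = bounded_mapsD[OF S] and TD = bounded_mapsD[OF T]
  show "(\<lambda>x\<in>carrier H. S x \<oplus> T x) (x \<oplus> y)
      = (\<lambda>x\<in>carrier H. S x \<oplus> T x) x \<oplus> (\<lambda>x\<in>carrier H. S x \<oplus> T x) y"
    if "x \<in> carrier H" "y \<in> carrier H" for x y
    using that SD TD by (simp add: M.a_ac)
  show "hnorm H ((\<lambda>x\<in>carrier H. S x \<oplus> T x) x) \<le> (cnorm B S + cnorm B T) * hnorm H x"
    if x: "x \<in> carrier H" for x
    using x N_triangle[of "S x" "T x"] op_norm_bound[OF S x] op_norm_bound[OF T x] SD(1) TD(1)
    by (simp add: distrib_right del: bounded_ops_simps)
qed (use bounded_mapsD[OF S] bounded_mapsD[OF T] in \<open>simp_all add: smult_add_right\<close>)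

lemma ops_smult [simp]:
  assumes T: "T \<in> bounded_maps H H"
  shows "(\<lambda>x\<in>carrier H. c \<odot> T x) \<in> bounded_maps H H"
proof (rule bounded_mapsI)
  note TD = bounded_mapsD[OF T]
  show "hnorm H ((\<lambda>x\<in>carrier H. c \<odot> T x) x) \<le> (cmod c * cnorm B T) * hnorm H x"
    if x: "x \<in> carrier H" for x
    using x op_norm_bound[OF T x] TD(1) mult_left_mono[of "hnorm H (T x)" _ "cmod c"]
    by (simp add: N_smult mult.assoc del: bounded_ops_simps)
qed (use bounded_mapsD[OF T] in \<open>simp_all add: smult_add_right mult.commute\<close>)

lemma ops_compose [simp]:
  assumes S: "S \<in> bounded_maps H H" and T: "T \<in> bounded_maps H H"
  shows "compose (carrier H) S T \<in> bounded_maps H H"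
proof (rule bounded_mapsI)
  note SD = bounded_mapsD[OF S] and TD = bounded_mapsD[OF T]
  show "hnorm H (compose (carrier H) S T x) \<le> (cnorm B S * cnorm B T) * hnorm H x"
    if x: "x \<in> carrier H" for x
    using x op_norm_compose_bound[OF S T x] by (simp add: compose_eq del: bounded_ops_simps)
qed (use bounded_mapsD[OF S] bounded_mapsD[OF T] in \<open>simp_all add: compose_eq compose_def\<close>)

lemma ops_zero [simp]: "(\<lambda>x\<in>carrier H. \<zero>) \<in> bounded_maps H H"
  by (rule bounded_mapsI[where b = 0]) auto

lemma ops_id [simp]: "(\<lambda>x\<in>carrier H. x) \<in> bounded_maps H H"
  by (rule bounded_mapsI[where b = 1]) auto

lemma ops_adjoint [simp]: "T \<in> bounded_maps H H \<Longrightarrow> adjoint_map H H T \<in> bounded_maps H H"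
  by (rule adjoint_in_bounded_maps)

lemma module_ops: "Module.module complex_ring B"
proof (rule moduleI[OF cring_complex_ring])
  show "abelian_group B"
  proof (rule abelian_groupI)
    show "\<exists>y\<in>carrier B. y \<oplus>\<^bsub>B\<^esub> x = \<zero>\<^bsub>B\<^esub>" if "x \<in> carrier B" for x
    proof (rule bexI[of _ "\<lambda>v\<in>carrier H. (-1) \<odot> x v"])
      show "(\<lambda>v\<in>carrier H. - 1 \<odot> x v) \<oplus>\<^bsub>B\<^esub> x = \<zero>\<^bsub>B\<^esub>"
        using that op_closed[of x] 
        by (intro ext) (auto simp: minus_eq_smult [symmetric] M.l_neg)
    qed (use that in simp)
    fix x y z assume *: "x \<in> carrier B" "y \<in> carrier B" "z \<in> carrier B"
    show "x \<oplus>\<^bsub>B\<^esub> y \<oplus>\<^bsub>B\<^esub> z = x \<oplus>\<^bsub>B\<^esub> (y \<oplus>\<^bsub>B\<^esub> z)"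
      using * op_closed by (intro ext) (auto simp: M.a_assoc)
  next
    fix x y assume *: "x \<in> carrier B" "y \<in> carrier B"
    show "x \<oplus>\<^bsub>B\<^esub> y = y \<oplus>\<^bsub>B\<^esub> x"
      using * op_closed by (intro ext) (auto simp: M.a_comm)
  next
    fix x assume "x \<in> carrier B"
    then show "\<zero>\<^bsub>B\<^esub> \<oplus>\<^bsub>B\<^esub> x = x"
      using op_closed[of x] bounded_mapsD(2)[of x H H]
      by (intro ext) (auto simp: extensional_def)
  qed auto
next
  fix x assume "x \<in> carrier B"
  then show "\<one>\<^bsub>complex_ring\<^esub> \<odot>\<^bsub>B\<^esub> x = x"
    using op_closed[of x] bounded_mapsD(2)[of x H H]
    by (intro ext) (auto simp: extensional_def)
next
  fix a b x assume "x \<in> carrier B"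
  then show "(a \<oplus>\<^bsub>complex_ring\<^esub> b) \<odot>\<^bsub>B\<^esub> x = a \<odot>\<^bsub>B\<^esub> x \<oplus>\<^bsub>B\<^esub> b \<odot>\<^bsub>B\<^esub> x"
    "(a \<otimes>\<^bsub>complex_ring\<^esub> b) \<odot>\<^bsub>B\<^esub> x = a \<odot>\<^bsub>B\<^esub> (b \<odot>\<^bsub>B\<^esub> x)"
    using op_closed[of x] by (intro ext; auto simp: smult_add_left)+
next
  fix a x y assume "x \<in> carrier B" "y \<in> carrier B"
  then show "a \<odot>\<^bsub>B\<^esub> (x \<oplus>\<^bsub>B\<^esub> y) = a \<odot>\<^bsub>B\<^esub> x \<oplus>\<^bsub>B\<^esub> a \<odot>\<^bsub>B\<^esub> y"
    using op_closed by (intro ext) (auto simp: smult_add_right)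
qed auto

lemma normed_ops: "complex_normed B (cnorm B)"
proof -
  interpret O: Module.module complex_ring B
    by (rule module_ops)
  interpret O: complex_module B ..
  show ?thesis
  proof
    fix S T :: "'h \<Rightarrow> 'h" and c
    assume "S \<in> carrier B" "T \<in> carrier B"
    then have S: "S \<in> bounded_maps H H" and T: "T \<in> bounded_maps H H"
      by simp_all
    show "0 \<le> cnorm B S"
      by (rule op_norm_nonneg[OF S])
    have "hnorm H ((S \<oplus>\<^bsub>B\<^esub> T) x) \<le> (cnorm B S + cnorm B T) * hnorm H x"
      if x: "x \<in> carrier H" for x
      using x N_triangle[of "S x" "T x"] op_norm_bound[OF S x] op_norm_bound[OF T x]
        op_closed[OF S x] op_closed[OF T x]
      by (simp add: distrib_right del: bounded_ops_simps(8))
    then show "cnorm B (S \<oplus>\<^bsub>B\<^esub> T) \<le> cnorm B S + cnorm B T"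
      using op_norm_nonneg[OF S] op_norm_nonneg[OF T]
      by (intro op_norm_le) (auto simp del: bounded_ops_simps)
    show "cnorm B S = 0 \<longleftrightarrow> S = \<zero>\<^bsub>B\<^esub>"
    proof
      assume 0: "cnorm B S = 0"
      have "S x = \<zero>" if x: "x \<in> carrier H" for x
        using op_norm_bound[OF S x] N_nonneg[OF op_closed[OF S x]] op_closed[OF S x]
        unfolding 0 by (simp add: N_eq_0)
      then show "S = \<zero>\<^bsub>B\<^esub>"
        using S by (intro op_eqI) auto
    next
      assume "S = \<zero>\<^bsub>B\<^esub>"
      then have "cnorm B S \<le> 0"
        by (intro op_norm_le) auto
      then show "cnorm B S = 0"
        using op_norm_nonneg[OF S] by linarith
    qed
    have le: "cnorm B (c \<odot>\<^bsub>B\<^esub> S) \<le> cmod c * cnorm B S" if S: "S \<in> bounded_maps H H" for c S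
    proof (rule op_norm_le)
      show "hnorm H ((c \<odot>\<^bsub>B\<^esub> S) x) \<le> cmod c * cnorm B S * hnorm H x" if x: "x \<in> carrier H" for x
        using x op_norm_bound[OF S x] op_closed[OF S x] mult_left_mono[of "hnorm H (S x)" _ "cmod c"]
        by (simp add: N_smult mult.assoc del: bounded_ops_simps(8))
    qed (use op_norm_nonneg[OF S] in \<open>simp del: bounded_ops_simps\<close>)
    show "cnorm B (c \<odot>\<^bsub>B\<^esub> S) = cmod c * cnorm B S"
    proof (cases "c = 0")
      case True
      then show ?thesis
        using le[OF S, of c] op_norm_nonneg[of "c \<odot>\<^bsub>B\<^esub> S"] S
        by (simp del: bounded_ops_simps(8))
    next
      case False
      have "cnorm B ((1 / c) \<odot>\<^bsub>B\<^esub> (c \<odot>\<^bsub>B\<^esub> S)) \<le> cmod (1 / c) * cnorm B (c \<odot>\<^bsub>B\<^esub> S)"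
        using S by (intro le) simp
      moreover have "(1 / c) \<odot>\<^bsub>B\<^esub> (c \<odot>\<^bsub>B\<^esub> S) = S"
        using O.smult_smult[of S "1 / c" c] O.smult_1[of S] S False
        by (simp del: bounded_ops_simps(6) O.smult_smult)
      ultimately have "cmod c * cnorm B S \<le> cnorm B (c \<odot>\<^bsub>B\<^esub> S)"
        using False by (simp add: norm_divide field_simps del: bounded_ops_simps)
      then show ?thesis
        using le[OF S, of c] by linarith
    qed
  qed
qed

lemma adjoint_involution: "T \<in> bounded_maps H H \<Longrightarrow> adjoint_map H H (adjoint_map H H T) = T"
proof (rule op_eqI)
  fix x assume T: "T \<in> bounded_maps H H" and x: "x \<in> carrier H"
  show "adjoint_map H H (adjoint_map H H T) x = T x"
  proof (rule adjoint_map_eqI)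
    fix z assume z: "z \<in> carrier H"
    have "ip H (adjoint_map H H T z) x = cnj (ip H x (adjoint_map H H T z))"
      using s_cnj adjoint_map_closed[OF T z] x by blast
    also have "\<dots> = cnj (ip H (T x) z)"
      using adjoint_map_ip[OF T z x] by simp
    also have "\<dots> = ip H z (T x)"
      using s_cnj[of "T x" z] op_closed[OF T x] z by simp
    finally show "ip H (adjoint_map H H T z) x = ip H z (T x)" .
  qed (use T x op_closed in auto)
qed auto

text \<open>The universal property of the free product is applied to this algebra.\<close>

theorem cstar_bounded_ops: "unital_cstar_algebra B"
proof -
  interpret O: Module.module complex_ring B
    by (rule module_ops)
  interpret O: complex_module B ..
  interpret O: complex_normed B "cnorm B"
    by (rule normed_ops)
  have "cstar_dist B = O.ndist"
    by (intro ext) (simp only: cstar_dist_def O.ndist_def)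
  have submult: "cnorm B (S \<otimes>\<^bsub>B\<^esub> T) \<le> cnorm B S * cnorm B T"
    if S: "S \<in> bounded_maps H H" and T: "T \<in> bounded_maps H H" for S T
  proof (rule op_norm_le)
    show "hnorm H ((S \<otimes>\<^bsub>B\<^esub> T) x) \<le> cnorm B S * cnorm B T * hnorm H x" if x: "x \<in> carrier H" for x
      using x op_norm_compose_bound[OF S T x] by (simp add: compose_eq del: bounded_ops_simps(8))
  qed (use op_norm_nonneg S T in \<open>simp del: bounded_ops_simps\<close>)
  have star_le: "cnorm B (star B T) \<le> cnorm B T" if T: "T \<in> bounded_maps H H" for T
  proof (rule op_norm_le)
    show "hnorm H (star B T x) \<le> cnorm B T * hnorm H x" if x: "x \<in> carrier H" for x
      using adjoint_bound[OF T x op_norm_nonneg[OF T] op_norm_bound[OF T]]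
      by (simp del: bounded_ops_simps(8))
  qed (rule op_norm_nonneg[OF T])
  have "O.ms.mcomplete"
    unfolding O.mcomplete_iff
  proof (intro allI impI, elim conjE)
    fix T :: "nat \<Rightarrow> 'h \<Rightarrow> 'h"
    assume "\<forall>n. T n \<in> carrier B"
      and cauchy: "\<forall>e>0. \<exists>M. \<forall>m\<ge>M. \<forall>n\<ge>M. cnorm B (T m \<ominus>\<^bsub>B\<^esub> T n) < e"
    then have T: "T n \<in> bounded_maps H H" for n
      by simp
    have diff_le: "hnorm H (T m x \<ominus> T n x) \<le> cnorm B (T m \<ominus>\<^bsub>B\<^esub> T n) * hnorm H x"
      if x: "x \<in> carrier H" for m n x
    proof -
      have "T m \<ominus>\<^bsub>B\<^esub> T n \<in> bounded_maps H H"
        using O.minus_closed[of "T m" "T n"] T by (simp del: bounded_ops_simps(2-8))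
      moreover have "(T m \<ominus>\<^bsub>B\<^esub> T n) x = T m x \<ominus> T n x"
        using O.diff_eq_smult[of "T m" "T n"] T x op_closed[OF T x] by (simp add: diff_eq_smult)
      ultimately show ?thesis
        using op_norm_bound[of "T m \<ominus>\<^bsub>B\<^esub> T n" x] x by simp
    qed
    have uniform: "\<exists>M. \<forall>m\<ge>M. \<forall>n\<ge>M. \<forall>x\<in>carrier H. hnorm H (T m x \<ominus> T n x) \<le> e * hnorm H x"
      if "e > 0" for e
    proof -
      obtain M where M: "\<And>m n. m \<ge> M \<Longrightarrow> n \<ge> M \<Longrightarrow> cnorm B (T m \<ominus>\<^bsub>B\<^esub> T n) < e"
        using cauchy \<open>e > 0\<close> by blast
      have "hnorm H (T m x \<ominus> T n x) \<le> e * hnorm H x" if "m \<ge> M" "n \<ge> M" "x \<in> carrier H" for m n x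
        using diff_le[OF that(3), of m n] M[OF that(1,2)] N_nonneg[OF that(3)]
          mult_right_mono[of "cnorm B (T m \<ominus>\<^bsub>B\<^esub> T n)" e "hnorm H x"] by linarith
      then show ?thesis by blast
    qed
    have "\<exists>l\<in>carrier H. (\<lambda>n. hnorm H (T n x \<ominus> l)) \<longlonglongrightarrow> 0" if x: "x \<in> carrier H" for x
    proof -
      have "\<exists>M. \<forall>m\<ge>M. \<forall>n\<ge>M. hnorm H (T m x \<ominus> T n x) < e" if e: "e > 0" for e
      proof -
        have pos: "e / (hnorm H x + 1) > 0"
          using N_nonneg[OF x] e by simp
        have less: "e / (hnorm H x + 1) * hnorm H x < e"
          using N_nonneg[OF x] e by (simp add: field_simps)
        show ?thesis
        proof -
          obtain M where M: "\<forall>m\<ge>M. \<forall>n\<ge>M. \<forall>x'\<in>carrier H.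
              hnorm H (T m x' \<ominus> T n x') \<le> e / (hnorm H x + 1) * hnorm H x'"
            using uniform[OF pos] by blast
          have "hnorm H (T m x \<ominus> T n x) < e" if "m \<ge> M" "n \<ge> M" for m n
            using M that x less by (blast intro: le_less_trans)
          then show ?thesis by blast
        qed
      qed
      then show ?thesis
        using mcomplete[unfolded mcomplete_iff, THEN spec, of "\<lambda>n. T n x"] op_closed[OF T x] by simp
    qed
    then obtain L where L: "\<And>x. x \<in> carrier H \<Longrightarrow> L x \<in> carrier H"
        and lim: "\<And>x. x \<in> carrier H \<Longrightarrow> (\<lambda>n. hnorm H (T n x \<ominus> L x)) \<longlonglongrightarrow> 0"
      by metis
    define U where "U = (\<lambda>x\<in>carrier H. L x)"
    have lim_ip: "(\<lambda>n. ip H (T n x) z) \<longlonglongrightarrow> ip H (U x) z"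
      if "x \<in> carrier H" "z \<in> carrier H" for x z
      using that tendsto_ip_left[OF op_closed[OF T that(1)] L[OF that(1)] that(2) lim[OF that(1)]]
      by (simp add: U_def)
    have U_closed: "U x \<in> carrier H" if "x \<in> carrier H" for x
      using L that by (simp add: U_def)
    have near: "\<exists>M. \<forall>n\<ge>M. \<forall>x\<in>carrier H. hnorm H (T n x \<ominus> U x) \<le> e * hnorm H x"
      if e: "e > 0" for e
    proof -
      obtain M where M: "\<forall>m\<ge>M. \<forall>n\<ge>M. \<forall>x\<in>carrier H. hnorm H (T m x \<ominus> T n x) \<le> e * hnorm H x"
        using uniform[OF e] by blast
      have "hnorm H (T n x \<ominus> U x) \<le> e * hnorm H x" if n: "n \<ge> M" and x: "x \<in> carrier H" for n x
      proof -
        have "(\<lambda>m. e * hnorm H x + hnorm H (T m x \<ominus> U x)) \<longlonglongrightarrow> e * hnorm H x + 0"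
          using lim[OF x] x by (intro tendsto_add tendsto_const) (simp add: U_def)
        moreover have "\<exists>N. \<forall>m\<ge>N. hnorm H (T n x \<ominus> U x) \<le> e * hnorm H x + hnorm H (T m x \<ominus> U x)"
        proof (intro exI allI impI)
          fix m assume "m \<ge> M"
          then have "hnorm H (T n x \<ominus> T m x) \<le> e * hnorm H x"
            using M n x by blast
          then show "hnorm H (T n x \<ominus> U x) \<le> e * hnorm H x + hnorm H (T m x \<ominus> U x)"
            using N_triangle_diff[OF op_closed[OF T x] op_closed[OF T x] U_closed[OF x], of n m] by linarith
        qed
        ultimately show ?thesis
          using LIMSEQ_le_const by fastforce
      qed
      then show ?thesis by blast
    qed
    have U: "U \<in> bounded_maps H H"
    proof -
      obtain M where M: "\<And>x. x \<in> carrier H \<Longrightarrow> hnorm H (T M x \<ominus> U x) \<le> 1 * hnorm H x"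
        using near[of 1] by auto
      show ?thesis
      proof (rule bounded_mapsI)
        fix x y c assume x: "x \<in> carrier H"
        show "U x \<in> carrier H"
          by (rule U_closed[OF x])
        show "U (c \<odot> x) = c \<odot> U x"
        proof (rule ip_eqI_left)
          fix z assume z: "z \<in> carrier H"
          have "(\<lambda>n. ip H (T n (c \<odot> x)) z) \<longlonglongrightarrow> c * ip H (U x) z"
            using tendsto_mult_left[OF lim_ip[OF x z], of c] x z bounded_mapsD(4)[OF T x] op_closed[OF T x]
            by (simp add: s_linear)
          then show "ip H (U (c \<odot> x)) z = ip H (c \<odot> U x) z"
            using LIMSEQ_unique lim_ip[of "c \<odot> x" z] x z U_closed by (simp add: s_linear)
        qed (use x U_closed in auto)
        show "hnorm H (U x) \<le> (1 + cnorm B (T M)) * hnorm H x"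
          using N_le_diff[OF U_closed[OF x] op_closed[OF T x, of M]] M[OF x] op_norm_bound[OF T x, of M]
            N_diff_commute[OF U_closed[OF x] op_closed[OF T x, of M]]
          by (simp add: distrib_right del: bounded_ops_simps)
        assume y: "y \<in> carrier H"
        show "U (x \<oplus> y) = U x \<oplus> U y"
        proof (rule ip_eqI_left)
          fix z assume z: "z \<in> carrier H"
          have "(\<lambda>n. ip H (T n (x \<oplus> y)) z) \<longlonglongrightarrow> ip H (U x) z + ip H (U y) z"
            using tendsto_add[OF lim_ip[OF x z] lim_ip[OF y z]] x y z bounded_mapsD(3)[OF T x y]
              op_closed[OF T x] op_closed[OF T y]
            by (simp add: s_linear)
          then show "ip H (U (x \<oplus> y)) z = ip H (U x \<oplus> U y) z"
            using LIMSEQ_unique lim_ip[of "x \<oplus> y" z] x y z U_closed by (simp add: s_linear)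
        qed (use x y U_closed in auto)
      qed (simp add: U_def)
    qed
    have "(\<lambda>n. cnorm B (T n \<ominus>\<^bsub>B\<^esub> U)) \<longlonglongrightarrow> 0"
    proof (rule LIMSEQ_I)
      fix e :: real assume "e > 0"
      then obtain M where M: "\<And>n x. n \<ge> M \<Longrightarrow> x \<in> carrier H \<Longrightarrow> hnorm H (T n x \<ominus> U x) \<le> e / 2 * hnorm H x"
        using near[of "e / 2"] by auto
      have "norm (cnorm B (T n \<ominus>\<^bsub>B\<^esub> U) - 0) < e" if n: "n \<ge> M" for n
      proof -
        have diff: "T n \<ominus>\<^bsub>B\<^esub> U \<in> bounded_maps H H"
          using O.minus_closed[of "T n" U] T U by (simp del: bounded_ops_simps(2-8))
        have "cnorm B (T n \<ominus>\<^bsub>B\<^esub> U) \<le> e / 2"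
        proof (rule op_norm_le)
          fix x assume x: "x \<in> carrier H"
          have "(T n \<ominus>\<^bsub>B\<^esub> U) x = T n x \<ominus> U x"
            using O.diff_eq_smult[of "T n" U] T U x op_closed[OF T x] U_closed[OF x]
            by (simp add: diff_eq_smult)
          then show "hnorm H ((T n \<ominus>\<^bsub>B\<^esub> U) x) \<le> e / 2 * hnorm H x"
            using M[OF n x] by simp
        qed (use \<open>e > 0\<close> in simp)
        then show ?thesis
          using op_norm_nonneg[OF diff] \<open>e > 0\<close> by (simp del: bounded_ops_simps)
      qed
      then show "\<exists>no. \<forall>n\<ge>no. norm (cnorm B (T n \<ominus>\<^bsub>B\<^esub> U) - 0) < e"
        by blast
    qed
    then show "\<exists>l\<in>carrier B. (\<lambda>n. cnorm B (T n \<ominus>\<^bsub>B\<^esub> l)) \<longlonglongrightarrow> 0"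
      using U by (intro bexI[of _ U]) (simp_all del: bounded_ops_simps(2-8))
  qed
  then have complete: "Metric_space.mcomplete (carrier B) (cstar_dist B)"
    unfolding \<open>cstar_dist B = O.ndist\<close> .
  show ?thesis
  proof unfold_locales
    fix S T R :: "'h \<Rightarrow> 'h" and c
    assume "S \<in> carrier B"
    then have S: "S \<in> bounded_maps H H"
      by simp
    note SD = bounded_mapsD[OF S] and adS = adjoint_map[OF S]
    show "\<one>\<^bsub>B\<^esub> \<otimes>\<^bsub>B\<^esub> S = S" "S \<otimes>\<^bsub>B\<^esub> \<one>\<^bsub>B\<^esub> = S"
      using S SD(1) by (rule_tac op_eqI; simp add: compose_eq)+
    show "star B S \<in> carrier B" "star B (star B S) = S"
      using S by (simp_all add: adjoint_involution)
    show "star B (c \<odot>\<^bsub>B\<^esub> S) = cnj c \<odot>\<^bsub>B\<^esub> star B S"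
    proof (rule op_eqI)
      fix x assume x: "x \<in> carrier H"
      have "star B (c \<odot>\<^bsub>B\<^esub> S) x = cnj c \<odot> star B S x"
        unfolding bounded_ops_simps
        using x S adS SD(1) by (intro adjoint_map_eqI) (auto simp: s_linear)
      then show "star B (c \<odot>\<^bsub>B\<^esub> S) x = (cnj c \<odot>\<^bsub>B\<^esub> star B S) x"
        using x by simp
    qed (use S in simp_all)
    show "0 \<le> cnorm B S" "cnorm B S = 0 \<longleftrightarrow> S = \<zero>\<^bsub>B\<^esub>" "cnorm B (c \<odot>\<^bsub>B\<^esub> S) = cmod c * cnorm B S"
      using \<open>S \<in> carrier B\<close> O.N_nonneg O.N_eq_0 O.N_smult by blast+
    show "cnorm B (star B S \<otimes>\<^bsub>B\<^esub> S) = (cnorm B S)\<^sup>2"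
    proof (rule antisym)
      have "cnorm B (star B S \<otimes>\<^bsub>B\<^esub> S) \<le> cnorm B (star B S) * cnorm B S"
        using S by (intro submult) simp_all
      also have "\<dots> \<le> cnorm B S * cnorm B S"
        using star_le[OF S] op_norm_nonneg[OF S] by (intro mult_right_mono)
      finally show "cnorm B (star B S \<otimes>\<^bsub>B\<^esub> S) \<le> (cnorm B S)\<^sup>2"
        by (simp only: power2_eq_square)
      have SS: "star B S \<otimes>\<^bsub>B\<^esub> S \<in> bounded_maps H H"
        using S by simp
      define K where "K = cnorm B (star B S \<otimes>\<^bsub>B\<^esub> S)"
      have K: "K \<ge> 0"
        unfolding K_def by (rule op_norm_nonneg[OF SS])
      \<comment> \<open>\<open>\<parallel>S x\<parallel>\<^sup>2 = \<langle>x, S\<^sup>* S x\<rangle> \<le> K \<parallel>x\<parallel>\<^sup>2\<close>.\<close>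
      have "cnorm B S \<le> sqrt K"
      proof (rule op_norm_le)
        fix x assume x: "x \<in> carrier H"
        have "of_real ((hnorm H (S x))\<^sup>2) = ip H x (star B S (S x))"
          using ip_self[OF SD(1)[OF x]] adS(2)[OF SD(1)[OF x] x] by simp
        then have "(hnorm H (S x))\<^sup>2 = cmod (ip H x (star B S (S x)))"
          by (metis abs_of_nonneg norm_of_real zero_le_power2)
        also have "\<dots> \<le> hnorm H x * hnorm H ((star B S \<otimes>\<^bsub>B\<^esub> S) x)"
          using ip_CS[OF x, of "star B S (S x)"] x adS(1) SD(1) by (simp add: compose_eq)
        also have "\<dots> \<le> hnorm H x * (K * hnorm H x)"
          unfolding K_def using op_norm_bound[OF SS x] N_nonneg[OF x] by (intro mult_left_mono)
        also have "\<dots> = (sqrt K * hnorm H x)\<^sup>2"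
          using K by (simp add: power_mult_distrib power2_eq_square)
        finally show "hnorm H (S x) \<le> sqrt K * hnorm H x"
          by (rule power2_le_imp_le) (use K N_nonneg[OF x] in simp)
      qed (use K in simp)
      then have "(cnorm B S)\<^sup>2 \<le> (sqrt K)\<^sup>2"
        using op_norm_nonneg[OF S] by (rule power_mono)
      then show "(cnorm B S)\<^sup>2 \<le> cnorm B (star B S \<otimes>\<^bsub>B\<^esub> S)"
        using K by (simp only: real_sqrt_pow2 K_def)
    qed
    assume "T \<in> carrier B"
    then have T: "T \<in> bounded_maps H H"
      by simp
    note TD = bounded_mapsD[OF T] and adT = adjoint_map[OF T]
    show "S \<otimes>\<^bsub>B\<^esub> T \<in> carrier B"
      using S T by simp
    show "(c \<odot>\<^bsub>B\<^esub> S) \<otimes>\<^bsub>B\<^esub> T = c \<odot>\<^bsub>B\<^esub> (S \<otimes>\<^bsub>B\<^esub> T)" "S \<otimes>\<^bsub>B\<^esub> (c \<odot>\<^bsub>B\<^esub> T) = c \<odot>\<^bsub>B\<^esub> (S \<otimes>\<^bsub>B\<^esub> T)"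
      using S T SD TD by (rule_tac op_eqI; simp add: compose_eq)+
    show "star B (S \<oplus>\<^bsub>B\<^esub> T) = star B S \<oplus>\<^bsub>B\<^esub> star B T"
    proof (rule op_eqI)
      fix x assume x: "x \<in> carrier H"
      have "star B (S \<oplus>\<^bsub>B\<^esub> T) x = star B S x \<oplus> star B T x"
        unfolding bounded_ops_simps
        using x S T adS adT SD(1) TD(1) by (intro adjoint_map_eqI) (auto simp: s_linear)
      then show "star B (S \<oplus>\<^bsub>B\<^esub> T) x = (star B S \<oplus>\<^bsub>B\<^esub> star B T) x"
        using x by simp
    qed (use S T in simp_all)
    show "star B (S \<otimes>\<^bsub>B\<^esub> T) = star B T \<otimes>\<^bsub>B\<^esub> star B S"
    proof (rule op_eqI)
      fix x assume x: "x \<in> carrier H"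
      have "star B (S \<otimes>\<^bsub>B\<^esub> T) x = star B T (star B S x)"
        unfolding bounded_ops_simps
        using x S T adS adT SD(1) TD(1) by (intro adjoint_map_eqI) (auto simp: compose_eq)
      then show "star B (S \<otimes>\<^bsub>B\<^esub> T) x = (star B T \<otimes>\<^bsub>B\<^esub> star B S) x"
        using x by (simp add: compose_eq)
    qed (use S T in simp_all)
    show "cnorm B (S \<oplus>\<^bsub>B\<^esub> T) \<le> cnorm B S + cnorm B T"
      using \<open>S \<in> carrier B\<close> \<open>T \<in> carrier B\<close> by (rule O.N_triangle)
    show "cnorm B (S \<otimes>\<^bsub>B\<^esub> T) \<le> cnorm B S * cnorm B T"
      by (rule submult[OF S T])
    assume "R \<in> carrier B"
    then have R: "R \<in> bounded_maps H H"
      by simp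
    note RD = bounded_mapsD[OF R]
    show "(S \<otimes>\<^bsub>B\<^esub> T) \<otimes>\<^bsub>B\<^esub> R = S \<otimes>\<^bsub>B\<^esub> (T \<otimes>\<^bsub>B\<^esub> R)"
      "(S \<oplus>\<^bsub>B\<^esub> T) \<otimes>\<^bsub>B\<^esub> R = S \<otimes>\<^bsub>B\<^esub> R \<oplus>\<^bsub>B\<^esub> T \<otimes>\<^bsub>B\<^esub> R"
      "S \<otimes>\<^bsub>B\<^esub> (T \<oplus>\<^bsub>B\<^esub> R) = S \<otimes>\<^bsub>B\<^esub> T \<oplus>\<^bsub>B\<^esub> S \<otimes>\<^bsub>B\<^esub> R"
      using S T R SD TD RD by (rule_tac op_eqI; simp add: compose_eq)+
  qed (use complete in simp_all)
qed

end

section \<open>Completion of a semi-inner product space\<close>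

text \<open>The completion is realized inside an arbitrary type \<open>'h\<close> with room for it: a vector \<open>\<xi>\<close> is
  encoded by the function \<open>b \<mapsto> \<langle>\<xi>, b\<rangle>\<close>, carried over to \<open>'h\<close> by the injection \<open>g\<close>.\<close>

locale ip_completion = semi_ip V s
  for V :: "(complex, 'a, 'm) module_scheme" (structure) and s :: "'a \<Rightarrow> 'a \<Rightarrow> complex" +
  fixes g :: "('a \<Rightarrow> complex) \<Rightarrow> 'h"
  assumes inj_g: "inj g"
begin

definition cauchy :: "(nat \<Rightarrow> 'a) \<Rightarrow> bool" where
  "cauchy a \<longleftrightarrow> (\<forall>n. a n \<in> carrier V) \<and> (\<forall>e>0. \<exists>M. \<forall>m\<ge>M. \<forall>n\<ge>M. sn (a m \<ominus> a n) < e)"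

text \<open>The sequence \<open>a\<close> is Cauchy and converges to \<open>\<xi>\<close> in the completion.\<close>

definition represents :: "(nat \<Rightarrow> 'a) \<Rightarrow> 'h \<Rightarrow> bool" where
  "represents a \<xi> \<longleftrightarrow> cauchy a \<and> (\<exists>f\<in>extensional (carrier V). \<xi> = g f \<and>
     (\<forall>b\<in>carrier V. (\<lambda>n. s (a n) b) \<longlonglongrightarrow> f b))"

definition dec :: "'h \<Rightarrow> 'a \<Rightarrow> complex" where
  "dec \<xi> = inv_into UNIV g \<xi>"

text \<open>If \<open>b\<close> converges to \<open>\<eta>\<close>, then \<open>\<langle>\<xi>, \<eta>\<rangle>\<close> is the limit of \<open>\<langle>\<xi>, b\<^sub>n\<rangle>\<close>. The choice of \<open>b\<close>
  does not matter by \<open>cip_tendsto\<close>.\<close>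

definition cip :: "'h \<Rightarrow> 'h \<Rightarrow> complex" where
  "cip \<xi> \<eta> = lim (\<lambda>n. dec \<xi> ((SOME b. represents b \<eta>) n))"

text \<open>The two ring components of the record are arbitrary.\<close>

definition completion :: "'h hilbert" where
  "completion = \<lparr>carrier = {\<xi>. \<exists>a. represents a \<xi>}, mult = (\<lambda>\<xi> \<eta>. \<xi>), one = g undefined,
     zero = g (\<lambda>b\<in>carrier V. 0), add = (\<lambda>\<xi> \<eta>. g (\<lambda>b\<in>carrier V. dec \<xi> b + dec \<eta> b)),
     smult = (\<lambda>c \<xi>. g (\<lambda>b\<in>carrier V. c * dec \<xi> b)), ip = cip\<rparr>"

definition emb :: "'a \<Rightarrow> 'h" where
  "emb v = g (\<lambda>b\<in>carrier V. s v b)"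

lemma dec_g [simp]: "dec (g f) = f"
  using inj_g by (simp add: dec_def)

lemma completion_simps:
  "carrier completion = {\<xi>. \<exists>a. represents a \<xi>}"
  "zero completion = g (\<lambda>b\<in>carrier V. 0)"
  "add completion = (\<lambda>\<xi> \<eta>. g (\<lambda>b\<in>carrier V. dec \<xi> b + dec \<eta> b))"
  "smult completion = (\<lambda>c \<xi>. g (\<lambda>b\<in>carrier V. c * dec \<xi> b))"
  "ip completion = cip"
  by (simp_all add: completion_def)

lemma cauchy_closed: "cauchy a \<Longrightarrow> a n \<in> carrier V"
  by (simp add: cauchy_def)

lemma cauchy_const [simp]: "v \<in> carrier V \<Longrightarrow> cauchy (\<lambda>n. v)"
  by (simp add: cauchy_def)

lemma cauchyI:
  assumes "\<And>n. a n \<in> carrier V"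
    and "\<And>e. e > 0 \<Longrightarrow> \<exists>M. \<forall>m\<ge>M. \<forall>n\<ge>M. sn (a m \<ominus> a n) < e"
  shows "cauchy a"
  using assms by (simp add: cauchy_def)

lemma cauchyD:
  assumes "cauchy a" "e > 0"
  obtains M where "\<And>m n. m \<ge> M \<Longrightarrow> n \<ge> M \<Longrightarrow> sn (a m \<ominus> a n) < e"
  using assms unfolding cauchy_def by metis

lemma cauchy_lipschitz:
  assumes a: "cauchy a" and b: "\<And>n. b n \<in> carrier V" and K: "0 \<le> K"
    and le: "\<And>m n. sn (b m \<ominus> b n) \<le> K * sn (a m \<ominus> a n)"
  shows "cauchy b"
proof (rule cauchyI)
  fix e :: real assume "e > 0"
  then have "e / (K + 1) > 0"
    using K by simp
  then obtain M where M: "\<And>m n. m \<ge> M \<Longrightarrow> n \<ge> M \<Longrightarrow> sn (a m \<ominus> a n) < e / (K + 1)"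
    using cauchyD[OF a] by metis
  have "sn (b m \<ominus> b n) < e" if "m \<ge> M" "n \<ge> M" for m n
  proof -
    have "sn (b m \<ominus> b n) \<le> K * (e / (K + 1))"
      using le[of m n] M[OF that] K mult_left_mono[of "sn (a m \<ominus> a n)" "e / (K + 1)" K] by linarith
    also have "\<dots> < e"
      using K \<open>e > 0\<close> by (simp add: field_simps)
    finally show ?thesis .
  qed
  then show "\<exists>M. \<forall>m\<ge>M. \<forall>n\<ge>M. sn (b m \<ominus> b n) < e"
    by blast
qed (rule b)

lemma cauchy_add:
  assumes a: "cauchy a" and b: "cauchy b"
  shows "cauchy (\<lambda>n. a n \<oplus> b n)"
proof (rule cauchyI)
  note ab [simp] = cauchy_closed[OF a] cauchy_closed[OF b]
  show "a n \<oplus> b n \<in> carrier V" for n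
    by simp
  fix e :: real assume "e > 0"
  then obtain M N where M: "\<And>m n. m \<ge> M \<Longrightarrow> n \<ge> M \<Longrightarrow> sn (a m \<ominus> a n) < e / 2"
      and N: "\<And>m n. m \<ge> N \<Longrightarrow> n \<ge> N \<Longrightarrow> sn (b m \<ominus> b n) < e / 2"
    using cauchyD[OF a, of "e / 2"] cauchyD[OF b, of "e / 2"] by (metis half_gt_zero)
  have "sn (a m \<oplus> b m \<ominus> (a n \<oplus> b n)) < e" if "m \<ge> max M N" "n \<ge> max M N" for m n
  proof -
    have "a m \<oplus> b m \<ominus> (a n \<oplus> b n) = (a m \<ominus> a n) \<oplus> (b m \<ominus> b n)"
      using ab(1)[of m] ab(1)[of n] ab(2)[of m] ab(2)[of n] by algebra
    then show ?thesis
      using sn_triangle[of "a m \<ominus> a n" "b m \<ominus> b n"] M[of m n] N[of m n] that by simp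
  qed
  then show "\<exists>M. \<forall>m\<ge>M. \<forall>n\<ge>M. sn (a m \<oplus> b m \<ominus> (a n \<oplus> b n)) < e"
    by blast
qed

lemma cauchy_smult:
  assumes a: "cauchy a"
  shows "cauchy (\<lambda>n. c \<odot> a n)"
proof (rule cauchy_lipschitz[OF a])
  show "sn (c \<odot> a m \<ominus> c \<odot> a n) \<le> cmod c * sn (a m \<ominus> a n)" for m n
    using cauchy_closed[OF a] by (simp add: smult_diff_right [symmetric] sn_smult)
qed (use cauchy_closed[OF a] in auto)

lemma cauchy_bounded:
  assumes a: "cauchy a"
  obtains K where "K > 0" "\<And>n. sn (a n) \<le> K"
proof -
  obtain M where M: "\<And>m n. m \<ge> M \<Longrightarrow> n \<ge> M \<Longrightarrow> sn (a m \<ominus> a n) < 1"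
    using cauchyD[OF a, of 1] by auto
  define K where "K = Max (sn ` a ` {..M}) + 1"
  have le: "sn (a n) \<le> K - 1" if "n \<le> M" for n
    using that unfolding K_def by simp
  have "sn (a n) \<le> K" for n
  proof (cases "n \<le> M")
    case False
    then have "sn (a n) \<le> sn (a n \<ominus> a M) + sn (a M)"
      using sn.N_le_diff cauchy_closed[OF a] by blast
    also have "\<dots> \<le> 1 + (K - 1)"
      using M[of n M] le[of M] False by simp
    finally show ?thesis by simp
  qed (use le in force)
  moreover have "K > 0"
    using le[of M] sn_nonneg[OF cauchy_closed[OF a, of M]] by simp
  ultimately show ?thesis
    using that by blast
qed

lemma s_convergent:
  assumes a: "cauchy a" and b: "cauchy b"
  shows "convergent (\<lambda>n. s (a n) (b n))"
proof (rule Cauchy_convergent, rule CauchyI)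
  note ab [simp] = cauchy_closed[OF a] cauchy_closed[OF b]
  obtain K where K: "K > 0" "\<And>n. sn (a n) \<le> K"
    using cauchy_bounded[OF a] by blast
  obtain L where L: "L > 0" "\<And>n. sn (b n) \<le> L"
    using cauchy_bounded[OF b] by blast
  fix e :: real assume "e > 0"
  obtain M where M: "\<And>m n. m \<ge> M \<Longrightarrow> n \<ge> M \<Longrightarrow> sn (a m \<ominus> a n) < e / (2 * L)"
    using cauchyD[OF a, of "e / (2 * L)"] \<open>e > 0\<close> L(1) by (metis divide_pos_pos mult_pos_pos zero_less_numeral)
  obtain N where N: "\<And>m n. m \<ge> N \<Longrightarrow> n \<ge> N \<Longrightarrow> sn (b m \<ominus> b n) < e / (2 * K)"
    using cauchyD[OF b, of "e / (2 * K)"] \<open>e > 0\<close> K(1) by (metis divide_pos_pos mult_pos_pos zero_less_numeral)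
  have "norm (s (a m) (b m) - s (a n) (b n)) < e" if "m \<ge> max M N" "n \<ge> max M N" for m n
  proof -
    have "s (a m) (b m) - s (a n) (b n) = s (a m \<ominus> a n) (b m) + s (a n) (b m \<ominus> b n)"
      by (simp add: s_linear)
    then have "norm (s (a m) (b m) - s (a n) (b n))
        \<le> sn (a m \<ominus> a n) * sn (b m) + sn (a n) * sn (b m \<ominus> b n)"
      using norm_triangle_ineq[of "s (a m \<ominus> a n) (b m)" "s (a n) (b m \<ominus> b n)"]
        cauchy_schwarz[of "a m \<ominus> a n" "b m"] cauchy_schwarz[of "a n" "b m \<ominus> b n"] by simp
    also have "\<dots> \<le> sn (a m \<ominus> a n) * L + K * sn (b m \<ominus> b n)"
      using L(2) K(2) sn_nonneg by (intro add_mono mult_left_mono mult_right_mono) auto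
    also have "\<dots> < e / (2 * L) * L + K * (e / (2 * K))"
      using M[of m n] N[of m n] that L(1) K(1) by (intro add_strict_mono mult_strict_right_mono mult_strict_left_mono) auto
    also have "\<dots> = e"
      using L(1) K(1) by simp
    finally show ?thesis .
  qed
  then show "\<exists>M. \<forall>m\<ge>M. \<forall>n\<ge>M. norm (s (a m) (b m) - s (a n) (b n)) < e"
    by blast
qed

lemma representsD:
  assumes "represents a \<xi>"
  shows "cauchy a" "dec \<xi> \<in> extensional (carrier V)" "g (dec \<xi>) = \<xi>"
    and "b \<in> carrier V \<Longrightarrow> (\<lambda>n. s (a n) b) \<longlonglongrightarrow> dec \<xi> b"
  using assms by (auto simp: represents_def)

lemma represents_mem: "represents a \<xi> \<Longrightarrow> a n \<in> carrier V"
  using representsD(1) cauchy_closed by blast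

lemma representsI:
  assumes "cauchy a" "f \<in> extensional (carrier V)" "\<And>b. b \<in> carrier V \<Longrightarrow> (\<lambda>n. s (a n) b) \<longlonglongrightarrow> f b"
  shows "represents a (g f)"
  using assms by (auto simp: represents_def)

lemma represents_unique:
  assumes a: "represents a \<xi>" and b: "represents a \<eta>"
  shows "\<xi> = \<eta>"
proof -
  have "dec \<xi> = dec \<eta>"
    using representsD(2,4)[OF a] representsD(2,4)[OF b] LIMSEQ_unique
    by (intro extensionalityI[of _ "carrier V"]) blast+
  then show ?thesis
    using representsD(3)[OF a] representsD(3)[OF b] by metis
qed

text \<open>Testing \<open>\<xi>\<close> and \<open>a\<^sub>n\<close> against \<open>b\<^sub>n\<close> gives nearly the same, uniformly on bounded sequences \<open>b\<close>.\<close>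

lemma dec_tendsto:
  assumes a: "represents a \<xi>" and b: "cauchy b"
  shows "(\<lambda>n. dec \<xi> (b n) - s (a n) (b n)) \<longlonglongrightarrow> 0"
proof (rule LIMSEQ_I)
  note ab [simp] = represents_mem[OF a] cauchy_closed[OF b]
  obtain K where K: "K > 0" "\<And>n. sn (b n) \<le> K"
    using cauchy_bounded[OF b] by blast
  fix e :: real assume "e > 0"
  then have "e / (2 * K) > 0"
    using K(1) by simp
  then obtain M where M: "\<And>m n. m \<ge> M \<Longrightarrow> n \<ge> M \<Longrightarrow> sn (a m \<ominus> a n) < e / (2 * K)"
    using cauchyD[OF representsD(1)[OF a]] by metis
  have "norm (dec \<xi> (b n) - s (a n) (b n)) \<le> e / 2" if n: "n \<ge> M" for n
  proof (rule LIMSEQ_le_const2)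
    show "(\<lambda>m. norm (s (a m) (b n) - s (a n) (b n))) \<longlonglongrightarrow> norm (dec \<xi> (b n) - s (a n) (b n))"
      by (intro tendsto_norm tendsto_diff tendsto_const representsD(4)[OF a]) simp
    show "\<exists>N. \<forall>m\<ge>N. norm (s (a m) (b n) - s (a n) (b n)) \<le> e / 2"
    proof (intro exI allI impI)
      fix m assume "m \<ge> M"
      have "norm (s (a m) (b n) - s (a n) (b n)) \<le> sn (a m \<ominus> a n) * sn (b n)"
        using cauchy_schwarz[of "a m \<ominus> a n" "b n"] by (simp add: s_linear)
      also have "\<dots> \<le> e / (2 * K) * K"
        using M[OF \<open>m \<ge> M\<close> n] K sn_nonneg \<open>e / (2 * K) > 0\<close> by (intro mult_mono) auto
      finally show "norm (s (a m) (b n) - s (a n) (b n)) \<le> e / 2"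
        using K(1) by simp
    qed
  qed
  then show "\<exists>no. \<forall>n\<ge>no. norm (dec \<xi> (b n) - s (a n) (b n) - 0) < e"
    using \<open>e > 0\<close> by (intro exI[of _ M]) force
qed

text \<open>Independence of the representing sequences comes from symmetry. The limit of \<open>\<langle>a\<^sub>n, b\<^sub>n\<rangle>\<close> is that
  of \<open>\<langle>\<xi>, b\<^sub>n\<rangle>\<close>, in which \<open>a\<close> does not occur, and by conjugation that of the conjugate of
  \<open>\<langle>\<eta>, a\<^sub>n\<rangle>\<close>, in which \<open>b\<close> does not occur.\<close>

lemma cip_tendsto:
  assumes a: "represents a \<xi>" and b: "represents b \<eta>"
  shows "(\<lambda>n. s (a n) (b n)) \<longlonglongrightarrow> cip \<xi> \<eta>"
proof -
  define b' where "b' = (SOME b. represents b \<eta>)"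
  have b': "represents b' \<eta>"
    unfolding b'_def by (rule someI[where P = "\<lambda>b. represents b \<eta>", OF b])
  note ca = representsD(1)[OF a] and cb = representsD(1)[OF b] and cb' = representsD(1)[OF b']
  obtain L where L: "(\<lambda>n. s (a n) (b' n)) \<longlonglongrightarrow> L"
    using s_convergent[OF ca cb'] by (auto simp: convergent_def)
  have "(\<lambda>n. dec \<xi> (b' n)) \<longlonglongrightarrow> L"
    using Lim_transform[OF L dec_tendsto[OF a cb']] .
  then have cip: "cip \<xi> \<eta> = L"
    unfolding cip_def b'_def [symmetric] by (rule limI)
  have swap: "s y x = cnj (s x y)" if "x \<in> carrier V" "y \<in> carrier V" for x y
    using s_cnj that .
  have "(\<lambda>n. s (b' n) (a n)) \<longlonglongrightarrow> cnj L"
    unfolding swap[OF cauchy_closed[OF ca] cauchy_closed[OF cb']] by (rule tendsto_cnj[OF L])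
  then have "(\<lambda>n. dec \<eta> (a n)) \<longlonglongrightarrow> cnj L"
    by (rule Lim_transform[OF _ dec_tendsto[OF b' ca]])
  then have "(\<lambda>n. s (b n) (a n)) \<longlonglongrightarrow> cnj L"
    by (rule Lim_transform2[OF _ dec_tendsto[OF b ca]])
  then have "(\<lambda>n. s (a n) (b n)) \<longlonglongrightarrow> cnj (cnj L)"
    unfolding swap[OF cauchy_closed[OF cb] cauchy_closed[OF ca]] by (rule tendsto_cnj)
  then show ?thesis
    by (simp add: cip)
qed

lemma represents_add:
  assumes a: "represents a \<xi>" and b: "represents b \<eta>"
  shows "represents (\<lambda>n. a n \<oplus> b n) (\<xi> \<oplus>\<^bsub>completion\<^esub> \<eta>)"
  unfolding completion_simps
proof (rule representsI)
  note ca = representsD(1)[OF a] and cb = representsD(1)[OF b]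
  show "cauchy (\<lambda>n. a n \<oplus> b n)"
    by (rule cauchy_add[OF ca cb])
  show "(\<lambda>n. s (a n \<oplus> b n) v) \<longlonglongrightarrow> (\<lambda>b\<in>carrier V. dec \<xi> b + dec \<eta> b) v" if "v \<in> carrier V" for v
    using that tendsto_add[OF representsD(4)[OF a that] representsD(4)[OF b that]]
      cauchy_closed[OF ca] cauchy_closed[OF cb] by (simp add: s_linear)
qed simp

lemma represents_smult:
  assumes a: "represents a \<xi>"
  shows "represents (\<lambda>n. c \<odot> a n) (c \<odot>\<^bsub>completion\<^esub> \<xi>)"
  unfolding completion_simps
proof (rule representsI)
  note ca = representsD(1)[OF a]
  show "cauchy (\<lambda>n. c \<odot> a n)"
    by (rule cauchy_smult[OF ca])
  show "(\<lambda>n. s (c \<odot> a n) v) \<longlonglongrightarrow> (\<lambda>b\<in>carrier V. c * dec \<xi> b) v" if "v \<in> carrier V" for v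
    using that tendsto_mult_left[OF representsD(4)[OF a that], of c] cauchy_closed[OF ca]
    by (simp add: s_linear)
qed simp

lemma represents_emb: "v \<in> carrier V \<Longrightarrow> represents (\<lambda>n. v) (emb v)"
  unfolding emb_def by (rule representsI) simp_all

lemma represents_zero: "represents (\<lambda>n. \<zero>) \<zero>\<^bsub>completion\<^esub>"
  unfolding completion_simps by (rule representsI) simp_all

lemma represents_exists:
  assumes a: "cauchy a"
  shows "\<exists>\<xi>. represents a \<xi>"
proof -
  have "represents a (g (\<lambda>b\<in>carrier V. lim (\<lambda>n. s (a n) b)))"
  proof (rule representsI[OF a])
    show "(\<lambda>n. s (a n) b) \<longlonglongrightarrow> (\<lambda>b\<in>carrier V. lim (\<lambda>n. s (a n) b)) b" if "b \<in> carrier V" for b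
      using s_convergent[OF a cauchy_const[OF that]] that by (simp add: convergent_LIMSEQ_iff)
  qed simp
  then show ?thesis ..
qed

lemma dec_eq_cip:
  assumes a: "represents a \<xi>" and v: "v \<in> carrier V"
  shows "dec \<xi> v = cip \<xi> (emb v)"
  using LIMSEQ_unique[OF representsD(4)[OF a v] cip_tendsto[OF a represents_emb[OF v]]] .

lemma completion_eqI:
  assumes "\<xi> \<in> carrier completion" "\<eta> \<in> carrier completion"
    and "\<And>v. v \<in> carrier V \<Longrightarrow> dec \<xi> v = dec \<eta> v"
  shows "\<xi> = \<eta>"
proof -
  obtain a b where ab: "represents a \<xi>" "represents b \<eta>"
    using assms(1,2) by (auto simp: completion_simps)
  have "dec \<xi> = dec \<eta>"
    using representsD(2)[OF ab(1)] representsD(2)[OF ab(2)] assms(3)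
    by (intro extensionalityI[of _ "carrier V"]) auto
  then show ?thesis
    using representsD(3)[OF ab(1)] representsD(3)[OF ab(2)] by metis
qed

lemma module_completion: "Module.module complex_ring completion"
proof -
  have dec_simps:
    "v \<in> carrier V \<Longrightarrow> dec (\<xi> \<oplus>\<^bsub>completion\<^esub> \<eta>) v = dec \<xi> v + dec \<eta> v"
    "v \<in> carrier V \<Longrightarrow> dec (c \<odot>\<^bsub>completion\<^esub> \<xi>) v = c * dec \<xi> v"
    "v \<in> carrier V \<Longrightarrow> dec \<zero>\<^bsub>completion\<^esub> v = 0" for \<xi> \<eta> v c
    by (simp_all add: completion_simps)
  have [simp]: "\<xi> \<oplus>\<^bsub>completion\<^esub> \<eta> \<in> carrier completion" "c \<odot>\<^bsub>completion\<^esub> \<xi> \<in> carrier completion"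
    if "\<xi> \<in> carrier completion" "\<eta> \<in> carrier completion" for \<xi> \<eta> c
    using that represents_add represents_smult unfolding completion_simps(1) by blast+
  have zero [simp]: "\<zero>\<^bsub>completion\<^esub> \<in> carrier completion"
    using represents_zero unfolding completion_simps(1) by blast
  show ?thesis
  proof (rule moduleI[OF cring_complex_ring])
    show "abelian_group completion"
    proof (rule abelian_groupI)
      show "\<exists>y\<in>carrier completion. y \<oplus>\<^bsub>completion\<^esub> x = \<zero>\<^bsub>completion\<^esub>" if "x \<in> carrier completion" for x
        using that by (intro bexI[of _ "(-1) \<odot>\<^bsub>completion\<^esub> x"] completion_eqI) (simp_all add: dec_simps)
    qed (auto intro!: completion_eqI simp: dec_simps)
  qed (auto intro!: completion_eqI simp: dec_simps algebra_simps)
qed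

text \<open>Completeness is shown by diagonalization: each \<open>\<xi>\<^sub>n\<close> is within \<open>1/(n + 1)\<close> of some \<open>emb v\<^sub>n\<close>,
  the sequence \<open>v\<close> is Cauchy, and what it represents is the limit of \<open>\<xi>\<close>.\<close>

theorem hilbert_completion: "hilbert_space completion"
proof -
  interpret C: Module.module complex_ring completion
    by (rule module_completion)
  interpret C: complex_module completion ..
  have rep: "\<exists>a. represents a \<xi>" if "\<xi> \<in> carrier completion" for \<xi>
    using that by (simp add: completion_simps)
  have ip: "ip completion (\<xi> \<oplus>\<^bsub>completion\<^esub> \<eta>) \<zeta> = ip completion \<xi> \<zeta> + ip completion \<eta> \<zeta>"
    "ip completion (c \<odot>\<^bsub>completion\<^esub> \<xi>) \<eta> = c * ip completion \<xi> \<eta>"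
    "ip completion \<eta> \<xi> = cnj (ip completion \<xi> \<eta>)"
    "ip completion \<xi> \<xi> \<in> \<real>\<^sub>\<ge>\<^sub>0"
    if xi: "\<xi> \<in> carrier completion" "\<eta> \<in> carrier completion" "\<zeta> \<in> carrier completion" for \<xi> \<eta> \<zeta> c
  proof -
    obtain a b d where a: "represents a \<xi>" and b: "represents b \<eta>" and d: "represents d \<zeta>"
      using rep xi by metis
    note [simp] = represents_mem[OF a] represents_mem[OF b]
      represents_mem[OF d]
    have "(\<lambda>n. s (a n) (d n) + s (b n) (d n)) \<longlonglongrightarrow> cip (\<xi> \<oplus>\<^bsub>completion\<^esub> \<eta>) \<zeta>"
      using cip_tendsto[OF represents_add[OF a b] d] by (simp add: s_linear)
    then show "ip completion (\<xi> \<oplus>\<^bsub>completion\<^esub> \<eta>) \<zeta> = ip completion \<xi> \<zeta> + ip completion \<eta> \<zeta>"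
      using tendsto_add[OF cip_tendsto[OF a d] cip_tendsto[OF b d]] LIMSEQ_unique
      unfolding completion_simps(5) by blast
    have "(\<lambda>n. c * s (a n) (b n)) \<longlonglongrightarrow> cip (c \<odot>\<^bsub>completion\<^esub> \<xi>) \<eta>"
      using cip_tendsto[OF represents_smult[OF a] b, of c] by (simp add: s_linear)
    then show "ip completion (c \<odot>\<^bsub>completion\<^esub> \<xi>) \<eta> = c * ip completion \<xi> \<eta>"
      using tendsto_mult_left[OF cip_tendsto[OF a b], of c] LIMSEQ_unique
      unfolding completion_simps(5) by blast
    have "s (b n) (a n) = cnj (s (a n) (b n))" for n
      by (rule s_cnj) simp_all
    then show "ip completion \<eta> \<xi> = cnj (ip completion \<xi> \<eta>)"
      using tendsto_cnj[OF cip_tendsto[OF a b]] cip_tendsto[OF b a] LIMSEQ_unique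
      unfolding completion_simps(5) by simp
    show "ip completion \<xi> \<xi> \<in> \<real>\<^sub>\<ge>\<^sub>0"
      unfolding completion_simps(5)
      by (rule closed_sequentially[OF closed_nonneg_Reals_complex _ cip_tendsto[OF a a]])
        (simp add: s_nonneg)
  qed
  interpret C: semi_ip completion "ip completion"
  proof
    fix x y z c
    assume x: "x \<in> carrier completion"
    show "ip completion x x \<in> \<real>\<^sub>\<ge>\<^sub>0"
      by (rule ip(4)[OF x x x])
    assume y: "y \<in> carrier completion"
    show "ip completion (c \<odot>\<^bsub>completion\<^esub> x) y = c * ip completion x y"
      by (rule ip(2)[OF x y y])
    show "ip completion y x = cnj (ip completion x y)"
      by (rule ip(3)[OF x y y])
    assume z: "z \<in> carrier completion"
    show "ip completion (x \<oplus>\<^bsub>completion\<^esub> y) z = ip completion x z + ip completion y z"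
      by (rule ip(1)[OF x y z])
  qed
  have sn_tendsto: "(\<lambda>n. sn (a n)) \<longlonglongrightarrow> C.sn \<xi>" if a: "represents a \<xi>" for a \<xi>
    unfolding sn_def C.sn_def unfolding completion_simps(5)
    by (intro tendsto_real_sqrt tendsto_Re cip_tendsto a)
  have definite: "\<xi> = \<zero>\<^bsub>completion\<^esub>" if xi: "\<xi> \<in> carrier completion" and 0: "C.sn \<xi> = 0" for \<xi>
  proof (rule completion_eqI)
    fix v assume v: "v \<in> carrier V"
    obtain a where a: "represents a \<xi>"
      using rep[OF xi] by blast
    have "(\<lambda>n. s (a n) v) \<longlonglongrightarrow> 0"
    proof (rule Lim_null_comparison)
      show "\<forall>\<^sub>F n in sequentially. norm (s (a n) v) \<le> sn (a n) * sn v"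
        using cauchy_schwarz represents_mem[OF a] v by simp
      show "(\<lambda>n. sn (a n) * sn v) \<longlonglongrightarrow> 0"
        using tendsto_mult_left_zero[OF sn_tendsto[OF a, unfolded 0]] .
    qed
    then show "dec \<xi> v = dec \<zero>\<^bsub>completion\<^esub> v"
      using LIMSEQ_unique representsD(4)[OF a v] v by (simp add: completion_simps)
  qed (use xi in simp_all)
  interpret C: complex_normed completion C.sn
  proof
    show "C.sn x = 0 \<longleftrightarrow> x = \<zero>\<^bsub>completion\<^esub>" if "x \<in> carrier completion" for x
      using definite[OF that] by auto
  qed
  have hdist: "hdist completion = C.ndist"
    by (intro ext) (simp add: hdist_def C.ndist_def hnorm_def C.sn_def)
  have emb_closed [simp]: "emb v \<in> carrier completion" if "v \<in> carrier V" for v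
    using represents_emb[OF that] unfolding completion_simps(1) by blast
  have represents_diff: "represents (\<lambda>n. a n \<ominus> b n) (\<xi> \<ominus>\<^bsub>completion\<^esub> \<eta>)"
    if a: "represents a \<xi>" and b: "represents b \<eta>" for a b \<xi> \<eta>
  proof -
    have "\<xi> \<in> carrier completion" "\<eta> \<in> carrier completion"
      using a b unfolding completion_simps(1) by blast+
    then show ?thesis
      using represents_add[OF a represents_smult[OF b, of "-1"]]
        represents_mem[OF a] represents_mem[OF b]
      by (simp add: diff_eq_smult C.diff_eq_smult)
  qed
  have emb_tendsto: "(\<lambda>n. C.sn (\<xi> \<ominus>\<^bsub>completion\<^esub> emb (a n))) \<longlonglongrightarrow> 0" if a: "represents a \<xi>" for a \<xi>
  proof (rule LIMSEQ_I)
    fix e :: real assume "e > 0"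
    then obtain M where M: "\<And>m n. m \<ge> M \<Longrightarrow> n \<ge> M \<Longrightarrow> sn (a m \<ominus> a n) < e / 2"
      using cauchyD[OF representsD(1)[OF a], of "e / 2"] by auto
    have "norm (C.sn (\<xi> \<ominus>\<^bsub>completion\<^esub> emb (a n)) - 0) < e" if n: "n \<ge> M" for n
    proof -
      have an: "a n \<in> carrier V"
        using represents_mem[OF a] .
      have "C.sn (\<xi> \<ominus>\<^bsub>completion\<^esub> emb (a n)) \<le> e / 2"
      proof (rule LIMSEQ_le_const2)
        show "(\<lambda>m. sn (a m \<ominus> a n)) \<longlonglongrightarrow> C.sn (\<xi> \<ominus>\<^bsub>completion\<^esub> emb (a n))"
          by (rule sn_tendsto[OF represents_diff[OF a represents_emb[OF an]]])
        show "\<exists>N. \<forall>m\<ge>N. sn (a m \<ominus> a n) \<le> e / 2"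
          using M[OF _ n] less_imp_le by blast
      qed
      moreover have "\<xi> \<in> carrier completion"
        using a unfolding completion_simps(1) by blast
      ultimately show ?thesis
        using C.sn_nonneg[of "\<xi> \<ominus>\<^bsub>completion\<^esub> emb (a n)"] an \<open>e > 0\<close> by simp
    qed
    then show "\<exists>no. \<forall>n\<ge>no. norm (C.sn (\<xi> \<ominus>\<^bsub>completion\<^esub> emb (a n)) - 0) < e"
      by blast
  qed
  have "C.ms.mcomplete"
    unfolding C.mcomplete_iff
  proof (intro allI impI, elim conjE)
    fix \<xi> :: "nat \<Rightarrow> 'h"
    assume xi_all: "\<forall>n. \<xi> n \<in> carrier completion"
      and cauchy_xi: "\<forall>e>0. \<exists>M. \<forall>m\<ge>M. \<forall>n\<ge>M. C.sn (\<xi> m \<ominus>\<^bsub>completion\<^esub> \<xi> n) < e"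
    have xi [simp]: "\<xi> n \<in> carrier completion" for n
      using xi_all by blast
    have "\<exists>v\<in>carrier V. C.sn (\<xi> n \<ominus>\<^bsub>completion\<^esub> emb v) < 1 / real (Suc n)" for n
    proof -
      obtain a where a: "represents a (\<xi> n)"
        using rep[OF xi] by blast
      obtain k where "C.sn (\<xi> n \<ominus>\<^bsub>completion\<^esub> emb (a k)) < 1 / real (Suc n)"
        using order_tendstoD(2)[OF emb_tendsto[OF a], of "1 / real (Suc n)"]
        by (auto simp: eventually_sequentially)
      then show ?thesis
        using represents_mem[OF a] by blast
    qed
    then obtain v where v [simp]: "\<And>n. v n \<in> carrier V"
        and near: "\<And>n. C.sn (\<xi> n \<ominus>\<^bsub>completion\<^esub> emb (v n)) < 1 / real (Suc n)"
      by metis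
    have inv0: "(\<lambda>n. 1 / real (Suc n)) \<longlonglongrightarrow> 0"
      using LIMSEQ_inverse_real_of_nat by (simp add: inverse_eq_divide)
    have sn_emb: "sn (x \<ominus> y) = C.sn (emb x \<ominus>\<^bsub>completion\<^esub> emb y)" if "x \<in> carrier V" "y \<in> carrier V" for x y
      using sn_tendsto[OF represents_diff[OF represents_emb[OF that(1)] represents_emb[OF that(2)]]]
      by (simp add: LIMSEQ_const_iff)
    have "cauchy v"
    proof (rule cauchyI)
      fix e :: real assume "e > 0"
      then obtain M where M: "\<forall>m\<ge>M. \<forall>n\<ge>M. C.sn (\<xi> m \<ominus>\<^bsub>completion\<^esub> \<xi> n) < e / 3"
        using cauchy_xi by (meson divide_pos_pos zero_less_numeral)
      obtain N where N: "\<And>n. n \<ge> N \<Longrightarrow> 1 / real (Suc n) < e / 3"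
        using order_tendstoD(2)[OF inv0, of "e / 3"] \<open>e > 0\<close> by (auto simp: eventually_sequentially)
      have "sn (v m \<ominus> v n) < e" if "m \<ge> max M N" "n \<ge> max M N" for m n
      proof -
        have "C.sn (emb (v m) \<ominus>\<^bsub>completion\<^esub> emb (v n)) \<le> C.sn (emb (v m) \<ominus>\<^bsub>completion\<^esub> \<xi> m) +
            (C.sn (\<xi> m \<ominus>\<^bsub>completion\<^esub> \<xi> n) + C.sn (\<xi> n \<ominus>\<^bsub>completion\<^esub> emb (v n)))"
          using C.sn.N_triangle_diff[of "emb (v m)" "\<xi> m" "emb (v n)"]
            C.sn.N_triangle_diff[of "\<xi> m" "\<xi> n" "emb (v n)"] by simp
        moreover have "C.sn (emb (v m) \<ominus>\<^bsub>completion\<^esub> \<xi> m) < e / 3"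
          using near[of m] N[of m] that C.sn.N_diff_commute[of "emb (v m)" "\<xi> m"] by simp
        moreover have "C.sn (\<xi> n \<ominus>\<^bsub>completion\<^esub> emb (v n)) < e / 3"
          using near[of n] N[of n] that by simp
        moreover have "C.sn (\<xi> m \<ominus>\<^bsub>completion\<^esub> \<xi> n) < e / 3"
          using M that by simp
        ultimately show ?thesis
          by (simp add: sn_emb)
      qed
      then show "\<exists>M. \<forall>m\<ge>M. \<forall>n\<ge>M. sn (v m \<ominus> v n) < e"
        by blast
    qed simp
    then obtain \<eta> where eta: "represents v \<eta>"
      using represents_exists by blast
    then have etaC: "\<eta> \<in> carrier completion"
      unfolding completion_simps(1) by blast
    have "(\<lambda>n. C.sn (\<xi> n \<ominus>\<^bsub>completion\<^esub> \<eta>)) \<longlonglongrightarrow> 0"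
    proof (rule Lim_null_comparison)
      have "C.sn (\<xi> n \<ominus>\<^bsub>completion\<^esub> \<eta>) \<le> 1 / real (Suc n) + C.sn (\<eta> \<ominus>\<^bsub>completion\<^esub> emb (v n))" for n
        using C.sn.N_triangle_diff[of "\<xi> n" "emb (v n)" \<eta>] near[of n] etaC
          C.sn.N_diff_commute[of "emb (v n)" \<eta>] by simp
      then show "\<forall>\<^sub>F n in sequentially. norm (C.sn (\<xi> n \<ominus>\<^bsub>completion\<^esub> \<eta>))
          \<le> 1 / real (Suc n) + C.sn (\<eta> \<ominus>\<^bsub>completion\<^esub> emb (v n))"
        using C.sn_nonneg etaC by simp
      show "(\<lambda>n. 1 / real (Suc n) + C.sn (\<eta> \<ominus>\<^bsub>completion\<^esub> emb (v n))) \<longlonglongrightarrow> 0"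
        using tendsto_add[OF inv0 emb_tendsto[OF eta]] by simp
    qed
    then show "\<exists>l\<in>carrier completion. (\<lambda>n. C.sn (\<xi> n \<ominus>\<^bsub>completion\<^esub> l)) \<longlonglongrightarrow> 0"
      using etaC by blast
  qed
  then have complete: "Metric_space.mcomplete (carrier completion) (hdist completion)"
    by (simp add: hdist)
  show ?thesis
  proof unfold_locales
    show "\<xi> = \<zero>\<^bsub>completion\<^esub>" if "\<xi> \<in> carrier completion" "ip completion \<xi> \<xi> = 0" for \<xi>
      using definite[OF that(1)] that(2) by (simp add: C.sn_def)
  qed (rule complete C.s_add_left C.s_smult_left C.s_cnj C.s_nonneg; assumption)+
qed

sublocale C: hilbert_space completion
  by (rule hilbert_completion)

lemma emb_closed [simp]: "v \<in> carrier V \<Longrightarrow> emb v \<in> carrier completion"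
  using represents_emb[of v] unfolding completion_simps(1) by blast

lemma represents_closed: "represents a \<xi> \<Longrightarrow> \<xi> \<in> carrier completion"
  unfolding completion_simps(1) by blast

lemma obtain_represents:
  assumes "\<xi> \<in> carrier completion"
  obtains a where "represents a \<xi>"
  using assms unfolding completion_simps(1) by blast

lemmas ip_tendsto = cip_tendsto [folded completion_simps(5)]

lemma ip_emb: "\<xi> \<in> carrier completion \<Longrightarrow> v \<in> carrier V \<Longrightarrow> ip completion \<xi> (emb v) = dec \<xi> v"
  by (metis obtain_represents dec_eq_cip completion_simps(5))

lemma dec_emb: "\<lbrakk>v \<in> carrier V; w \<in> carrier V\<rbrakk> \<Longrightarrow> dec (emb v) w = s v w"
  by (simp add: emb_def)

lemma hnorm_tendsto:
  assumes a: "represents a \<xi>"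
  shows "(\<lambda>n. sn (a n)) \<longlonglongrightarrow> hnorm completion \<xi>"
  unfolding sn_def hnorm_def by (intro tendsto_real_sqrt tendsto_Re ip_tendsto a)

lemma emb_dense:
  assumes xi: "\<xi> \<in> carrier completion" and orth: "\<And>v. v \<in> carrier V \<Longrightarrow> dec \<xi> v = 0"
  shows "\<xi> = \<zero>\<^bsub>completion\<^esub>"
proof (rule completion_eqI[OF xi])
  show "\<zero>\<^bsub>completion\<^esub> \<in> carrier completion"
    by (rule represents_closed[OF represents_zero])
qed (simp add: orth completion_simps(2))

end

section \<open>Representations\<close>

context hilbert_space
begin

definition cl :: "'h set \<Rightarrow> 'h set" where
  "cl M = {m \<in> carrier H. \<forall>e>0. \<exists>y\<in>M. hnorm H (m \<ominus> y) < e}"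

definition subspace :: "'h set \<Rightarrow> bool" where
  "subspace M \<longleftrightarrow> M \<subseteq> carrier H \<and> \<zero> \<in> M \<and> (\<forall>x\<in>M. \<forall>y\<in>M. x \<oplus> y \<in> M) \<and> (\<forall>c. \<forall>x\<in>M. c \<odot> x \<in> M)"

lemma cl_superset: "M \<subseteq> carrier H \<Longrightarrow> M \<subseteq> cl M"
  unfolding cl_def by (auto intro!: bexI)

lemma cl_approx:
  assumes R: "\<And>m m'. \<lbrakk>m \<in> carrier H; m' \<in> carrier H\<rbrakk> \<Longrightarrow> cmod (F m - F m') \<le> K * hnorm H (m \<ominus> m')"
    and F: "\<And>y. y \<in> M \<Longrightarrow> F y = 0" and M: "M \<subseteq> carrier H" and m: "m \<in> cl M"
  shows "F m = (0 :: complex)"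
proof -
  have "cmod (F m) \<le> 0"
  proof (rule le_zero_if_small)
    fix e :: real assume "e > 0"
    then obtain y where y: "y \<in> M" "hnorm H (m \<ominus> y) < e"
      using m by (auto simp: cl_def)
    then show "\<exists>d. 0 \<le> d \<and> d < e \<and> cmod (F m) \<le> K * d"
      using R[of m y] F[OF y(1)] m M N_nonneg[of "m \<ominus> y"]
      by (intro exI[of _ "hnorm H (m \<ominus> y)"]) (auto simp: cl_def)
  qed
  then show ?thesis by simp
qed

lemma orthogonal_cl:
  assumes x: "x \<in> carrier H" and M: "M \<subseteq> carrier H" and m: "m \<in> cl M"
    and orth: "\<And>z. z \<in> M \<Longrightarrow> ip H x z = 0"
  shows "ip H x m = 0"
proof (rule cl_approx[OF _ orth M m])
  fix m m' assume "m \<in> carrier H" "m' \<in> carrier H"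
  then show "cmod (ip H x m - ip H x m') \<le> hnorm H x * hnorm H (m \<ominus> m')"
    using x ip_CS[of x "m \<ominus> m'"] by (simp add: s_diff_right)
qed

lemma subspace_cl:
  assumes M: "subspace M"
  shows "subspace (cl M)"
  unfolding subspace_def
proof (intro conjI ballI allI)
  have MH: "M \<subseteq> carrier H"
    using M by (simp add: subspace_def)
  show "cl M \<subseteq> carrier H"
    by (auto simp: cl_def)
  show "\<zero> \<in> cl M"
    using M cl_superset[OF MH] by (auto simp: subspace_def)
  fix x y c assume x: "x \<in> cl M"
  then have xH: "x \<in> carrier H" and xM: "\<And>e. e > 0 \<Longrightarrow> \<exists>y\<in>M. hnorm H (x \<ominus> y) < e"
    by (auto simp: cl_def)
  show "c \<odot> x \<in> cl M"
    unfolding cl_def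
  proof (intro CollectI conjI allI impI)
    fix e :: real assume e: "e > 0"
    obtain z where z: "z \<in> M" "hnorm H (x \<ominus> z) < e / (cmod c + 1)"
      using xM[of "e / (cmod c + 1)"] e by (auto simp: add_nonneg_pos)
    have zH: "z \<in> carrier H"
      using z MH by blast
    have "hnorm H (c \<odot> x \<ominus> c \<odot> z) = cmod c * hnorm H (x \<ominus> z)"
      using xH zH by (simp add: smult_diff_right [symmetric] N_smult)
    also have "\<dots> \<le> cmod c * (e / (cmod c + 1))"
      using z by (intro mult_left_mono) auto
    also have "\<dots> < e"
      using e add_pos_nonneg[of 1 "cmod c"] by (simp add: field_simps)
    finally show "\<exists>y\<in>M. hnorm H (c \<odot> x \<ominus> y) < e"
      using z M by (auto simp: subspace_def)
  qed (use xH in simp)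
  assume y: "y \<in> cl M"
  then have yH: "y \<in> carrier H" and yM: "\<And>e. e > 0 \<Longrightarrow> \<exists>z\<in>M. hnorm H (y \<ominus> z) < e"
    by (auto simp: cl_def)
  show "x \<oplus> y \<in> cl M"
    unfolding cl_def
  proof (intro CollectI conjI allI impI)
    fix e :: real assume e: "e > 0"
    obtain z where z: "z \<in> M" "hnorm H (x \<ominus> z) < e / 2"
      using xM[of "e / 2"] e by auto
    obtain w where w: "w \<in> M" "hnorm H (y \<ominus> w) < e / 2"
      using yM[of "e / 2"] e by auto
    have H: "z \<in> carrier H" "w \<in> carrier H"
      using z w MH by auto
    have "x \<oplus> y \<ominus> (z \<oplus> w) = (x \<ominus> z) \<oplus> (y \<ominus> w)"
      using xH yH H by algebra
    then have "hnorm H (x \<oplus> y \<ominus> (z \<oplus> w)) < e"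
      using N_triangle[of "x \<ominus> z" "y \<ominus> w"] z w xH yH H by simp
    then show "\<exists>z\<in>M. hnorm H (x \<oplus> y \<ominus> z) < e"
      using z w M unfolding subspace_def by blast
  qed (use xH yH in simp)
qed

lemma subspace_diff:
  assumes "subspace M" "x \<in> M" "y \<in> M"
  shows "x \<ominus> y \<in> M"
proof -
  have "x \<oplus> (-1) \<odot> y \<in> M"
    using assms unfolding subspace_def by blast
  then show ?thesis
    using assms by (subst diff_eq_smult) (auto simp: subspace_def)
qed

text \<open>The second and third property characterize \<open>P y\<close> as the unique point of the closure of \<open>M\<close> whose
  difference to \<open>y\<close> is orthogonal to \<open>M\<close>. Linearity of \<open>P\<close> follows from uniqueness, and so does,
  later, that \<open>P\<close> commutes with a representation leaving \<open>M\<close> invariant.\<close>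

lemma exists_projection:
  assumes M: "subspace M"
  obtains P where "P \<in> bounded_maps H H"
    and "\<And>y. y \<in> carrier H \<Longrightarrow> P y \<in> cl M"
    and "\<And>y m. \<lbrakk>y \<in> carrier H; m \<in> cl M; \<And>z. z \<in> M \<Longrightarrow> ip H (y \<ominus> m) z = 0\<rbrakk> \<Longrightarrow> P y = m"
    and "\<And>y z. \<lbrakk>y \<in> carrier H; z \<in> M\<rbrakk> \<Longrightarrow> ip H (y \<ominus> P y) z = 0"
proof -
  have MH: "M \<subseteq> carrier H" and clH: "\<And>m. m \<in> cl M \<Longrightarrow> m \<in> carrier H"
    using M by (auto simp: subspace_def cl_def)
  have "\<exists>m\<in>cl M. \<forall>z\<in>M. ip H (y \<ominus> m) z = 0" if "y \<in> carrier H" for y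
    using orthogonal_projection[of M y] that M unfolding subspace_def cl_def by auto
  then obtain P0 where P0: "\<And>y. y \<in> carrier H \<Longrightarrow> P0 y \<in> cl M"
      "\<And>y z. y \<in> carrier H \<Longrightarrow> z \<in> M \<Longrightarrow> ip H (y \<ominus> P0 y) z = 0"
    by metis
  define P where "P = (\<lambda>y\<in>carrier H. P0 y)"
  have P_cl: "P y \<in> cl M" and P_orth: "\<And>z. z \<in> M \<Longrightarrow> ip H (y \<ominus> P y) z = 0"
    if "y \<in> carrier H" for y
    using P0 that by (auto simp: P_def)
  note PH = P_cl[THEN clH]
  have unique: "P y = m" if y: "y \<in> carrier H" and m: "m \<in> cl M"
    and orth: "\<And>z. z \<in> M \<Longrightarrow> ip H (y \<ominus> m) z = 0" for y m
  proof -
    define d where "d = P y \<ominus> m"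
    have d: "d \<in> cl M"
      unfolding d_def using subspace_diff[OF subspace_cl[OF M] P_cl[OF y] m] .
    have "ip H d z = 0" if z: "z \<in> M" for z
    proof -
      have zH: "z \<in> carrier H" using z MH by blast
      show ?thesis
        using orth[OF z] P_orth[OF y z] y PH[OF y] clH[OF m] zH by (simp add: d_def s_linear)
    qed
    then have "ip H d d = 0"
      using orthogonal_cl[OF clH[OF d] MH d] by blast
    then show ?thesis
      using ip_eq_0[of d] PH[OF y] clH[OF m] by (simp add: d_def diff_0_iff)
  qed
  have "P \<in> bounded_maps H H"
  proof (rule bounded_mapsI)
    fix x y c assume x: "x \<in> carrier H"
    show "P x \<in> carrier H"
      by (rule PH[OF x])
    show "P (c \<odot> x) = c \<odot> P x"
    proof (rule unique)
      show "c \<odot> P x \<in> cl M"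
        using subspace_cl[OF M] P_cl[OF x] by (simp add: subspace_def)
      show "ip H (c \<odot> x \<ominus> c \<odot> P x) z = 0" if "z \<in> M" for z
        using P_orth[OF x that] x PH[OF x] that MH
        by (auto simp: smult_diff_right [symmetric] s_smult_left)
    qed (use x in simp)
    have "ip H (x \<ominus> P x) (P x) = 0"
      using orthogonal_cl[OF _ MH P_cl[OF x] P_orth[OF x]] x PH[OF x] by simp
    then have "ip H (P x) (P x) = ip H x (P x)"
      using x PH[OF x] by (simp add: s_linear)
    then have "(hnorm H (P x))\<^sup>2 = cmod (ip H x (P x))"
      using ip_self[OF PH[OF x]] by (metis norm_of_real abs_of_nonneg zero_le_power2)
    then have "hnorm H (P x) * hnorm H (P x) \<le> hnorm H x * hnorm H (P x)"
      using ip_CS[OF x PH[OF x]] by (simp add: power2_eq_square)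
    then show "hnorm H (P x) \<le> 1 * hnorm H x"
      using N_nonneg[OF PH[OF x]] N_nonneg[OF x] by (cases "hnorm H (P x) = 0") auto
    assume y: "y \<in> carrier H"
    show "P (x \<oplus> y) = P x \<oplus> P y"
    proof (rule unique)
      show "P x \<oplus> P y \<in> cl M"
        using subspace_cl[OF M] P_cl[OF x] P_cl[OF y] by (simp add: subspace_def)
      show "ip H (x \<oplus> y \<ominus> (P x \<oplus> P y)) z = 0" if "z \<in> M" for z
      proof -
        have "z \<in> carrier H"
          using that MH by blast
        then show ?thesis
          using P_orth[OF x that] P_orth[OF y that] x y PH[OF x] PH[OF y]
          by (simp add: s_linear)
      qed
    qed (use x y in simp)
  qed (simp add: P_def)
  then show ?thesis
    using that P_cl unique P_orth by blast
qed

end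

locale cstar_rep = B: cstar_algebra B + H: hilbert_space H
  for B :: "'b cstar" (structure) and H :: "'h hilbert" and \<pi> +
  assumes rep: "\<pi> \<in> star_hom B (bounded_ops H)"
begin

lemma cstar_ops: "cstar_algebra (bounded_ops H)"
  using H.cstar_bounded_ops unital_cstar_algebra.axioms(1) by blast

sublocale hom: cstar_hom B "bounded_ops H" \<pi>
  by (intro cstar_hom.intro cstar_hom_axioms.intro B.cstar_algebra_axioms cstar_ops rep)

declare hom.hom_simps [simp del]

lemma rep_bounded [simp]: "x \<in> carrier B \<Longrightarrow> \<pi> x \<in> bounded_maps H H"
  using star_homD(1)[OF rep] by simp

lemma rep_closed [simp]: "\<lbrakk>x \<in> carrier B; v \<in> carrier H\<rbrakk> \<Longrightarrow> \<pi> x v \<in> carrier H"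
  using H.op_closed rep_bounded by blast

lemma rep_mult:
  "\<lbrakk>x \<in> carrier B; y \<in> carrier B; v \<in> carrier H\<rbrakk> \<Longrightarrow> \<pi> (x \<otimes> y) v = \<pi> x (\<pi> y v)"
  using star_homD(2)[OF rep] by (simp add: compose_eq)

lemma rep_add:
  "\<lbrakk>x \<in> carrier B; y \<in> carrier B; v \<in> carrier H\<rbrakk> \<Longrightarrow> \<pi> (x \<oplus> y) v = \<pi> x v \<oplus>\<^bsub>H\<^esub> \<pi> y v"
  using star_homD(3)[OF rep] by simp

lemma rep_smult:
  "\<lbrakk>x \<in> carrier B; v \<in> carrier H\<rbrakk> \<Longrightarrow> \<pi> (c \<odot> x) v = c \<odot>\<^bsub>H\<^esub> \<pi> x v"
  using star_homD(4)[OF rep] by simp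

lemma rep_zero: "v \<in> carrier H \<Longrightarrow> \<pi> \<zero> v = \<zero>\<^bsub>H\<^esub>"
  using hom.hom_zero by simp

lemma rep_diff:
  "\<lbrakk>x \<in> carrier B; y \<in> carrier B; v \<in> carrier H\<rbrakk> \<Longrightarrow> \<pi> (x \<ominus> y) v = \<pi> x v \<ominus>\<^bsub>H\<^esub> \<pi> y v"
  by (simp add: B.diff_eq_smult H.diff_eq_smult rep_add rep_smult)

lemma rep_star:
  assumes "x \<in> carrier B" "v \<in> carrier H" "w \<in> carrier H"
  shows "ip H (\<pi> x v) w = ip H v (\<pi> (star B x) w)"
  using star_homD(5)[OF rep, of x] H.adjoint_map_ip[OF rep_bounded, of x w v] assms by simp

lemma rep_norm:
  assumes x: "x \<in> carrier B" and v: "v \<in> carrier H"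
  shows "hnorm H (\<pi> x v) \<le> cnorm B x * hnorm H v"
proof -
  have "hnorm H (\<pi> x v) \<le> cnorm (bounded_ops H) (\<pi> x) * hnorm H v"
    using H.op_norm_bound[OF rep_bounded[OF x] v] .
  also have "\<dots> \<le> cnorm B x * hnorm H v"
    using hom.contractive[OF x] H.N_nonneg[OF v] by (intro mult_right_mono) auto
  finally show ?thesis .
qed

lemmas rep_linear = bounded_mapsD(3,4)[OF rep_bounded] H.bounded_maps_diff[OF rep_bounded]

definition nondegenerate :: bool where
  "nondegenerate \<longleftrightarrow> (\<forall>w\<in>carrier H. (\<forall>x\<in>carrier B. \<pi> x w = \<zero>\<^bsub>H\<^esub>) \<longrightarrow> w = \<zero>\<^bsub>H\<^esub>)"

definition orbit :: "'h \<Rightarrow> 'h set" where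
  "orbit v = (\<lambda>x. \<pi> x v) ` carrier B"

lemma subspace_orbit:
  assumes v: "v \<in> carrier H"
  shows "H.subspace (orbit v)"
  unfolding H.subspace_def orbit_def
proof (intro conjI ballI allI)
  show "\<zero>\<^bsub>H\<^esub> \<in> (\<lambda>x. \<pi> x v) ` carrier B"
    using rep_zero[OF v] by (metis B.M.zero_closed imageI)
  fix p q c assume "p \<in> (\<lambda>x. \<pi> x v) ` carrier B"
  then obtain x where x: "x \<in> carrier B" "p = \<pi> x v"
    by blast
  show "c \<odot>\<^bsub>H\<^esub> p \<in> (\<lambda>x. \<pi> x v) ` carrier B"
    using x v rep_smult[OF x(1) v, of c] by (metis B.smult_in imageI)
  assume "q \<in> (\<lambda>x. \<pi> x v) ` carrier B"
  then obtain y where y: "y \<in> carrier B" "q = \<pi> y v"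
    by blast
  show "p \<oplus>\<^bsub>H\<^esub> q \<in> (\<lambda>x. \<pi> x v) ` carrier B"
    using x y v rep_add[OF x(1) y(1) v] by (metis B.M.a_closed imageI)
qed (use v in auto)

text \<open>Let \<open>m\<close> be the projection of \<open>v\<close> onto the closure of the orbit, which is invariant. Its orthogonal
  complement is invariant too, so \<open>\<pi>(x)(v - m)\<close> lies both in the closure of the orbit and in
  the complement. Hence it vanishes for all \<open>x\<close>, and nondegeneracy gives \<open>v = m\<close>.\<close>

lemma vector_in_cl_orbit:
  assumes nondeg: nondegenerate and v: "v \<in> carrier H"
  shows "v \<in> H.cl (orbit v)"
proof -
  have orbH: "orbit v \<subseteq> carrier H"
    using subspace_orbit[OF v] by (simp add: H.subspace_def)
  obtain m where m: "m \<in> H.cl (orbit v)" "m \<in> carrier H"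
      and orth: "\<And>z. z \<in> orbit v \<Longrightarrow> ip H (v \<ominus>\<^bsub>H\<^esub> m) z = 0"
    using H.orthogonal_projection[of "orbit v" v] subspace_orbit[OF v] v
    unfolding H.subspace_def H.cl_def by auto
  define w where "w = v \<ominus>\<^bsub>H\<^esub> m"
  have w: "w \<in> carrier H"
    using v m by (simp add: w_def)
  have "\<pi> x w = \<zero>\<^bsub>H\<^esub>" if x: "x \<in> carrier B" for x
  proof -
    define y where "y = star B x \<otimes> x"
    have y: "y \<in> carrier B"
      using x by (simp add: y_def)
    have 1: "ip H w (\<pi> y v) = 0"
      unfolding w_def by (rule orth) (use y in \<open>simp add: orbit_def\<close>)
    have 2: "ip H w (\<pi> y m) = 0"
    proof (rule H.cl_approx[OF _ _ orbH m(1)])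
      fix p q assume pq: "p \<in> carrier H" "q \<in> carrier H"
      have "cmod (ip H w (\<pi> y p) - ip H w (\<pi> y q)) = cmod (ip H w (\<pi> y (p \<ominus>\<^bsub>H\<^esub> q)))"
        using w y pq by (simp add: rep_linear H.s_linear)
      also have "\<dots> \<le> hnorm H w * hnorm H (\<pi> y (p \<ominus>\<^bsub>H\<^esub> q))"
        using H.ip_CS w y pq by simp
      also have "\<dots> \<le> hnorm H w * (cnorm B y * hnorm H (p \<ominus>\<^bsub>H\<^esub> q))"
        using rep_norm y pq H.N_nonneg[OF w] by (intro mult_left_mono) auto
      finally show "cmod (ip H w (\<pi> y p) - ip H w (\<pi> y q)) \<le> (hnorm H w * cnorm B y) * hnorm H (p \<ominus>\<^bsub>H\<^esub> q)"
        by (simp add: mult.assoc)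
    next
      fix p assume "p \<in> orbit v"
      then obtain z where z: "z \<in> carrier B" "p = \<pi> z v"
        by (auto simp: orbit_def)
      have "\<pi> y p = \<pi> (y \<otimes> z) v"
        using rep_mult y z v by simp
      then have "\<pi> y p \<in> orbit v"
        using y z by (auto simp: orbit_def)
      then show "ip H w (\<pi> y p) = 0"
        unfolding w_def by (rule orth)
    qed
    have "ip H (\<pi> x w) (\<pi> x w) = ip H w (\<pi> y w)"
      using rep_star[of x w "\<pi> x w"] x w by (simp add: rep_mult y_def)
    also have "\<pi> y w = \<pi> y v \<ominus>\<^bsub>H\<^esub> \<pi> y m"
      using y v m by (simp add: w_def rep_linear)
    finally have "ip H (\<pi> x w) (\<pi> x w) = 0"
      using 1 2 w v m y by (simp add: H.s_linear)
    then show ?thesis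
      using H.ip_eq_0 x w by simp
  qed
  then have "w = \<zero>\<^bsub>H\<^esub>"
    using nondeg w unfolding nondegenerate_def by blast
  then have "v = m"
    using v m by (simp add: w_def H.diff_0_iff)
  then show ?thesis
    using m by simp
qed

text \<open>For the norm choose \<open>x\<close> with \<open>\<pi>(x) v\<close> near \<open>v\<close> and then a contraction \<open>u\<close> with \<open>u x\<close> near \<open>x\<close>;
  then \<open>\<pi>(u) v\<close> is near \<open>v\<close>, so the functional is near 1 at \<open>u\<close>.\<close>

theorem vector_state:
  assumes nondeg: nondegenerate and v: "v \<in> carrier H" and v1: "hnorm H v = 1"
  shows "(\<lambda>x\<in>carrier B. ip H (\<pi> x v) v) \<in> states B"
proof -
  let ?f = "\<lambda>x\<in>carrier B. ip H (\<pi> x v) v"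
  have bound: "cmod (?f x) \<le> cnorm B x" if x: "x \<in> carrier B" for x
    using H.ip_CS[of "\<pi> x v" v] rep_norm[OF x v] x v v1 by simp
  have bdd: "bdd_above ((\<lambda>x. cmod (?f x)) ` {x \<in> carrier B. cnorm B x \<le> 1})"
    by (rule bdd_aboveI2[of _ _ 1]) (use bound in force)
  have "(SUP x\<in>{x \<in> carrier B. cnorm B x \<le> 1}. cmod (?f x)) = 1"
  proof (rule antisym)
    show "(SUP x\<in>{x \<in> carrier B. cnorm B x \<le> 1}. cmod (?f x)) \<le> 1"
    proof (rule cSUP_least)
      show "{x \<in> carrier B. cnorm B x \<le> 1} \<noteq> {}"
        by (auto intro!: exI[of _ "\<zero>"])
      show "cmod (?f x) \<le> 1" if "x \<in> {x \<in> carrier B. cnorm B x \<le> 1}" for x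
        using bound[of x] that by auto
    qed
    show "1 \<le> (SUP x\<in>{x \<in> carrier B. cnorm B x \<le> 1}. cmod (?f x))"
    proof (rule field_le_epsilon)
      fix e :: real assume "e > 0"
      then obtain x where x: "x \<in> carrier B" "hnorm H (v \<ominus>\<^bsub>H\<^esub> \<pi> x v) < e / 3"
        using vector_in_cl_orbit[OF nondeg v] unfolding H.cl_def orbit_def
        by (auto dest!: spec[of _ "e / 3"])
      obtain u where u: "u \<in> carrier B" "cnorm B u \<le> 1" "cnorm B (x \<ominus> u \<otimes> x) < e / 3"
        using B.approximate_unit[OF x(1), of "e / 3"] \<open>e > 0\<close> by auto
      have "hnorm H (v \<ominus>\<^bsub>H\<^esub> \<pi> u v) \<le> hnorm H (v \<ominus>\<^bsub>H\<^esub> \<pi> x v) +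
          (hnorm H (\<pi> x v \<ominus>\<^bsub>H\<^esub> \<pi> u (\<pi> x v)) + hnorm H (\<pi> u (\<pi> x v) \<ominus>\<^bsub>H\<^esub> \<pi> u v))"
        using H.N_triangle_diff[of v "\<pi> x v" "\<pi> u v"]
          H.N_triangle_diff[of "\<pi> x v" "\<pi> u (\<pi> x v)" "\<pi> u v"] x(1) u(1) v by simp
      moreover have "hnorm H (\<pi> x v \<ominus>\<^bsub>H\<^esub> \<pi> u (\<pi> x v)) \<le> cnorm B (x \<ominus> u \<otimes> x)"
        using rep_norm[of "x \<ominus> u \<otimes> x" v] x(1) u(1) v v1 by (simp add: rep_diff rep_mult)
      moreover have "hnorm H (\<pi> u (\<pi> x v) \<ominus>\<^bsub>H\<^esub> \<pi> u v) \<le> 1 * hnorm H (v \<ominus>\<^bsub>H\<^esub> \<pi> x v)"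
      proof -
        have "hnorm H (\<pi> u (\<pi> x v) \<ominus>\<^bsub>H\<^esub> \<pi> u v) = hnorm H (\<pi> u (\<pi> x v \<ominus>\<^bsub>H\<^esub> v))"
          using x(1) u(1) v by (simp add: rep_linear)
        also have "\<dots> \<le> cnorm B u * hnorm H (\<pi> x v \<ominus>\<^bsub>H\<^esub> v)"
          using rep_norm x(1) u(1) v by simp
        also have "\<dots> \<le> 1 * hnorm H (\<pi> x v \<ominus>\<^bsub>H\<^esub> v)"
          using u(2) H.N_nonneg x(1) v by (intro mult_right_mono) auto
        finally show ?thesis
          using H.N_diff_commute[of v "\<pi> x v"] x(1) v by simp
      qed
      ultimately have near: "hnorm H (v \<ominus>\<^bsub>H\<^esub> \<pi> u v) < e"
        using x(2) u(3) by linarith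
      have "ip H v v = ip H (v \<ominus>\<^bsub>H\<^esub> \<pi> u v) v + ip H (\<pi> u v) v"
        using v u(1) by (simp add: H.s_linear)
      then have "cmod (ip H v v) \<le> cmod (ip H (v \<ominus>\<^bsub>H\<^esub> \<pi> u v) v) + cmod (ip H (\<pi> u v) v)"
        using norm_triangle_ineq by metis
      moreover have "cmod (ip H (v \<ominus>\<^bsub>H\<^esub> \<pi> u v) v) \<le> hnorm H (v \<ominus>\<^bsub>H\<^esub> \<pi> u v)"
        using H.ip_CS[of "v \<ominus>\<^bsub>H\<^esub> \<pi> u v" v] v u(1) v1 by simp
      moreover have "cmod (ip H v v) = 1"
        using H.ip_self[OF v] v1 by simp
      ultimately have "1 \<le> cmod (?f u) + e"
        using near u(1) by simp
      also have "cmod (?f u) \<le> (SUP x\<in>{x \<in> carrier B. cnorm B x \<le> 1}. cmod (?f x))"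
        using u by (intro cSUP_upper bdd) simp
      finally show "1 \<le> (SUP x\<in>{x \<in> carrier B. cnorm B x \<le> 1}. cmod (?f x)) + e"
        by simp
    qed
  qed
  moreover have "?f (star B x \<otimes> x) \<in> \<real>\<^sub>\<ge>\<^sub>0" if x: "x \<in> carrier B" for x
    using rep_star[of "star B x" "\<pi> x v" v] H.ip_nonneg[of "\<pi> x v"] x v by (simp add: rep_mult)
  ultimately show ?thesis
    unfolding states_def using bdd v by (auto simp: rep_add rep_smult H.s_linear)
qed

end

section \<open>States\<close>

lemma statesD:
  assumes "f \<in> states A"
  shows "f \<in> extensional (carrier A)"
    and "\<lbrakk>x \<in> carrier A; y \<in> carrier A\<rbrakk> \<Longrightarrow> f (x \<oplus>\<^bsub>A\<^esub> y) = f x + f y"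
    and "x \<in> carrier A \<Longrightarrow> f (c \<odot>\<^bsub>A\<^esub> x) = c * f x"
    and "x \<in> carrier A \<Longrightarrow> f (star A x \<otimes>\<^bsub>A\<^esub> x) \<in> \<real>\<^sub>\<ge>\<^sub>0"
  using assms by (auto simp: states_def)

context cstar_algebra
begin

lemma state_bound:
  assumes f: "f \<in> states A" and x: "x \<in> carrier A"
  shows "cmod (f x) \<le> cnorm A x"
proof (cases "x = \<zero>")
  case True
  then show ?thesis
    using statesD(3)[OF f, of "\<zero>" 0] by simp
next
  case False
  then have pos: "cnorm A x > 0"
    using cnorm_nonneg[OF x] cnorm_eq_0[OF x] by simp
  let ?y = "of_real (1 / cnorm A x) \<odot> x"
  have "cmod (f ?y) \<le> (SUP x\<in>{x \<in> carrier A. cnorm A x \<le> 1}. cmod (f x))"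
    using f x pos by (intro cSUP_upper) (auto simp: states_def cnorm_smult norm_divide)
  then have "cmod (f ?y) \<le> 1"
    using f by (simp add: states_def)
  then show ?thesis
    using x pos by (simp add: statesD(3)[OF f] norm_mult norm_divide)
qed

text \<open>A scalar of modulus 1 rotates the value of the functional to the positive axis.\<close>

lemma state_norm_attained:
  assumes f: "f \<in> states A" and e: "e > 0"
  shows "\<exists>x\<in>carrier A. cnorm A x \<le> 1 \<and> f x \<in> \<real>\<^sub>\<ge>\<^sub>0 \<and> cmod (f x) > 1 - e"
proof -
  have "\<exists>x\<in>{x \<in> carrier A. cnorm A x \<le> 1}. 1 - e < cmod (f x)"
  proof (rule less_cSUP_iff[THEN iffD1])
    show "{x \<in> carrier A. cnorm A x \<le> 1} \<noteq> {}"
      by (auto intro!: exI[of _ "\<zero>"])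
  qed (use f e in \<open>auto simp: states_def\<close>)
  then obtain x where x: "x \<in> carrier A" "cnorm A x \<le> 1" "1 - e < cmod (f x)"
    by blast
  \<comment> \<open>If \<open>f x = 0\<close>, any scalar of modulus 1 will do.\<close>
  define c where "c = (if f x = 0 then 1 else cnj (f x) / of_real (cmod (f x)))"
  have c: "cmod c = 1" "c * f x = of_real (cmod (f x))"
  proof -
    show "cmod c = 1"
      by (simp add: c_def norm_divide)
    show "c * f x = of_real (cmod (f x))"
      using complex_norm_square[of "f x"] by (auto simp: c_def power2_eq_square mult.commute nonzero_divide_eq_eq)
  qed
  have "cnorm A (c \<odot> x) \<le> 1" "f (c \<odot> x) = of_real (cmod (f x))"
    using x c by (simp_all add: cnorm_smult statesD(3)[OF f])
  then show ?thesis
    using x by (intro bexI[of _ "c \<odot> x"]) auto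
qed

end

section \<open>Words in the copies\<close>

context cstar_algebra
begin

lemma cstar_subalgebraI:
  assumes S: "S \<subseteq> carrier A" and "\<zero> \<in> S"
    and "\<And>x y. \<lbrakk>x \<in> S; y \<in> S\<rbrakk> \<Longrightarrow> x \<oplus> y \<in> S" and smult: "\<And>c x. x \<in> S \<Longrightarrow> c \<odot> x \<in> S"
    and "\<And>x y. \<lbrakk>x \<in> S; y \<in> S\<rbrakk> \<Longrightarrow> x \<otimes> y \<in> S" and "\<And>x. x \<in> S \<Longrightarrow> star A x \<in> S"
    and limit: "\<And>x. \<lbrakk>x \<in> carrier A; \<And>e. e > 0 \<Longrightarrow> \<exists>y\<in>S. cnorm A (x \<ominus> y) < e\<rbrakk> \<Longrightarrow> x \<in> S"
  shows "cstar_subalgebra S A"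
  unfolding cstar_subalgebra_def cstar_dist_eq closedin_iff
proof (intro conjI ballI impI submoduleI)
  show "\<ominus> x \<in> S" if "x \<in> S" for x
    using smult[OF that, of "-1"] S that by (subst minus_eq_smult) auto
qed (use assms in auto)

end

lemma word_mult_single [simp]: "word_mult B i [(j, a)] = i j a"
  by (simp add: word_mult_def)

lemma word_mult_Cons:
  "w \<noteq> [] \<Longrightarrow> word_mult B i ((j, a) # w) = i j a \<otimes>\<^bsub>B\<^esub> word_mult B i w"
  by (cases w) (simp_all add: word_mult_def)

lemma words_Cons: "((j, a) # w \<in> words J A) = (j \<in> J \<and> a \<in> carrier A \<and> (w = [] \<or> w \<in> words J A))"
  by (auto simp: words_def)

lemma words_induct [consumes 1, case_names single Cons]:
  assumes "w \<in> words J A"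
    and "\<And>j a. \<lbrakk>j \<in> J; a \<in> carrier A\<rbrakk> \<Longrightarrow> P [(j, a)]"
    and "\<And>j a w. \<lbrakk>j \<in> J; a \<in> carrier A; w \<in> words J A; w \<noteq> []; P w\<rbrakk> \<Longrightarrow> P ((j, a) # w)"
  shows "P w"
  using assms(1)
proof (induction w)
  case Nil
  then show ?case
    by (simp add: words_def)
next
  case (Cons x w)
  obtain j a where x: "x = (j, a)"
    by (cases x)
  show ?case
  proof (cases "w = []")
    case True
    then show ?thesis
      using Cons.prems assms(2) by (simp add: x words_Cons)
  next
    case False
    then show ?thesis
      using Cons assms(3) by (simp add: x words_Cons)
  qed
qed

text \<open>The part of the definition of a free product that remains when the universal property is left out.\<close>

locale generated_copies = A: cstar_algebra A + B: cstar_algebra B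
  for A :: "'a cstar" and B :: "'b cstar" (structure) +
  fixes J :: "'j set" and i :: "'j \<Rightarrow> 'a \<Rightarrow> 'b"
  assumes copy_hom: "j \<in> J \<Longrightarrow> i j \<in> star_hom A B"
    and generated: "\<And>S. \<lbrakk>cstar_subalgebra S B; (\<Union>j\<in>J. i j ` carrier A) \<subseteq> S\<rbrakk> \<Longrightarrow> S = carrier B"
begin

lemma copy_closed [simp]: "\<lbrakk>j \<in> J; a \<in> carrier A\<rbrakk> \<Longrightarrow> i j a \<in> carrier B"
  using star_homD(1)[OF copy_hom] by blast

lemma word_closed [simp]: "w \<in> words J A \<Longrightarrow> word_mult B i w \<in> carrier B"
  by (induction rule: words_induct) (simp_all add: word_mult_Cons)

lemma words_append: "\<lbrakk>v \<in> words J A; w \<in> words J A\<rbrakk> \<Longrightarrow> v @ w \<in> words J A"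
  by (auto simp: words_def)

lemma word_mult_append:
  "\<lbrakk>v \<in> words J A; w \<in> words J A\<rbrakk> \<Longrightarrow>
    word_mult B i (v @ w) = word_mult B i v \<otimes> word_mult B i w"
proof (induction v rule: words_induct)
  case (single j a)
  then show ?case
    by (subst append_Cons, subst word_mult_Cons) (auto simp: words_def)
next
  case (Cons j a v)
  then show ?case
    by (simp add: word_mult_Cons B.mult_assoc)
qed

lemma star_word:
  "w \<in> words J A \<Longrightarrow> \<exists>v\<in>words J A. star B (word_mult B i w) = word_mult B i v"
proof (induction rule: words_induct)
  case (single j a)
  then show ?case
    using star_homD(5)[OF copy_hom, of j a]
    by (intro bexI[of _ "[(j, star A a)]"]) (auto simp: words_def)
next
  case (Cons j a w)
  then obtain v where v: "v \<in> words J A" "star B (word_mult B i w) = word_mult B i v"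
    by blast
  have s: "[(j, star A a)] \<in> words J A"
    using Cons by (auto simp: words_def)
  have "star B (word_mult B i ((j, a) # w)) = word_mult B i (v @ [(j, star A a)])"
    using Cons v star_homD(5)[OF copy_hom, of j a]
    by (simp add: word_mult_append[OF v(1) s] word_mult_Cons B.star_mult)
  then show ?case
    using words_append[OF v(1) s] by blast
qed

text \<open>The closed linear span of the words, as an inductive set so that its elements can be handled by
  induction. The element 0 is included separately because there are no words if \<open>J\<close> is empty.\<close>

inductive_set word_closure :: "'b set" where
  word: "w \<in> words J A \<Longrightarrow> word_mult B i w \<in> word_closure"
| zero: "\<zero> \<in> word_closure"
| add: "\<lbrakk>x \<in> word_closure; y \<in> word_closure\<rbrakk> \<Longrightarrow> x \<oplus> y \<in> word_closure"
| smult: "x \<in> word_closure \<Longrightarrow> c \<odot> x \<in> word_closure"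
| limit: "\<lbrakk>x \<in> carrier B; \<forall>e>0. \<exists>y. y \<in> word_closure \<and> cnorm B (x \<ominus> y) < e\<rbrakk>
    \<Longrightarrow> x \<in> word_closure"

lemma word_closure_closed: "x \<in> word_closure \<Longrightarrow> x \<in> carrier B"
  by (induction rule: word_closure.induct) simp_all

text \<open>The limit case of the three inductions below, for the Lipschitz maps \<open>x \<mapsto> x w\<close>, \<open>y \<mapsto> x y\<close> and
  \<open>x \<mapsto> x\<^sup>*\<close>.\<close>

lemma word_closure_limit_map:
  assumes x: "x \<in> carrier B" and near: "\<forall>e>0. \<exists>y. (y \<in> word_closure \<and> f y \<in> word_closure) \<and> cnorm B (x \<ominus> y) < e"
    and f: "\<And>x. x \<in> carrier B \<Longrightarrow> f x \<in> carrier B" and K: "0 \<le> K"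
    and lip: "\<And>x y. \<lbrakk>x \<in> carrier B; y \<in> carrier B\<rbrakk> \<Longrightarrow>
      cnorm B (f x \<ominus> f y) \<le> K * cnorm B (x \<ominus> y)"
  shows "f x \<in> word_closure"
proof (rule word_closure.limit)
  show "\<forall>e>0. \<exists>z. z \<in> word_closure \<and> cnorm B (f x \<ominus> z) < e"
  proof (intro allI impI)
    fix e :: real assume "e > 0"
    then obtain y where y: "y \<in> word_closure" "f y \<in> word_closure" "cnorm B (x \<ominus> y) < e / (K + 1)"
      using near K by (metis add_nonneg_pos divide_pos_pos zero_less_one)
    have "cnorm B (f x \<ominus> f y) \<le> K * (e / (K + 1))"
      using lip[OF x word_closure_closed[OF y(1)]] mult_left_mono[OF less_imp_le[OF y(3)] K] by linarith
    also have "\<dots> < e"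
      using K \<open>e > 0\<close> by (simp add: field_simps)
    finally show "\<exists>z. z \<in> word_closure \<and> cnorm B (f x \<ominus> z) < e"
      using y by blast
  qed
qed (rule f[OF x])

lemma word_closure_mult_word:
  assumes w: "w \<in> words J A"
  shows "x \<in> word_closure \<Longrightarrow> x \<otimes> word_mult B i w \<in> word_closure"
proof (induction rule: word_closure.induct)
  case (word v)
  then show ?case
    using word_mult_append[OF word w] words_append[OF word w] word_closure.word by metis
next
  case zero
  then show ?case
    using w word_closure.zero by simp
next
  case (add x y)
  then show ?case
    using w word_closure_closed word_closure.add by (simp add: B.mult_add_left)
next
  case (smult x c)
  then show ?case
    using w word_closure_closed word_closure.smult by (simp add: B.mult_smult_left)
next
  case (limit x)
  show ?case
  proof (rule word_closure_limit_map[OF limit(1)])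
    show "\<forall>e>0. \<exists>y. (y \<in> word_closure \<and> y \<otimes> word_mult B i w \<in> word_closure) \<and> cnorm B (x \<ominus> y) < e"
      using limit(2) by blast
    show "cnorm B (x \<otimes> word_mult B i w \<ominus> y \<otimes> word_mult B i w)
        \<le> cnorm B (word_mult B i w) * cnorm B (x \<ominus> y)" if "x \<in> carrier B" "y \<in> carrier B" for x y
      using B.cnorm_mult[of "x \<ominus> y" "word_mult B i w"] that w
      by (simp add: B.diff_mult mult.commute)
  qed (use w in \<open>auto simp: B.cnorm_nonneg\<close>)
qed

text \<open>The right factor runs through words first, where \<open>word_closure_mult_word\<close> applies, and then
  through their closed span.\<close>

lemma word_closure_mult:
  assumes x: "x \<in> word_closure"
  shows "y \<in> word_closure \<Longrightarrow> x \<otimes> y \<in> word_closure"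
proof (induction rule: word_closure.induct)
  case (word w)
  then show ?case
    by (rule word_closure_mult_word[OF _ x])
next
  case zero
  then show ?case
    using x word_closure_closed word_closure.zero by simp
next
  case (add y z)
  then show ?case
    using x word_closure_closed word_closure.add by (simp add: B.mult_add_right)
next
  case (smult y c)
  then show ?case
    using x word_closure_closed word_closure.smult by (simp add: B.mult_smult_right)
next
  case (limit y)
  note xB = word_closure_closed[OF x]
  show ?case
  proof (rule word_closure_limit_map[OF limit(1)])
    show "\<forall>e>0. \<exists>z. (z \<in> word_closure \<and> x \<otimes> z \<in> word_closure) \<and> cnorm B (y \<ominus> z) < e"
      using limit(2) by blast
    show "cnorm B (x \<otimes> y \<ominus> x \<otimes> z) \<le> cnorm B x * cnorm B (y \<ominus> z)"
      if "y \<in> carrier B" "z \<in> carrier B" for y z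
      using B.cnorm_mult[of x "y \<ominus> z"] that xB by (simp add: B.mult_diff)
  qed (use xB in \<open>auto simp: B.cnorm_nonneg\<close>)
qed

lemma word_closure_star: "x \<in> word_closure \<Longrightarrow> star B x \<in> word_closure"
proof (induction rule: word_closure.induct)
  case (word w)
  then show ?case
    using star_word word_closure.word by metis
next
  case zero
  then show ?case
    using word_closure.zero by simp
next
  case (add x y)
  then show ?case
    using word_closure_closed word_closure.add by (simp add: B.star_add)
next
  case (smult x c)
  then show ?case
    using word_closure_closed word_closure.smult by (simp add: B.star_smult)
next
  case (limit x)
  show ?case
  proof (rule word_closure_limit_map[OF limit(1)])
    show "\<forall>e>0. \<exists>y. (y \<in> word_closure \<and> star B y \<in> word_closure) \<and> cnorm B (x \<ominus> y) < e"
      using limit(2) by blast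
    show "cnorm B (star B x \<ominus> star B y) \<le> 1 * cnorm B (x \<ominus> y)"
      if "x \<in> carrier B" "y \<in> carrier B" for x y
      using that by (simp add: B.cnorm_star_diff)
  qed auto
qed

lemma word_closure_eq: "word_closure = carrier B"
proof (rule generated)
  show "cstar_subalgebra word_closure B"
  proof (rule B.cstar_subalgebraI)
    show "x \<in> word_closure"
      if "x \<in> carrier B" "\<And>e. e > 0 \<Longrightarrow> \<exists>y\<in>word_closure. cnorm B (x \<ominus> y) < e" for x
      using that by (intro word_closure.limit) blast+
  qed (auto intro: word_closure_closed word_closure.zero word_closure.add word_closure.smult
      word_closure_mult word_closure_star)
  show "(\<Union>j\<in>J. i j ` carrier A) \<subseteq> word_closure"
    using word_closure.word[of "[(_, _)]"] by (fastforce simp: words_def)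
qed

lemma word_induct [consumes 1, case_names word zero add smult limit]:
  assumes "x \<in> carrier B"
    and "\<And>w. w \<in> words J A \<Longrightarrow> P (word_mult B i w)"
    and "P \<zero>"
    and "\<And>x y. \<lbrakk>x \<in> carrier B; y \<in> carrier B; P x; P y\<rbrakk> \<Longrightarrow> P (x \<oplus> y)"
    and "\<And>c x. \<lbrakk>x \<in> carrier B; P x\<rbrakk> \<Longrightarrow> P (c \<odot> x)"
    and "\<And>x. \<lbrakk>x \<in> carrier B; \<And>e. e > 0 \<Longrightarrow> \<exists>y\<in>carrier B. P y \<and> cnorm B (x \<ominus> y) < e\<rbrakk> \<Longrightarrow> P x"
  shows "P x"
proof -
  have "x \<in> word_closure"
    using assms(1) by (simp add: word_closure_eq)
  then show ?thesis
  proof (induction rule: word_closure.induct)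
    case (limit x)
    then show ?case
      using word_closure_closed by (intro assms(6)) blast+
  qed (use assms word_closure_closed in auto)
qed

text \<open>The form in which the density of words is used throughout: for uniqueness of the state, symmetry,
  factorization, and for extending properties of the copies to all of \<open>B\<close> through matrix
  coefficients.\<close>

lemma functional_eq_if_eq_on_words:
  assumes f: "\<And>x y. \<lbrakk>x \<in> carrier B; y \<in> carrier B\<rbrakk> \<Longrightarrow> f (x \<oplus> y) = f x + f y"
      "\<And>c x. x \<in> carrier B \<Longrightarrow> f (c \<odot> x) = c * f x"
      "\<And>x. x \<in> carrier B \<Longrightarrow> cmod (f x) \<le> K * cnorm B x"
    and f': "\<And>x y. \<lbrakk>x \<in> carrier B; y \<in> carrier B\<rbrakk> \<Longrightarrow> f' (x \<oplus> y) = f' x + f' y"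
      "\<And>c x. x \<in> carrier B \<Longrightarrow> f' (c \<odot> x) = c * f' x"
      "\<And>x. x \<in> carrier B \<Longrightarrow> cmod (f' x) \<le> K * cnorm B x"
    and eq: "\<And>w. w \<in> words J A \<Longrightarrow> f (word_mult B i w) = f' (word_mult B i w)"
    and x: "x \<in> carrier B"
  shows "f x = f' x"
  using x
proof (induction rule: word_induct)
  case zero
  then show ?case
    using f(2)[of "\<zero>" 0] f'(2)[of "\<zero>" 0] by simp
next
  case (limit x)
  have "cmod (f x - f' x) \<le> 0"
  proof (rule le_zero_if_small)
    fix e :: real assume "e > 0"
    then obtain y where y: "y \<in> carrier B" "f y = f' y" "cnorm B (x \<ominus> y) < e"
      using limit(2) by blast
    have "f x - f' x = f (x \<ominus> y) - f' (x \<ominus> y)"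
      using y limit(1) by (simp add: B.diff_eq_smult f f')
    then have "cmod (f x - f' x) \<le> (2 * K) * cnorm B (x \<ominus> y)"
      using f(3)[of "x \<ominus> y"] f'(3)[of "x \<ominus> y"] y(1) limit(1)
        norm_triangle_ineq4[of "f (x \<ominus> y)" "f' (x \<ominus> y)"] by simp
    then show "\<exists>d. 0 \<le> d \<and> d < e \<and> cmod (f x - f' x) \<le> (2 * K) * d"
      using y B.cnorm_nonneg[of "x \<ominus> y"] limit(1)
      by (intro exI[of _ "cnorm B (x \<ominus> y)"]) simp
  qed
  then show ?case by simp
qed (simp_all add: eq f f')

lemma state_eq_if_eq_on_words:
  assumes f: "f \<in> states B" and f': "f' \<in> states B"
    and eq: "\<And>w. w \<in> words J A \<Longrightarrow> f (word_mult B i w) = f' (word_mult B i w)"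
  shows "f = f'"
proof (rule extensionalityI[OF statesD(1)[OF f] statesD(1)[OF f']])
  show "f x = f' x" if "x \<in> carrier B" for x
  proof (rule functional_eq_if_eq_on_words[where K = 1, OF statesD(2,3)[OF f] _ statesD(2,3)[OF f'] _ eq that])
    show "cmod (f x) \<le> 1 * cnorm B x" "cmod (f' x) \<le> 1 * cnorm B x" if "x \<in> carrier B" for x
      using B.state_bound[OF f that] B.state_bound[OF f' that] by simp_all
  qed
qed

end

section \<open>Unitaries between Hilbert spaces with dense families of equal Gram matrix\<close>

context hilbert_pair
begin

text \<open>Approximate \<open>x\<close> by \<open>u (b\<^sub>n)\<close>. The vectors \<open>v (b\<^sub>n)\<close> have the same mutual distances, so they
  converge as well.\<close>

lemma transport_limits:
  assumes u: "\<And>b. b \<in> I \<Longrightarrow> u b \<in> carrier H" and v: "\<And>b. b \<in> I \<Longrightarrow> v b \<in> carrier K"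
    and gram: "\<And>a b. \<lbrakk>a \<in> I; b \<in> I\<rbrakk> \<Longrightarrow> ip K (v a) (v b) = ip H (u a) (u b)"
    and dense: "carrier H \<subseteq> H.cl (u ` I)" and x: "x \<in> carrier H"
  shows "\<exists>y\<in>carrier K. \<exists>b. (\<forall>n. b n \<in> I) \<and> (\<lambda>n. hnorm H (u (b n) \<ominus>\<^bsub>H\<^esub> x)) \<longlonglongrightarrow> 0 \<and>
    (\<lambda>n. hnorm K (v (b n) \<ominus>\<^bsub>K\<^esub> y)) \<longlonglongrightarrow> 0"
proof -
  define r where "r n = 1 / real (Suc n)" for n
  have r: "r \<longlonglongrightarrow> 0"
    unfolding r_def using LIMSEQ_inverse_real_of_nat by (simp add: inverse_eq_divide)
  have "\<exists>b\<in>I. hnorm H (x \<ominus>\<^bsub>H\<^esub> u b) < r n" for n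
    using dense x unfolding H.cl_def r_def by force
  then obtain b where b: "\<And>n. b n \<in> I" and near: "\<And>n. hnorm H (x \<ominus>\<^bsub>H\<^esub> u (b n)) < r n"
    by metis
  note [simp] = u[OF b] v[OF b]
  have isom: "hnorm K (v (b m) \<ominus>\<^bsub>K\<^esub> v (b n)) = hnorm H (u (b m) \<ominus>\<^bsub>H\<^esub> u (b n))" for m n
    unfolding hnorm_def by (simp add: H.s_linear K.s_linear gram b)
  have limu: "(\<lambda>n. hnorm H (u (b n) \<ominus>\<^bsub>H\<^esub> x)) \<longlonglongrightarrow> 0"
  proof (rule Lim_null_comparison[OF always_eventually r], rule allI)
    show "norm (hnorm H (u (b n) \<ominus>\<^bsub>H\<^esub> x)) \<le> r n" for n
      using near[of n] x H.N_diff_commute[of x "u (b n)"] H.N_nonneg[of "u (b n) \<ominus>\<^bsub>H\<^esub> x"] by simp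
  qed
  have "hnorm K (v (b m) \<ominus>\<^bsub>K\<^esub> v (b n)) \<le> r m + r n" for m n
    unfolding isom using near[of m] near[of n] x H.N_diff_commute[of x "u (b m)"]
      H.N_triangle_diff[of "u (b m)" x "u (b n)"] by simp
  then have "\<exists>y\<in>carrier K. (\<lambda>n. hnorm K (v (b n) \<ominus>\<^bsub>K\<^esub> y)) \<longlonglongrightarrow> 0"
    by (intro K.limit_exists[OF K.mcomplete _ r]) simp_all
  then show ?thesis
    using limu b by blast
qed

lemma dense_eqI:
  assumes u: "\<And>b. b \<in> I \<Longrightarrow> u b \<in> carrier H" and dense: "carrier H \<subseteq> H.cl (u ` I)"
    and x: "x \<in> carrier H" "x' \<in> carrier H"
    and eq: "\<And>b. b \<in> I \<Longrightarrow> ip H x (u b) = ip H x' (u b)"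
  shows "x = x'"
proof -
  have "ip H (x \<ominus>\<^bsub>H\<^esub> x') (x \<ominus>\<^bsub>H\<^esub> x') = 0"
  proof (rule H.orthogonal_cl[of _ "u ` I"])
    show "x \<ominus>\<^bsub>H\<^esub> x' \<in> H.cl (u ` I)"
      using dense x by auto
  qed (use u x eq in \<open>auto simp: H.s_linear\<close>)
  then show ?thesis
    using H.ip_eq_0[of "x \<ominus>\<^bsub>H\<^esub> x'"] x by (simp add: H.diff_0_iff)
qed

lemma unitary_mapsI:
  assumes V: "V \<in> bounded_maps H K"
    and ip: "\<And>x y. \<lbrakk>x \<in> carrier H; y \<in> carrier H\<rbrakk> \<Longrightarrow> ip K (V x) (V y) = ip H x y"
    and surj: "\<And>y. y \<in> carrier K \<Longrightarrow> \<exists>x\<in>carrier H. V x = y"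
  shows "V \<in> unitary_maps H K"
proof -
  note VD = bounded_mapsD[OF V]
  have inv: "adjoint_map H K V (V x) = x" if x: "x \<in> carrier H" for x
    using VD(1)[OF x] x ip by (intro adjoint_map_eqI[OF V]) auto
  have "compose (carrier H) (adjoint_map H K V) V = (\<lambda>x\<in>carrier H. x)"
    using inv by (intro ext) (simp add: compose_def)
  moreover have "V (adjoint_map H K V y) = y" if "y \<in> carrier K" for y
    using surj[OF that] inv by auto
  then have "compose (carrier K) V (adjoint_map H K V) = (\<lambda>y\<in>carrier K. y)"
    by (intro ext) (simp add: compose_def)
  ultimately show ?thesis
    using V by (simp add: unitary_maps_def)
qed

lemma unitary_mapsD:
  assumes "V \<in> unitary_maps H K"
  shows "V \<in> bounded_maps H K" "x \<in> carrier H \<Longrightarrow> adjoint_map H K V (V x) = x"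
  using assms by (auto simp: unitary_maps_def compose_def fun_eq_iff restrict_def) metis+

text \<open>The unitary sends \<open>lim u (b\<^sub>n)\<close> to \<open>lim v (b\<^sub>n)\<close>. It preserves inner products because these are
  limits of entries of the common Gram matrix. It is determined by \<open>\<langle>V x, v b\<rangle> = \<langle>x, u b\<rangle>\<close>, which gives
  linearity, and surjectivity comes from exchanging the roles of the two families.\<close>

theorem unitary_of_equal_gram:
  assumes u: "\<And>b. b \<in> I \<Longrightarrow> u b \<in> carrier H" and v: "\<And>b. b \<in> I \<Longrightarrow> v b \<in> carrier K"
    and gram: "\<And>a b. \<lbrakk>a \<in> I; b \<in> I\<rbrakk> \<Longrightarrow> ip K (v a) (v b) = ip H (u a) (u b)"
    and denseH: "carrier H \<subseteq> H.cl (u ` I)" and denseK: "carrier K \<subseteq> K.cl (v ` I)"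
  shows "\<exists>V\<in>unitary_maps H K. \<forall>x\<in>carrier H. \<forall>b\<in>I. ip K (V x) (v b) = ip H x (u b)"
proof -
  interpret KH: hilbert_pair K H ..
  note eqI = KH.dense_eqI[of I v, OF v denseK]
  \<comment> \<open>\<open>b\<close> indexes a sequence along which both families converge, to \<open>x\<close> and to \<open>y\<close>.\<close>
  define lim where "lim x y b \<longleftrightarrow> (\<forall>n. b n \<in> I) \<and> (\<lambda>n. hnorm H (u (b n) \<ominus>\<^bsub>H\<^esub> x)) \<longlonglongrightarrow> 0 \<and>
    (\<lambda>n. hnorm K (v (b n) \<ominus>\<^bsub>K\<^esub> y)) \<longlonglongrightarrow> 0" for x y b
  have match: "ip K y y' = ip H x x'" if l: "lim x y b" "lim x' y' b'"
    and c: "x \<in> carrier H" "y \<in> carrier K" "x' \<in> carrier H" "y' \<in> carrier K" for x y b x' y' b'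
  proof -
    have bI: "\<And>n. b n \<in> I" "\<And>n. b' n \<in> I"
      using l by (auto simp: lim_def)
    have "(\<lambda>n. ip H (u (b n)) (u (b' n))) \<longlonglongrightarrow> ip H x x'"
      by (intro H.tendsto_ip) (use l c u bI in \<open>auto simp: lim_def\<close>)
    moreover have "(\<lambda>n. ip K (v (b n)) (v (b' n))) \<longlonglongrightarrow> ip K y y'"
      by (intro K.tendsto_ip) (use l c v bI in \<open>auto simp: lim_def\<close>)
    ultimately show ?thesis
      using LIMSEQ_unique gram bI by simp
  qed
  have lim_const: "lim (u b) (v b) (\<lambda>n. b)" if "b \<in> I" for b
    using that u v by (simp add: lim_def)
  have "\<exists>y\<in>carrier K. \<exists>b. lim x y b" if "x \<in> carrier H" for x
    using transport_limits[of I u v, OF u v gram denseH that] by (simp add: lim_def)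
  then obtain V0 b0 where V0: "\<And>x. x \<in> carrier H \<Longrightarrow> V0 x \<in> carrier K"
      and b0: "\<And>x. x \<in> carrier H \<Longrightarrow> lim x (V0 x) (b0 x)"
    by metis
  define V where "V = (\<lambda>x\<in>carrier H. V0 x)"
  have VK: "V x \<in> carrier K" and Vlim: "lim x (V x) (b0 x)" if "x \<in> carrier H" for x
    using V0 b0 that by (auto simp: V_def)
  have Vip: "ip K (V x) (V y) = ip H x y" if "x \<in> carrier H" "y \<in> carrier H" for x y
    using match[OF Vlim[OF that(1)] Vlim[OF that(2)]] that VK by blast
  have Vu: "ip K (V x) (v b) = ip H x (u b)" if "x \<in> carrier H" "b \<in> I" for x b
    using match[OF Vlim[OF that(1)] lim_const[OF that(2)]] that VK u v by blast
  have "V \<in> unitary_maps H K"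
  proof (rule unitary_mapsI)
    show "V \<in> bounded_maps H K"
    proof (rule bounded_mapsI)
      fix x y c assume x: "x \<in> carrier H"
      show "V x \<in> carrier K"
        by (rule VK[OF x])
      show "V (c \<odot>\<^bsub>H\<^esub> x) = c \<odot>\<^bsub>K\<^esub> V x"
        using x VK u v Vu by (intro eqI) (auto simp: H.s_linear K.s_linear)
      show "hnorm K (V x) \<le> 1 * hnorm H x"
        using Vip[OF x x] by (simp add: hnorm_def)
      assume y: "y \<in> carrier H"
      show "V (x \<oplus>\<^bsub>H\<^esub> y) = V x \<oplus>\<^bsub>K\<^esub> V y"
        using x y VK u v Vu by (intro eqI) (auto simp: H.s_linear K.s_linear)
    qed (simp add: V_def)
    fix y assume y: "y \<in> carrier K"
    obtain x b where x: "x \<in> carrier H" "lim x y b"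
      using KH.transport_limits[of I v u, OF v u gram [symmetric] denseK y]
      by (auto simp: lim_def)
    have "V x = y"
    proof (rule eqI)
      show "ip K (V x) (v b) = ip K y (v b)" if "b \<in> I" for b
        using Vu[OF x(1) that] match[OF x(2) lim_const[OF that]] x y u v that by simp
    qed (use x y VK in auto)
    then show "\<exists>x\<in>carrier H. V x = y"
      using x by blast
  qed (rule Vip)
  then show ?thesis
    using Vu by blast
qed

end

section \<open>Processes\<close>

lemma processesD:
  assumes "p \<in> processes J A"
  shows "hilbert_space (hspace p)" "j \<in> J \<Longrightarrow> rep p j \<in> star_hom A (bounded_ops (hspace p))"
    "vac p \<in> carrier (hspace p)" "hnorm (hspace p) (vac p) = 1"
    "hilbert_topology (hspace p) closure_of {T (vac p) | T. T \<in> process_vN J A p} = carrier (hspace p)"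
    "\<lbrakk>x \<in> carrier (hspace p); \<And>j a. \<lbrakk>j \<in> J; a \<in> carrier A\<rbrakk> \<Longrightarrow> rep p j a x = \<zero>\<^bsub>hspace p\<^esub>\<rbrakk>
      \<Longrightarrow> x = \<zero>\<^bsub>hspace p\<^esub>"
  using assms unfolding processes_def by auto

text \<open>The unitary intertwines the representations of the copies, hence those of all words.\<close>

lemma unitarily_equivalent_moments:
  assumes p: "p \<in> processes J A" and q: "q \<in> processes J A"
    and eq: "unitarily_equivalent J A p q" and w: "w \<in> words J A"
  shows "moment p w = moment q w"
proof -
  interpret hilbert_pair "hspace p" "hspace q"
    by (intro hilbert_pair.intro processesD(1)[OF p] processesD(1)[OF q])
  let ?H = "hspace p" and ?K = "hspace q"
  obtain V where V: "V \<in> unitary_maps ?H ?K" and vac: "V (vac p) = vac q"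
      and intertwine: "\<And>j a y. \<lbrakk>j \<in> J; a \<in> carrier A; y \<in> carrier ?K\<rbrakk> \<Longrightarrow>
        V (rep p j a (adjoint_map ?H ?K V y)) = rep q j a y"
    using eq by (auto simp: unitarily_equivalent_def)
  note VB = unitary_mapsD(1)[OF V] and inv = unitary_mapsD(2)[OF V]
  have rep_closed: "rep p j a x \<in> carrier ?H" "rep q j a y \<in> carrier ?K"
    if "j \<in> J" "a \<in> carrier A" "x \<in> carrier ?H" "y \<in> carrier ?K" for j a x y
    using star_homD(1)[OF processesD(2)[OF p that(1)] that(2)]
      star_homD(1)[OF processesD(2)[OF q that(1)] that(2)] H.op_closed K.op_closed that by auto
  have step: "rep q j a (V x) = V (rep p j a x)" if "j \<in> J" "a \<in> carrier A" "x \<in> carrier ?H" for j a x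
    using intertwine[OF that(1,2), of "V x"] inv[OF that(3)] bounded_mapsD(1)[OF VB that(3)] by simp
  have word: "word_mult (bounded_ops ?H) (rep p) w x \<in> carrier ?H \<and>
      word_mult (bounded_ops ?K) (rep q) w (V x) = V (word_mult (bounded_ops ?H) (rep p) w x)"
    if x: "x \<in> carrier ?H" for x
    using w
  proof (induction rule: words_induct)
    case (single j a)
    then show ?case
      using x step rep_closed(1) bounded_mapsD(1)[OF VB x] by simp
  next
    case (Cons j a w)
    then show ?case
      using x step rep_closed(1) bounded_mapsD(1)[OF VB x] by (simp add: word_mult_Cons compose_eq)
  qed
  have O: "vac p \<in> carrier ?H"
    by (rule processesD(3)[OF p])
  let ?y = "word_mult (bounded_ops ?H) (rep p) w (vac p)"
  have "moment q w = ip ?K (V ?y) (V (vac p))"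
    using word[OF O] by (simp add: moment_def vac)
  also have "\<dots> = ip ?H ?y (adjoint_map ?H ?K V (V (vac p)))"
    using adjoint_map_ip[OF VB bounded_mapsD(1)[OF VB O]] word[OF O] by simp
  also have "\<dots> = moment p w"
    using inv[OF O] by (simp add: moment_def)
  finally show ?thesis ..
qed

text \<open>A process together with the representation of \<open>B\<close> that the universal property attaches to it.\<close>

locale process_rep = generated_copies A B J i
  for A :: "'a cstar" and B :: "'b cstar" (structure) and J :: "'j set" and i :: "'j \<Rightarrow> 'a \<Rightarrow> 'b" +
  fixes p :: "('j, 'a, 'h) process" and \<Psi> :: "'b \<Rightarrow> 'h \<Rightarrow> 'h"
  assumes process: "p \<in> processes J A"
    and lift_hom: "\<Psi> \<in> star_hom B (bounded_ops (hspace p))"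
    and lift: "\<lbrakk>j \<in> J; a \<in> carrier A\<rbrakk> \<Longrightarrow> \<Psi> (i j a) = rep p j a"
begin

abbreviation "H \<equiv> hspace p"
abbreviation "\<Omega> \<equiv> vac p"

sublocale R: cstar_rep B H \<Psi>
  by (intro cstar_rep.intro cstar_rep_axioms.intro B.cstar_algebra_axioms processesD(1)[OF process] lift_hom)

lemmas vac_closed [simp] = processesD(3)[OF process]

lemma lift_word: "w \<in> words J A \<Longrightarrow> \<Psi> (word_mult B i w) = word_mult (bounded_ops H) (rep p) w"
proof (induction rule: words_induct)
  case (Cons j a w)
  then show ?case
    using star_homD(2)[OF lift_hom, of "i j a" "word_mult B i w"] by (simp add: word_mult_Cons lift)
qed (simp add: lift)

definition state :: "'b \<Rightarrow> complex" where
  "state = (\<lambda>x\<in>carrier B. ip H (\<Psi> x \<Omega>) \<Omega>)"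

lemma nondegenerate: "R.nondegenerate"
  unfolding R.nondegenerate_def
proof (intro ballI impI)
  fix w assume w: "w \<in> carrier H" "\<forall>x\<in>carrier B. \<Psi> x w = \<zero>\<^bsub>H\<^esub>"
  show "w = \<zero>\<^bsub>H\<^esub>"
  proof (rule processesD(6)[OF process w(1)])
    show "rep p j a w = \<zero>\<^bsub>H\<^esub>" if "j \<in> J" "a \<in> carrier A" for j a
      using w(2) lift[OF that] copy_closed[OF that] by metis
  qed
qed

lemma has_state: "has_state J A B i p state"
  unfolding has_state_def state_def
  using R.vector_state[OF nondegenerate vac_closed processesD(4)[OF process]]
  by (simp add: lift_word moment_def)

lemma has_state_unique: "has_state J A B i p f \<Longrightarrow> f = state"
  using has_state state_eq_if_eq_on_words unfolding has_state_def by metis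

text \<open>Let \<open>P\<close> be the projection onto the closure of the orbit of \<open>\<Omega>\<close>. It commutes with the
  representation since the orbit is invariant under \<open>\<Psi>(x)\<close> and \<open>\<Psi>(x\<^sup>*)\<close>, so it lies in the commutant
  and every \<open>T\<close> in the von Neumann algebra of the process commutes with it. As \<open>P \<Omega> = \<Omega>\<close> by
  nondegeneracy, \<open>T \<Omega> = P T \<Omega>\<close> stays in the closure of the orbit, while these vectors are
  dense by assumption.\<close>

lemma cyclic: "carrier H \<subseteq> R.H.cl (R.orbit \<Omega>)"
proof
  fix y assume y: "y \<in> carrier H"
  have orbH: "R.orbit \<Omega> \<subseteq> carrier H"
    using R.subspace_orbit[OF vac_closed] by (simp add: R.H.subspace_def)
  obtain P where P: "P \<in> bounded_maps H H" and P_cl: "\<And>y. y \<in> carrier H \<Longrightarrow> P y \<in> R.H.cl (R.orbit \<Omega>)"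
    and P_eqI: "\<And>y m. \<lbrakk>y \<in> carrier H; m \<in> R.H.cl (R.orbit \<Omega>); \<And>z. z \<in> R.orbit \<Omega> \<Longrightarrow> ip H (y \<ominus>\<^bsub>H\<^esub> m) z = 0\<rbrakk> \<Longrightarrow> P y = m"
    and P_orth: "\<And>y z. \<lbrakk>y \<in> carrier H; z \<in> R.orbit \<Omega>\<rbrakk> \<Longrightarrow> ip H (y \<ominus>\<^bsub>H\<^esub> P y) z = 0"
    using R.H.exists_projection[OF R.subspace_orbit[OF vac_closed]] by metis
  note PH = R.H.op_closed[OF P]
  have orb_inv: "\<Psi> x z \<in> R.orbit \<Omega>" if x: "x \<in> carrier B" and z: "z \<in> R.orbit \<Omega>" for x z
  proof -
    obtain b where b: "b \<in> carrier B" "z = \<Psi> b \<Omega>"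
      using z by (auto simp: R.orbit_def)
    have "\<Psi> (x \<otimes> b) \<Omega> = \<Psi> x z"
      unfolding b(2) by (rule R.rep_mult[OF x b(1) vac_closed])
    then show ?thesis
      unfolding R.orbit_def using x b(1) by (intro image_eqI[of _ _ "x \<otimes> b"]) simp_all
  qed
  have commute: "P (\<Psi> x z) = \<Psi> x (P z)" if x: "x \<in> carrier B" and z: "z \<in> carrier H" for x z
  proof (rule P_eqI)
    show "\<Psi> x (P z) \<in> R.H.cl (R.orbit \<Omega>)"
      unfolding R.H.cl_def
    proof (intro CollectI conjI allI impI)
      fix e :: real assume "e > 0"
      have pos: "e / (cnorm B x + 1) > 0"
        using B.cnorm_nonneg[OF x] \<open>e > 0\<close> by simp
      then obtain m where m: "m \<in> R.orbit \<Omega>" "hnorm H (P z \<ominus>\<^bsub>H\<^esub> m) < e / (cnorm B x + 1)"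
        using P_cl[OF z] unfolding R.H.cl_def by blast
      have mH: "m \<in> carrier H"
        using m(1) orbH by blast
      have "hnorm H (\<Psi> x (P z) \<ominus>\<^bsub>H\<^esub> \<Psi> x m) = hnorm H (\<Psi> x (P z \<ominus>\<^bsub>H\<^esub> m))"
        using x PH[OF z] mH by (simp add: R.rep_linear)
      also have "\<dots> \<le> cnorm B x * hnorm H (P z \<ominus>\<^bsub>H\<^esub> m)"
        using x PH[OF z] mH by (intro R.rep_norm) simp_all
      also have "\<dots> \<le> cnorm B x * (e / (cnorm B x + 1))"
        using m(2) B.cnorm_nonneg[OF x] by (intro mult_left_mono) auto
      also have "\<dots> < e"
        using \<open>e > 0\<close> B.cnorm_nonneg[OF x] by (simp add: field_simps)
      finally show "\<exists>y\<in>R.orbit \<Omega>. hnorm H (\<Psi> x (P z) \<ominus>\<^bsub>H\<^esub> y) < e"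
        using orb_inv[OF x m(1)] by blast
    qed (use x PH[OF z] in simp)
    show "ip H (\<Psi> x z \<ominus>\<^bsub>H\<^esub> \<Psi> x (P z)) m = 0" if m: "m \<in> R.orbit \<Omega>" for m
    proof -
      have mH: "m \<in> carrier H"
        using m orbH by blast
      have "ip H (\<Psi> x z \<ominus>\<^bsub>H\<^esub> \<Psi> x (P z)) m = ip H (\<Psi> x (z \<ominus>\<^bsub>H\<^esub> P z)) m"
        using x z PH[OF z] by (simp add: R.rep_linear)
      also have "\<dots> = ip H (z \<ominus>\<^bsub>H\<^esub> P z) (\<Psi> (star B x) m)"
        using x z PH[OF z] mH by (intro R.rep_star) simp_all
      also have "\<dots> = 0"
        using x m z by (intro P_orth orb_inv) simp_all
      finally show ?thesis .
    qed
  qed (use x z in simp)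
  have P_comm: "P \<in> commutant H (\<Union>j\<in>J. rep p j ` carrier A)"
    unfolding commutant_def
  proof (intro CollectI conjI ballI)
    fix R assume "R \<in> (\<Union>j\<in>J. rep p j ` carrier A)"
    then obtain j a where ja: "j \<in> J" "a \<in> carrier A" "R = \<Psi> (i j a)"
      using lift by force
    have R: "R \<in> bounded_maps H H"
      unfolding ja(3) using ja by simp
    show "P \<otimes>\<^bsub>bounded_ops H\<^esub> R = R \<otimes>\<^bsub>bounded_ops H\<^esub> P"
      using P R commute ja by (intro R.H.op_eqI) (simp_all add: compose_eq)
  qed (use P in simp)
  have vac: "P \<Omega> = \<Omega>"
  proof (rule P_eqI)
    show "\<Omega> \<in> R.H.cl (R.orbit \<Omega>)"
      by (rule R.vector_in_cl_orbit[OF nondegenerate vac_closed])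
  qed (use orbH in auto)
  have TO: "T \<in> bounded_maps H H \<and> T \<Omega> \<in> R.H.cl (R.orbit \<Omega>)" if T: "T \<in> process_vN J A p" for T
  proof -
    have TB: "T \<in> bounded_maps H H" and "compose (carrier H) T P = compose (carrier H) P T"
      using T P_comm unfolding process_vN_def commutant_def[of H "commutant _ _"] by auto
    then have "T (P \<Omega>) = P (T \<Omega>)"
      by (metis compose_eq vac_closed)
    then have "T \<Omega> = P (T \<Omega>)"
      by (simp add: vac)
    then show ?thesis
      using TB P_cl[OF R.H.op_closed[OF TB vac_closed]] by simp
  qed
  let ?S = "{T \<Omega> | T. T \<in> process_vN J A p}"
  have SH: "?S \<subseteq> carrier H"
    using TO R.H.op_closed vac_closed by blast
  have "y \<in> R.H.ms.mtopology closure_of ?S"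
    using processesD(5)[OF process] y by (simp add: R.H.hdist_eq)
  then have near: "\<And>e. e > 0 \<Longrightarrow> \<exists>z\<in>?S. hnorm H (y \<ominus>\<^bsub>H\<^esub> z) < e"
    using R.H.closure_of_iff[OF SH] by blast
  show "y \<in> R.H.cl (R.orbit \<Omega>)"
    unfolding R.H.cl_def
  proof (intro CollectI conjI allI impI)
    fix e :: real assume "e > 0"
    then obtain T where T: "T \<in> process_vN J A p" "hnorm H (y \<ominus>\<^bsub>H\<^esub> T \<Omega>) < e / 2"
      using near[of "e / 2"] by auto
    have TH: "T \<Omega> \<in> carrier H" "T \<Omega> \<in> R.H.cl (R.orbit \<Omega>)"
      using TO[OF T(1)] by (auto simp: R.H.cl_def)
    then obtain z where z: "z \<in> R.orbit \<Omega>" "hnorm H (T \<Omega> \<ominus>\<^bsub>H\<^esub> z) < e / 2"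
      using \<open>e > 0\<close> unfolding R.H.cl_def by (auto dest!: spec[of _ "e / 2"])
    then have "hnorm H (y \<ominus>\<^bsub>H\<^esub> z) < e"
      using T(2) R.H.N_triangle_diff[OF y TH(1), of z] orbH by auto
    then show "\<exists>z\<in>R.orbit \<Omega>. hnorm H (y \<ominus>\<^bsub>H\<^esub> z) < e"
      using z(1) by blast
  qed (rule y)
qed

end

locale process_rep_pair = P: process_rep A B J i p \<Psi> + Q: process_rep A B J i q \<Phi>
  for A :: "'a cstar" and B :: "'b cstar" (structure) and J :: "'j set" and i :: "'j \<Rightarrow> 'a \<Rightarrow> 'b"
    and p :: "('j, 'a, 'h) process" and \<Psi> and q :: "('j, 'a, 'k) process" and \<Phi>
begin

sublocale hilbert_pair "hspace p" "hspace q"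
  by (intro hilbert_pair.intro processesD(1)[OF P.process] processesD(1)[OF Q.process])

lemma state_eq_iff: "P.state = Q.state \<longleftrightarrow> (\<forall>w\<in>words J A. moment p w = moment q w)"
  using P.has_state Q.has_state P.state_eq_if_eq_on_words unfolding has_state_def by metis

text \<open>The families \<open>\<Psi>(b)\<Omega>\<close> and \<open>\<Phi>(b)\<Omega>'\<close>, indexed by \<open>b \<in> B\<close>, are dense and both have the Gram matrix
  \<open>\<phi>(c\<^sup>* b)\<close>. The unitary between them is recognized through its matrix coefficients with these
  families; so are the intertwining relation and the image of the distinguished vector.\<close>

theorem unitarily_equivalent_if_state_eq:
  assumes eq: "P.state = Q.state"
  shows "unitarily_equivalent J A p q"
proof -
  let ?H = "hspace p" and ?K = "hspace q"
  have st: "ip ?H (\<Psi> x (vac p)) (vac p) = ip ?K (\<Phi> x (vac q)) (vac q)" if "x \<in> carrier B" for x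
    using fun_cong[OF eq, of x] that by (simp add: P.state_def Q.state_def)
  have "ip ?K (\<Phi> a (vac q)) (\<Phi> b (vac q)) = ip ?H (\<Psi> a (vac p)) (\<Psi> b (vac p))"
    if ab: "a \<in> carrier B" "b \<in> carrier B" for a b
  proof -
    have "ip ?K (\<Phi> a (vac q)) (\<Phi> b (vac q)) = ip ?K (\<Phi> (star B b \<otimes> a) (vac q)) (vac q)"
      using Q.R.rep_star[of "star B b" "\<Phi> a (vac q)" "vac q"] ab by (simp add: Q.R.rep_mult)
    moreover have "ip ?H (\<Psi> a (vac p)) (\<Psi> b (vac p)) = ip ?H (\<Psi> (star B b \<otimes> a) (vac p)) (vac p)"
      using P.R.rep_star[of "star B b" "\<Psi> a (vac p)" "vac p"] ab by (simp add: P.R.rep_mult)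
    ultimately show ?thesis
      using st[of "star B b \<otimes> a"] ab by simp
  qed
  then obtain V where V: "V \<in> unitary_maps ?H ?K"
      and Vip: "\<And>x b. \<lbrakk>x \<in> carrier ?H; b \<in> carrier B\<rbrakk> \<Longrightarrow> ip ?K (V x) (\<Phi> b (vac q)) = ip ?H x (\<Psi> b (vac p))"
    using unitary_of_equal_gram[of "carrier B" "\<lambda>b. \<Psi> b (vac p)" "\<lambda>b. \<Phi> b (vac q)"]
      P.cyclic Q.cyclic unfolding P.R.orbit_def Q.R.orbit_def by auto
  interpret KH: hilbert_pair ?K ?H ..
  have eqI: "x = x'" if "x \<in> carrier ?K" "x' \<in> carrier ?K"
    "\<And>b. b \<in> carrier B \<Longrightarrow> ip ?K x (\<Phi> b (vac q)) = ip ?K x' (\<Phi> b (vac q))" for x x'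
    using KH.dense_eqI[of "carrier B" "\<lambda>b. \<Phi> b (vac q)" x x'] Q.cyclic that
    unfolding Q.R.orbit_def by auto
  note VB = unitary_mapsD(1)[OF V] and inv = unitary_mapsD(2)[OF V]
  note VK = bounded_mapsD(1)[OF VB]
  have intertwine: "V (\<Psi> c x) = \<Phi> c (V x)" if c: "c \<in> carrier B" and x: "x \<in> carrier ?H" for c x
  proof (rule eqI)
    fix b assume b: "b \<in> carrier B"
    have "ip ?K (\<Phi> c (V x)) (\<Phi> b (vac q)) = ip ?K (V x) (\<Phi> (star B c \<otimes> b) (vac q))"
      using Q.R.rep_star[of c "V x" "\<Phi> b (vac q)"] VK[OF x] b c by (simp add: Q.R.rep_mult)
    also have "\<dots> = ip ?H x (\<Psi> (star B c \<otimes> b) (vac p))"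
      using Vip[OF x] b c by simp
    also have "\<dots> = ip ?H (\<Psi> c x) (\<Psi> b (vac p))"
      using P.R.rep_star[of c x "\<Psi> b (vac p)"] x b c by (simp add: P.R.rep_mult)
    also have "\<dots> = ip ?K (V (\<Psi> c x)) (\<Phi> b (vac q))"
      using Vip[of "\<Psi> c x" b] b c x by simp
    finally show "ip ?K (V (\<Psi> c x)) (\<Phi> b (vac q)) = ip ?K (\<Phi> c (V x)) (\<Phi> b (vac q))" ..
  qed (use c x VK in auto)
  have "V (vac p) = vac q"
  proof (rule eqI)
    fix b assume b: "b \<in> carrier B"
    have "ip ?K (V (vac p)) (\<Phi> b (vac q)) = ip ?H (vac p) (\<Psi> b (vac p))"
      using Vip[OF P.vac_closed b] .
    also have "\<dots> = ip ?K (vac q) (\<Phi> b (vac q))"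
      using st[OF b] P.R.H.s_cnj[of "\<Psi> b (vac p)" "vac p"] Q.R.H.s_cnj[of "\<Phi> b (vac q)" "vac q"] b by simp
    finally show "ip ?K (V (vac p)) (\<Phi> b (vac q)) = ip ?K (vac q) (\<Phi> b (vac q))" .
  qed (use VK in auto)
  moreover have "V (rep p j a (adjoint_map ?H ?K V y)) = rep q j a y"
    if "j \<in> J" "a \<in> carrier A" "y \<in> carrier ?K" for j a y
  proof -
    have "V (adjoint_map ?H ?K V y) = y"
      using V that(3) by (auto simp: unitary_maps_def compose_def fun_eq_iff restrict_def) metis
    then show ?thesis
      using intertwine[of "i j a" "adjoint_map ?H ?K V y"] adjoint_map_closed[OF VB that(3)] that
      by (simp add: P.lift Q.lift)
  qed
  ultimately show ?thesis
    unfolding unitarily_equivalent_def using V by blast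
qed

end

section \<open>The GNS process of a state\<close>

locale gns = B: cstar_algebra B for B :: "'b cstar" (structure) +
  fixes \<phi> :: "'b \<Rightarrow> complex" and g :: "('b \<Rightarrow> complex) \<Rightarrow> 'h"
  assumes state: "\<phi> \<in> states B" and inj: "inj g"
begin

lemmas phi_add = statesD(2)[OF state] and phi_smult = statesD(3)[OF state]
  and phi_nonneg = statesD(4)[OF state] and phi_bound = B.state_bound[OF state]

lemma phi_zero [simp]: "\<phi> \<zero> = 0"
  using phi_smult[of "\<zero>" 0] by simp

lemma phi_diff: "\<lbrakk>x \<in> carrier B; y \<in> carrier B\<rbrakk> \<Longrightarrow> \<phi> (x \<ominus> y) = \<phi> x - \<phi> y"
  by (simp add: B.diff_eq_smult phi_add phi_smult)

definition form :: "'b \<Rightarrow> 'b \<Rightarrow> complex" where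
  "form x y = \<phi> (star B y \<otimes> x)"

text \<open>Polarization: \<open>\<phi>\<close> is real on the squares of \<open>x + y\<close> and of \<open>x + \<i> y\<close>.\<close>

lemma form_cnj:
  assumes x: "x \<in> carrier B" and y: "y \<in> carrier B"
  shows "form y x = cnj (form x y)"
proof -
  have expand: "\<phi> (star B (x \<oplus> c \<odot> y) \<otimes> (x \<oplus> c \<odot> y)) =
      form x x + cnj c * form x y + c * form y x + cnj c * c * form y y" for c
    using x y by (simp add: form_def B.star_add B.star_smult B.mult_add_left B.mult_add_right
        B.mult_smult_left B.mult_smult_right phi_add phi_smult algebra_simps)
  have im: "Im (form x x + cnj c * form x y + c * form y x + cnj c * c * form y y) = 0" for c
    using phi_nonneg[of "x \<oplus> c \<odot> y"] x y unfolding expand [symmetric]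
    by (simp add: complex_nonneg_Reals_iff)
  have "Im (form x x) = 0" "Im (form y y) = 0"
    using phi_nonneg[OF x] phi_nonneg[OF y] by (simp_all add: form_def complex_nonneg_Reals_iff)
  then show ?thesis
    using im[of 1] im[of \<i>] by (simp add: complex_eq_iff)
qed

lemma semi_ip_form: "semi_ip B form"
proof
  show "form y x = cnj (form x y)" if "x \<in> carrier B" "y \<in> carrier B" for x y
    using that by (rule form_cnj)
qed (auto simp: form_def B.mult_add_right B.mult_smult_right phi_add phi_smult phi_nonneg)

sublocale ip_completion B form g
  by (intro ip_completion.intro semi_ip_form ip_completion_axioms.intro inj)

lemma sn_le_cnorm:
  assumes x: "x \<in> carrier B"
  shows "sn x \<le> cnorm B x"
proof -
  have "(sn x)\<^sup>2 \<le> (cnorm B x)\<^sup>2"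
    using phi_bound[of "star B x \<otimes> x"] complex_Re_le_cmod[of "form x x"] x
    by (simp add: sn_square B.cnorm_cstar form_def)
  then show ?thesis
    using B.cnorm_nonneg[OF x] by (rule power2_le_imp_le)
qed

text \<open>Left multiplication is bounded because \<open>K\<^sup>2 y\<^sup>* y - (x y)\<^sup>* (x y)\<close> is a square for \<open>K > \<parallel>x\<parallel>\<close>.\<close>

lemma sn_mult_le:
  assumes x: "x \<in> carrier B" and y: "y \<in> carrier B"
  shows "sn (x \<otimes> y) \<le> cnorm B x * sn y"
proof (rule field_le_epsilon)
  fix e :: real assume "e > 0"
  \<comment> \<open>The slack is divided by \<open>sn y + 1\<close>, so that it contributes at most \<open>e\<close> to \<open>K sn y\<close>.\<close>
  define K where "K = cnorm B x + e / (sn y + 1)"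
  have pos: "e / (sn y + 1) > 0"
    using \<open>e > 0\<close> sn_nonneg[OF y] by simp
  then have K: "K > cnorm B x" "K \<ge> 0"
    using B.cnorm_nonneg[OF x] by (auto simp: K_def)
  obtain w where w: "w \<in> carrier B" and
    eq: "star B w \<otimes> w = of_real (K\<^sup>2) \<odot> (star B y \<otimes> y) \<ominus> star B (x \<otimes> y) \<otimes> (x \<otimes> y)"
    using B.exists_square_complement[OF x K(1) y] by blast
  have "0 \<le> Re (\<phi> (star B w \<otimes> w))"
    using phi_nonneg[OF w] by (simp add: complex_nonneg_Reals_iff)
  also have "\<dots> = K\<^sup>2 * (sn y)\<^sup>2 - (sn (x \<otimes> y))\<^sup>2"
    unfolding eq using x y by (simp add: phi_diff phi_smult sn_square form_def)
  finally have "(sn (x \<otimes> y))\<^sup>2 \<le> (K * sn y)\<^sup>2"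
    by (simp add: power_mult_distrib)
  then have "sn (x \<otimes> y) \<le> K * sn y"
    by (rule power2_le_imp_le) (use K sn_nonneg[OF y] in simp)
  also have "\<dots> = cnorm B x * sn y + e * (sn y / (sn y + 1))"
    by (simp add: K_def algebra_simps)
  also have "\<dots> \<le> cnorm B x * sn y + e * 1"
    using \<open>e > 0\<close> sn_nonneg[OF y] by (intro add_left_mono mult_left_mono) simp_all
  finally show "sn (x \<otimes> y) \<le> cnorm B x * sn y + e"
    by simp
qed

text \<open>A positive functional on an algebra without unit is hermitian on products by \<open>form_cnj\<close>; an
  approximate unit writes every element nearly as a product.\<close>

lemma phi_star:
  assumes x: "x \<in> carrier B"
  shows "\<phi> (star B x) = cnj (\<phi> x)"
proof -
  have "cmod (\<phi> (star B x) - cnj (\<phi> x)) \<le> 0"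
  proof (rule le_zero_if_small)
    fix d :: real assume "d > 0"
    then obtain e where e: "e \<in> carrier B" "star B e = e" "cnorm B (x \<ominus> e \<otimes> x) < d"
      using B.approximate_unit[OF x] by blast
    let ?z = "x \<ominus> e \<otimes> x"
    have z: "?z \<in> carrier B" "star B ?z = star B x \<ominus> star B x \<otimes> e"
      using x e by (simp_all add: B.star_diff B.star_mult)
    have "\<phi> (star B x \<otimes> e) = cnj (\<phi> (e \<otimes> x))"
      using form_cnj[OF x e(1)] e(2) by (simp add: form_def)
    then have "\<phi> (star B x) - cnj (\<phi> x) = \<phi> (star B ?z) - cnj (\<phi> ?z)"
      unfolding z(2) using x e(1) by (simp add: phi_diff)
    then have "cmod (\<phi> (star B x) - cnj (\<phi> x)) \<le> cmod (\<phi> (star B ?z)) + cmod (\<phi> ?z)"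
      using norm_triangle_ineq4[of "\<phi> (star B ?z)" "cnj (\<phi> ?z)"] by simp
    also have "\<dots> \<le> 2 * cnorm B ?z"
      using phi_bound[of "star B ?z"] phi_bound[of ?z] z(1) by simp
    finally show "\<exists>d'. 0 \<le> d' \<and> d' < d \<and> cmod (\<phi> (star B x) - cnj (\<phi> x)) \<le> 2 * d'"
      using e(3) B.cnorm_nonneg[OF z(1)] by blast
  qed
  then show ?thesis by simp
qed

text \<open>Cauchy-Schwarz for \<open>\<phi>(e x) = \<langle>x, e\<rangle>\<close> with \<open>e\<close> from an approximate unit. In the GNS space this
  says that \<open>x \<mapsto> \<phi> x\<close> has norm at most 1.\<close>

lemma phi_le_sn:
  assumes x: "x \<in> carrier B"
  shows "cmod (\<phi> x) \<le> sn x"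
proof (rule field_le_epsilon)
  fix d :: real assume "d > 0"
  then obtain e where e: "e \<in> carrier B" "star B e = e" "cnorm B e \<le> 1" "cnorm B (x \<ominus> e \<otimes> x) < d"
    using B.approximate_unit[OF x] by blast
  have "\<phi> x = \<phi> (x \<ominus> e \<otimes> x) + form x e"
    using x e by (simp add: phi_diff form_def)
  then have "cmod (\<phi> x) \<le> cmod (\<phi> (x \<ominus> e \<otimes> x)) + cmod (form x e)"
    using norm_triangle_ineq by metis
  moreover have "cmod (\<phi> (x \<ominus> e \<otimes> x)) \<le> d"
    using phi_bound[of "x \<ominus> e \<otimes> x"] x e by simp
  moreover have "cmod (form x e) \<le> sn x * 1"
    using cauchy_schwarz[OF x e(1)] sn_le_cnorm[OF e(1)] e(3) sn_nonneg[OF x]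
      mult_left_mono[of "sn e" 1 "sn x"] by linarith
  ultimately show "cmod (\<phi> x) \<le> sn x + d"
    by simp
qed

text \<open>The inner product of the components of \<open>x\<close> and \<open>y\<close> orthogonal to the vector \<open>\<Omega>\<close> that is to be
  found. It is positive by \<open>phi_le_sn\<close>.\<close>

definition defect :: "'b \<Rightarrow> 'b \<Rightarrow> complex" where
  "defect x y = form x y - \<phi> x * cnj (\<phi> y)"

lemma semi_ip_defect: "semi_ip B defect"
proof
  fix x y z c assume x: "x \<in> carrier B"
  have "\<phi> x * cnj (\<phi> x) = of_real ((cmod (\<phi> x))\<^sup>2)"
    using complex_norm_square[of "\<phi> x"] by simp
  moreover have "(cmod (\<phi> x))\<^sup>2 \<le> (sn x)\<^sup>2"
    using phi_le_sn[OF x] by (intro power_mono) auto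
  ultimately show "defect x x \<in> \<real>\<^sub>\<ge>\<^sub>0"
    unfolding defect_def s_self[OF x] by (simp flip: of_real_diff of_real_power)
  assume y: "y \<in> carrier B"
  show "defect (c \<odot> x) y = c * defect x y"
    using x y by (simp add: defect_def s_linear phi_smult algebra_simps)
  show "defect y x = cnj (defect x y)"
    using form_cnj[OF x y] by (simp add: defect_def)
  assume z: "z \<in> carrier B"
  show "defect (x \<oplus> y) z = defect x z + defect y z"
    using x y z by (simp add: defect_def s_linear phi_add algebra_simps)
qed

text \<open>The code of the vector \<open>\<Omega>\<close> with \<open>\<langle>\<Omega>, b\<rangle>\<close> the conjugate of \<open>\<phi> b\<close>.\<close>

definition vacuum :: 'h where
  "vacuum = g (\<lambda>b\<in>carrier B. cnj (\<phi> b))"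

text \<open>Choose \<open>e\<^sub>n\<close> in the unit ball with \<open>\<phi>(e\<^sub>n) \<rightarrow> 1\<close>. Then \<open>defect e\<^sub>n e\<^sub>n \<le> 1 - \<phi>(e\<^sub>n)\<^sup>2\<close> tends to 0: in
  the limit the \<open>e\<^sub>n\<close> have no component orthogonal to \<open>\<Omega>\<close>. The Cauchy-Schwarz
  inequality for \<open>defect\<close> turns this into \<open>\<langle>e\<^sub>n, b\<rangle> - \<phi>(e\<^sub>n) cnj (\<phi> b) \<rightarrow> 0\<close> for every \<open>b\<close>.\<close>

lemma exists_vacuum_sequence:
  "\<exists>e. represents e vacuum \<and> (\<lambda>n. sn (e n)) \<longlonglongrightarrow> 1"
proof -
  interpret D: semi_ip B defect
    by (rule semi_ip_defect)
  define t where "t n = 1 / real (Suc n)" for n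
  have t: "t \<longlonglongrightarrow> 0"
    unfolding t_def using LIMSEQ_inverse_real_of_nat by (simp add: inverse_eq_divide)
  have tpos: "t n > 0" "t n \<le> 1" for n
    by (simp_all add: t_def)
  obtain e where e [simp]: "\<And>n. e n \<in> carrier B" and e1: "\<And>n. cnorm B (e n) \<le> 1"
      and pos: "\<And>n. \<phi> (e n) \<in> \<real>\<^sub>\<ge>\<^sub>0" and near: "\<And>n. cmod (\<phi> (e n)) > 1 - t n"
    using B.state_norm_attained[OF state tpos(1)] by metis
  have sn1: "sn (e n) \<le> 1" for n
    using sn_le_cnorm[of "e n"] e1[of n] by simp
  have phi_e: "\<phi> (e n) = of_real (cmod (\<phi> (e n)))" for n
    using pos[of n] by (simp add: nonneg_Reals_cmod_eq_Re complex_nonneg_Reals_iff complex_eq_iff)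
  have phi_e1: "cmod (1 - \<phi> (e n)) \<le> t n" for n
  proof -
    have "cmod (1 - \<phi> (e n)) = cmod (of_real (1 - cmod (\<phi> (e n))))"
      by (subst phi_e) simp
    also have "\<dots> = \<bar>1 - cmod (\<phi> (e n))\<bar>"
      by (rule norm_of_real)
    also have "\<dots> \<le> t n"
      using phi_le_sn[of "e n"] sn1[of n] near[of n] tpos(1)[of n] e by simp
    finally show ?thesis .
  qed
  \<comment> \<open>Pythagoras for the decomposition along \<open>\<Omega>\<close>.\<close>
  have D_square: "(D.sn x)\<^sup>2 = (sn x)\<^sup>2 - (cmod (\<phi> x))\<^sup>2" if "x \<in> carrier B" for x
  proof -
    have "Re (\<phi> x * cnj (\<phi> x)) = (cmod (\<phi> x))\<^sup>2"
      unfolding complex_norm_square [symmetric] by simp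
    then show ?thesis
      using that unfolding D.sn_square[OF that] sn_square[OF that] defect_def by simp
  qed
  define r where "r n = sqrt (2 * t n)" for n
  have r: "r \<longlonglongrightarrow> 0"
    unfolding r_def using tendsto_real_sqrt[OF tendsto_mult_left[OF t, of 2]] by simp
  \<comment> \<open>\<open>1 - (1 - t)\<^sup>2 \<le> 2 t\<close> for the gap \<open>t\<close> between \<open>\<phi>(e\<^sub>n)\<close> and 1.\<close>
  have D_small: "D.sn (e n) \<le> r n" for n
  proof -
    have "(1 - t n)\<^sup>2 \<le> (cmod (\<phi> (e n)))\<^sup>2"
      using near[of n] tpos(2)[of n] by (intro power_mono) auto
    moreover have "(sn (e n))\<^sup>2 \<le> 1"
      using sn1[of n] sn_nonneg[of "e n"] by (simp add: power_le_one)
    ultimately have "(D.sn (e n))\<^sup>2 \<le> 1 - (1 - t n)\<^sup>2"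
      using D_square[of "e n"] by simp
    also have "\<dots> \<le> 2 * t n"
      by (simp add: power2_diff)
    finally have "(D.sn (e n))\<^sup>2 \<le> (r n)\<^sup>2"
      using tpos(1)[of n] by (simp add: r_def)
    then show ?thesis
      by (rule power2_le_imp_le) (use tpos(1)[of n] in \<open>simp add: r_def\<close>)
  qed
  have diff_le: "sn (e m \<ominus> e n) \<le> (r m + t m) + (r n + t n)" for m n
  proof -
    let ?d = "e m \<ominus> e n"
    have "(sn ?d)\<^sup>2 \<le> (D.sn ?d + cmod (\<phi> ?d))\<^sup>2"
      using D_square[of ?d] D.sn_nonneg[of ?d] by (simp add: power2_sum)
    then have "sn ?d \<le> D.sn ?d + cmod (\<phi> ?d)"
      by (rule power2_le_imp_le) (use D.sn_nonneg[of ?d] in simp)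
    moreover have "D.sn ?d \<le> r m + r n"
      using D.sn.N_minus_le[of "e m" "e n"] D_small[of m] D_small[of n] by simp
    moreover have "\<phi> ?d = (1 - \<phi> (e n)) - (1 - \<phi> (e m))"
      by (simp add: phi_diff)
    then have "cmod (\<phi> ?d) \<le> t n + t m"
      using norm_triangle_ineq4[of "1 - \<phi> (e n)" "1 - \<phi> (e m)"] phi_e1[of m] phi_e1[of n] by simp
    ultimately show ?thesis by simp
  qed
  have rt: "(\<lambda>n. r n + t n) \<longlonglongrightarrow> 0"
    using tendsto_add[OF r t] by simp
  have "cauchy e"
  proof (rule cauchyI)
    fix \<epsilon> :: real assume "\<epsilon> > 0"
    then obtain M where M: "\<And>n. n \<ge> M \<Longrightarrow> r n + t n < \<epsilon> / 2"
      using order_tendstoD(2)[OF rt, of "\<epsilon> / 2"] by (auto simp: eventually_sequentially)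
    have "sn (e m \<ominus> e n) < \<epsilon>" if "m \<ge> M" "n \<ge> M" for m n
      using diff_le[of m n] M[OF that(1)] M[OF that(2)] by linarith
    then show "\<exists>M. \<forall>m\<ge>M. \<forall>n\<ge>M. sn (e m \<ominus> e n) < \<epsilon>"
      by blast
  qed simp
  have phi_lim: "(\<lambda>n. \<phi> (e n)) \<longlonglongrightarrow> 1"
  proof (rule LIM_zero_cancel, rule Lim_null_comparison[OF always_eventually t], rule allI)
    show "norm (\<phi> (e n) - 1) \<le> t n" for n
      using phi_e1[of n] by (simp add: norm_minus_commute)
  qed
  have "represents e vacuum"
    unfolding vacuum_def
  proof (rule representsI[OF \<open>cauchy e\<close>])
    fix b assume b: "b \<in> carrier B"
    have "(\<lambda>n. defect (e n) b) \<longlonglongrightarrow> 0"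
    proof (rule Lim_null_comparison[OF always_eventually tendsto_mult_left_zero[OF r]], rule allI)
      show "norm (defect (e n) b) \<le> r n * D.sn b" for n
        using D.cauchy_schwarz[of "e n" b] b mult_right_mono[OF D_small[of n] D.sn_nonneg[OF b]] by simp
    qed
    then have "(\<lambda>n. defect (e n) b + \<phi> (e n) * cnj (\<phi> b)) \<longlonglongrightarrow> 0 + 1 * cnj (\<phi> b)"
      by (intro tendsto_add tendsto_mult phi_lim tendsto_const)
    then show "(\<lambda>n. form (e n) b) \<longlonglongrightarrow> (\<lambda>b\<in>carrier B. cnj (\<phi> b)) b"
      using b by (simp add: defect_def)
  qed simp
  moreover have "(\<lambda>n. sn (e n)) \<longlonglongrightarrow> 1"
  proof (rule tendsto_sandwich)
    show "(\<lambda>n. cmod (\<phi> (e n))) \<longlonglongrightarrow> 1"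
      using tendsto_norm[OF phi_lim] by simp
  qed (use phi_le_sn sn1 in auto)
  ultimately show ?thesis
    by blast
qed

lemma vacuum_closed [simp]: "vacuum \<in> carrier completion"
  using exists_vacuum_sequence represents_closed by blast

lemma dec_vacuum: "b \<in> carrier B \<Longrightarrow> dec vacuum b = cnj (\<phi> b)"
  by (simp add: vacuum_def)

lemma hnorm_vacuum: "hnorm completion vacuum = 1"
  using exists_vacuum_sequence hnorm_tendsto LIMSEQ_unique by blast

text \<open>Left multiplication by \<open>x\<close>, read off from \<open>\<langle>x \<xi>, b\<rangle> = \<langle>\<xi>, x\<^sup>* b\<rangle>\<close>.\<close>

definition act :: "'b \<Rightarrow> 'h \<Rightarrow> 'h" where
  "act x = (\<lambda>\<xi>\<in>carrier completion. g (\<lambda>b\<in>carrier B. dec \<xi> (star B x \<otimes> b)))"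

lemma dec_act:
  "\<lbrakk>\<xi> \<in> carrier completion; b \<in> carrier B\<rbrakk> \<Longrightarrow> dec (act x \<xi>) b = dec \<xi> (star B x \<otimes> b)"
  by (simp add: act_def)

lemma form_mult:
  "\<lbrakk>x \<in> carrier B; y \<in> carrier B; z \<in> carrier B\<rbrakk> \<Longrightarrow> form (x \<otimes> y) z = form y (star B x \<otimes> z)"
  by (simp add: form_def B.star_mult B.mult_assoc)

text \<open>All algebraic properties of \<open>act\<close> are obtained from this lemma by comparing representing sequences.\<close>

lemma represents_act:
  assumes x: "x \<in> carrier B" and a: "represents a \<xi>"
  shows "represents (\<lambda>n. x \<otimes> a n) (act x \<xi>)"
proof -
  have aB [simp]: "a n \<in> carrier B" for n
    using represents_mem[OF a] .
  have "represents (\<lambda>n. x \<otimes> a n) (g (\<lambda>b\<in>carrier B. dec \<xi> (star B x \<otimes> b)))"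
  proof (rule representsI)
    show "cauchy (\<lambda>n. x \<otimes> a n)"
    proof (rule cauchy_lipschitz[OF representsD(1)[OF a]])
      show "sn (x \<otimes> a m \<ominus> x \<otimes> a n) \<le> cnorm B x * sn (a m \<ominus> a n)" for m n
        using sn_mult_le[OF x, of "a m \<ominus> a n"] x by (simp add: B.mult_diff)
    qed (use x in \<open>auto simp: B.cnorm_nonneg\<close>)
    show "(\<lambda>n. form (x \<otimes> a n) b) \<longlonglongrightarrow> (\<lambda>b\<in>carrier B. dec \<xi> (star B x \<otimes> b)) b"
      if b: "b \<in> carrier B" for b
      using representsD(4)[OF a, of "star B x \<otimes> b"] x b by (simp add: form_mult)
  qed simp
  then show ?thesis
    using represents_closed[OF a] by (simp add: act_def)
qed

lemma act_closed [simp]: "\<lbrakk>x \<in> carrier B; \<xi> \<in> carrier completion\<rbrakk> \<Longrightarrow> act x \<xi> \<in> carrier completion"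
  by (metis obtain_represents represents_act represents_closed)

lemma act_bounded [simp]:
  assumes x: "x \<in> carrier B"
  shows "act x \<in> bounded_maps completion completion"
proof (rule bounded_mapsI)
  fix \<xi> \<eta> c assume xi: "\<xi> \<in> carrier completion"
  obtain a where a: "represents a \<xi>"
    using obtain_represents[OF xi] .
  have aB [simp]: "a n \<in> carrier B" for n
    using represents_mem[OF a] .
  show "act x \<xi> \<in> carrier completion"
    using x xi by simp
  show "act x (c \<odot>\<^bsub>completion\<^esub> \<xi>) = c \<odot>\<^bsub>completion\<^esub> act x \<xi>"
    using represents_act[OF x represents_smult[OF a, of c]]
      represents_smult[OF represents_act[OF x a], of c] x
    by (intro represents_unique[of "\<lambda>n. c \<odot> (x \<otimes> a n)"]) (simp_all add: B.mult_smult_right)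
  show "hnorm completion (act x \<xi>) \<le> cnorm B x * hnorm completion \<xi>"
  proof (rule LIMSEQ_le[OF hnorm_tendsto[OF represents_act[OF x a]] tendsto_mult_left[OF hnorm_tendsto[OF a]]])
    show "\<exists>N. \<forall>n\<ge>N. sn (x \<otimes> a n) \<le> cnorm B x * sn (a n)"
      using sn_mult_le[OF x] by simp
  qed
  assume eta: "\<eta> \<in> carrier completion"
  obtain b where b: "represents b \<eta>"
    using obtain_represents[OF eta] .
  have bB [simp]: "b n \<in> carrier B" for n
    using represents_mem[OF b] .
  show "act x (\<xi> \<oplus>\<^bsub>completion\<^esub> \<eta>) = act x \<xi> \<oplus>\<^bsub>completion\<^esub> act x \<eta>"
    using represents_act[OF x represents_add[OF a b]]
      represents_add[OF represents_act[OF x a] represents_act[OF x b]] x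
    by (intro represents_unique[of "\<lambda>n. x \<otimes> a n \<oplus> x \<otimes> b n"]) (simp_all add: B.mult_add_right)
qed (simp add: act_def)

lemma act_opI:
  assumes "S \<in> bounded_maps completion completion" "T \<in> bounded_maps completion completion"
    and "\<And>a \<xi>. \<lbrakk>represents a \<xi>; \<xi> \<in> carrier completion; \<And>n. a n \<in> carrier B\<rbrakk> \<Longrightarrow> S \<xi> = T \<xi>"
  shows "S = T"
  using assms(1,2)
proof (rule C.op_eqI)
  fix \<xi> assume "\<xi> \<in> carrier completion"
  then show "S \<xi> = T \<xi>"
    using assms(3) represents_mem by (metis obtain_represents)
qed

lemma act_star_hom: "act \<in> star_hom B (bounded_ops completion)"
proof (rule star_homI)
  fix x y c assume x: "x \<in> carrier B"
  show "act x \<in> carrier (bounded_ops completion)"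
    using x by simp
  show "act (c \<odot> x) = c \<odot>\<^bsub>bounded_ops completion\<^esub> act x"
  proof (rule act_opI)
    fix a \<xi> assume a: "represents a \<xi>" "\<xi> \<in> carrier completion" and [simp]: "\<And>n. a n \<in> carrier B"
    have "act (c \<odot> x) \<xi> = c \<odot>\<^bsub>completion\<^esub> act x \<xi>"
      using represents_act[OF B.smult_in[OF x] a(1), of c] represents_smult[OF represents_act[OF x a(1)], of c] x
      by (intro represents_unique[of "\<lambda>n. c \<odot> (x \<otimes> a n)"]) (simp_all add: B.mult_smult_left)
    then show "act (c \<odot> x) \<xi> = (c \<odot>\<^bsub>bounded_ops completion\<^esub> act x) \<xi>"
      using a(2) by simp
  qed (use x in simp_all)
  show "act (star B x) = star (bounded_ops completion) (act x)"
  proof (rule act_opI)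
    fix a \<xi> assume a: "represents a \<xi>" "\<xi> \<in> carrier completion" and [simp]: "\<And>n. a n \<in> carrier B"
    have "adjoint_map completion completion (act x) \<xi> = act (star B x) \<xi>"
    proof (rule C.adjoint_map_eqI)
      fix \<zeta> assume "\<zeta> \<in> carrier completion"
      then obtain b where b: "represents b \<zeta>"
        by (rule obtain_represents)
      have "(\<lambda>n. form (x \<otimes> b n) (a n)) \<longlonglongrightarrow> ip completion (act x \<zeta>) \<xi>"
        by (rule ip_tendsto[OF represents_act[OF x b] a(1)])
      moreover have "(\<lambda>n. form (b n) (star B x \<otimes> a n)) \<longlonglongrightarrow> ip completion \<zeta> (act (star B x) \<xi>)"
        using x by (intro ip_tendsto[OF b represents_act[OF _ a(1)]]) simp
      ultimately show "ip completion (act x \<zeta>) \<xi> = ip completion \<zeta> (act (star B x) \<xi>)"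
        using x represents_mem[OF b] LIMSEQ_unique by (simp add: form_mult)
    qed (use x a(2) in simp_all)
    then show "act (star B x) \<xi> = star (bounded_ops completion) (act x) \<xi>"
      by simp
  qed (use x in simp_all)
  assume y: "y \<in> carrier B"
  show "act (x \<otimes> y) = act x \<otimes>\<^bsub>bounded_ops completion\<^esub> act y"
  proof (rule act_opI)
    fix a \<xi> assume a: "represents a \<xi>" "\<xi> \<in> carrier completion" and [simp]: "\<And>n. a n \<in> carrier B"
    have "act (x \<otimes> y) \<xi> = act x (act y \<xi>)"
      using represents_act[OF B.mult_closed[OF x y] a(1)] represents_act[OF x represents_act[OF y a(1)]] x y
      by (intro represents_unique[of "\<lambda>n. x \<otimes> (y \<otimes> a n)"]) (simp_all add: B.mult_assoc)
    then show "act (x \<otimes> y) \<xi> = (act x \<otimes>\<^bsub>bounded_ops completion\<^esub> act y) \<xi>"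
      using a(2) by (simp add: compose_eq)
  qed (use x y in simp_all)
  show "act (x \<oplus> y) = act x \<oplus>\<^bsub>bounded_ops completion\<^esub> act y"
  proof (rule act_opI)
    fix a \<xi> assume a: "represents a \<xi>" "\<xi> \<in> carrier completion" and [simp]: "\<And>n. a n \<in> carrier B"
    have "act (x \<oplus> y) \<xi> = act x \<xi> \<oplus>\<^bsub>completion\<^esub> act y \<xi>"
      using represents_act[OF B.M.a_closed[OF x y] a(1)]
        represents_add[OF represents_act[OF x a(1)] represents_act[OF y a(1)]] x y
      by (intro represents_unique[of "\<lambda>n. x \<otimes> a n \<oplus> y \<otimes> a n"]) (simp_all add: B.mult_add_left)
    then show "act (x \<oplus> y) \<xi> = (act x \<oplus>\<^bsub>bounded_ops completion\<^esub> act y) \<xi>"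
      using a(2) by simp
  qed (use x y in simp_all)
qed

sublocale R: cstar_rep B completion act
  by (intro cstar_rep.intro cstar_rep_axioms.intro B.cstar_algebra_axioms hilbert_completion act_star_hom)

lemma act_vacuum: "x \<in> carrier B \<Longrightarrow> act x vacuum = emb x"
proof (rule completion_eqI)
  fix b assume x: "x \<in> carrier B" and b: "b \<in> carrier B"
  show "dec (act x vacuum) b = dec (emb x) b"
    using phi_star[of "star B b \<otimes> x"] x b
    by (simp add: dec_act dec_vacuum dec_emb form_def B.star_mult)
qed simp_all

lemma vacuum_moment: "x \<in> carrier B \<Longrightarrow> ip completion (act x vacuum) vacuum = \<phi> x"
  using C.s_cnj[of vacuum "emb x"] ip_emb[of vacuum x] by (simp add: act_vacuum dec_vacuum)

lemma hnorm_emb: "v \<in> carrier B \<Longrightarrow> hnorm completion (emb v) = sn v"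
  using LIMSEQ_unique[OF hnorm_tendsto[OF represents_emb] tendsto_const] by simp

text \<open>Each \<open>b\<close> is nearly \<open>e b\<close>, and \<open>\<langle>\<xi>, e b\<rangle> = \<langle>e \<xi>, b\<rangle> = 0\<close> for self-adjoint \<open>e\<close>.\<close>

lemma act_nondegenerate:
  assumes xi: "\<xi> \<in> carrier completion" and 0: "\<And>x. x \<in> carrier B \<Longrightarrow> act x \<xi> = \<zero>\<^bsub>completion\<^esub>"
  shows "\<xi> = \<zero>\<^bsub>completion\<^esub>"
proof (rule emb_dense[OF xi])
  fix b assume b: "b \<in> carrier B"
  have "cmod (dec \<xi> b) \<le> 0"
  proof (rule le_zero_if_small)
    fix d :: real assume "d > 0"
    then obtain e where e: "e \<in> carrier B" "star B e = e" "cnorm B (b \<ominus> e \<otimes> b) < d"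
      using B.approximate_unit[OF b] by blast
    let ?z = "b \<ominus> e \<otimes> b"
    obtain a where a: "represents a \<xi>"
      using obtain_represents[OF xi] .
    have [simp]: "a n \<in> carrier B" for n
      using represents_mem[OF a] .
    have eb: "dec \<xi> (e \<otimes> b) = 0"
      using dec_act[OF xi b, of e] 0[OF e(1)] e(2) b by (simp add: completion_simps(2))
    have z: "?z \<in> carrier B"
      using b e by simp
    have "(\<lambda>n. form (a n) b - form (a n) (e \<otimes> b)) \<longlonglongrightarrow> dec \<xi> b - dec \<xi> (e \<otimes> b)"
      using b e by (intro tendsto_diff representsD(4)[OF a]) simp_all
    then have "dec \<xi> ?z = dec \<xi> b - dec \<xi> (e \<otimes> b)"
      using LIMSEQ_unique representsD(4)[OF a z] b e by (simp add: s_linear)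
    then have "cmod (dec \<xi> b) = cmod (ip completion \<xi> (emb ?z))"
      using ip_emb[OF xi z] eb by simp
    also have "\<dots> \<le> hnorm completion \<xi> * sn ?z"
      using C.ip_CS[OF xi emb_closed[OF z]] by (simp add: hnorm_emb[OF z])
    also have "\<dots> \<le> hnorm completion \<xi> * cnorm B ?z"
      using sn_le_cnorm[OF z] C.N_nonneg[OF xi] by (rule mult_left_mono)
    finally show "\<exists>d'. 0 \<le> d' \<and> d' < d \<and> cmod (dec \<xi> b) \<le> hnorm completion \<xi> * d'"
      using e(3) B.cnorm_nonneg[OF z] by blast
  qed
  then show "dec \<xi> b = 0" by simp
qed

text \<open>The canonical image of \<open>B\<close> is dense, since a vector orthogonal to it has code 0.\<close>

lemma emb_near:
  assumes xi: "\<xi> \<in> carrier completion" and e: "e > 0"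
  shows "\<exists>v\<in>carrier B. hnorm completion (\<xi> \<ominus>\<^bsub>completion\<^esub> emb v) < e"
proof -
  have nondeg: "R.nondegenerate"
    unfolding R.nondegenerate_def using act_nondegenerate by blast
  have subspace: "C.subspace (emb ` carrier B)"
    using R.subspace_orbit[OF vacuum_closed] by (simp add: R.orbit_def act_vacuum cong: image_cong)
  then obtain m where m: "m \<in> carrier completion" "\<forall>e>0. \<exists>y\<in>emb ` carrier B. hnorm completion (m \<ominus>\<^bsub>completion\<^esub> y) < e"
      and orth: "\<forall>z\<in>emb ` carrier B. ip completion (\<xi> \<ominus>\<^bsub>completion\<^esub> m) z = 0"
    using C.orthogonal_projection[of "emb ` carrier B" \<xi>] xi unfolding C.subspace_def by blast
  have "\<xi> \<ominus>\<^bsub>completion\<^esub> m = \<zero>\<^bsub>completion\<^esub>"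
    using orth ip_emb[of "\<xi> \<ominus>\<^bsub>completion\<^esub> m"] xi m(1) by (intro emb_dense) auto
  then have "\<xi> = m"
    using xi m(1) by (simp add: C.diff_0_iff)
  then show ?thesis
    using m(2) e by blast
qed

end

locale gns_process = generated_copies A B J i + gns B \<phi> g
  for A :: "'a cstar" and B :: "'b cstar" (structure) and J :: "'j set" and i :: "'j \<Rightarrow> 'a \<Rightarrow> 'b"
    and \<phi> :: "'b \<Rightarrow> complex" and g :: "('b \<Rightarrow> complex) \<Rightarrow> 'h"
begin

definition proc :: "('j, 'a, 'h) process" where
  "proc = \<lparr>hspace = completion, rep = (\<lambda>j a. act (i j a)), vac = vacuum\<rparr>"

lemma proc_simps [simp]:
  "hspace proc = completion" "rep proc = (\<lambda>j a. act (i j a))" "vac proc = vacuum"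
  by (simp_all add: proc_def)

text \<open>An operator \<open>T\<close> that commutes with the copies commutes with all words. The matrix coefficients
  of \<open>T \<circ> act x\<close> and \<open>act x \<circ> T\<close> are bounded functionals of \<open>x\<close>, so \<open>T\<close> commutes with all \<open>act x\<close>.\<close>

lemma act_in_vN:
  assumes x: "x \<in> carrier B"
  shows "act x \<in> process_vN J A proc"
proof -
  define comm where "comm = commutant completion (\<Union>j\<in>J. rep proc j ` carrier A)"
  have comm_bounded: "T \<in> bounded_maps completion completion" if "T \<in> comm" for T
    using that by (simp add: comm_def commutant_def)
  note Tx = C.op_closed[OF comm_bounded]
  have base: "T (act (i j a) v) = act (i j a) (T v)"
    if "T \<in> comm" "j \<in> J" "a \<in> carrier A" "v \<in> carrier completion" for T j a v
  proof -
    have "act (i j a) \<in> (\<Union>j\<in>J. rep proc j ` carrier A)"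
      using that(2,3) by auto
    then have "compose (carrier completion) T (act (i j a)) = compose (carrier completion) (act (i j a)) T"
      using that(1) unfolding comm_def commutant_def bounded_ops_simps by blast
    then have "compose (carrier completion) T (act (i j a)) v = compose (carrier completion) (act (i j a)) T v"
      by (rule fun_cong)
    then show ?thesis
      using that(4) by (simp only: compose_eq)
  qed
  have key: "T (act x v) = act x (T v)" if T: "T \<in> comm" and v: "v \<in> carrier completion" for T v
  proof (rule C.ip_eqI_left)
    note TB = comm_bounded[OF T] and Tv = Tx[OF T]
    fix w assume w: "w \<in> carrier completion"
    let ?n = "cnorm (bounded_ops completion) T"
    define K where "K = ?n * hnorm completion v * hnorm completion w"
    show "ip completion (T (act x v)) w = ip completion (act x (T v)) w"
    proof (rule functional_eq_if_eq_on_words[where K = K, OF _ _ _ _ _ _ _ x])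
      fix y assume y: "y \<in> carrier B"
      have "hnorm completion (T (act y v)) \<le> ?n * (cnorm B y * hnorm completion v)"
        using C.op_norm_bound[OF TB act_closed[OF y v]]
          mult_left_mono[OF R.rep_norm[OF y v] C.op_norm_nonneg[OF TB]] by linarith
      then show "cmod (ip completion (T (act y v)) w) \<le> K * cnorm B y"
        using C.ip_CS[of "T (act y v)" w] Tv y v w C.N_nonneg[OF w]
          mult_right_mono[of "hnorm completion (T (act y v))" _ "hnorm completion w"]
        unfolding K_def by (fastforce simp: mult_ac simp del: bounded_ops_simps)
      have "hnorm completion (act y (T v)) \<le> cnorm B y * (?n * hnorm completion v)"
        using R.rep_norm[OF y Tv[OF v]]
          mult_left_mono[OF C.op_norm_bound[OF TB v] B.cnorm_nonneg[OF y]] by linarith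
      then show "cmod (ip completion (act y (T v)) w) \<le> K * cnorm B y"
        using C.ip_CS[of "act y (T v)" w] Tv y v w C.N_nonneg[OF w]
          mult_right_mono[of "hnorm completion (act y (T v))" _ "hnorm completion w"]
        unfolding K_def by (fastforce simp: mult_ac simp del: bounded_ops_simps)
    next
      fix u assume u: "u \<in> words J A"
      have "T (act (word_mult B i u) v) = act (word_mult B i u) (T v)"
        using u
      proof (induction rule: words_induct)
        case (Cons j a u)
        then show ?case
          using base[OF T Cons(1,2), of "act (word_mult B i u) v"] v Tv
          by (simp add: word_mult_Cons R.rep_mult)
      qed (use T v base in simp)
      then show "ip completion (T (act (word_mult B i u) v)) w = ip completion (act (word_mult B i u) (T v)) w"
        by simp
    qed (use bounded_mapsD(3,4)[OF TB] Tv v w in \<open>simp_all add: R.rep_add R.rep_smult C.s_linear\<close>)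
  qed (use Tx[OF T] x v in simp_all)
  have "act x \<in> commutant completion comm"
    unfolding commutant_def
  proof (intro CollectI conjI ballI)
    fix T assume T: "T \<in> comm"
    show "act x \<otimes>\<^bsub>bounded_ops completion\<^esub> T = T \<otimes>\<^bsub>bounded_ops completion\<^esub> act x"
      using key[OF T] x comm_bounded[OF T] by (intro C.op_eqI) (simp_all add: compose_eq)
  qed (use x in simp)
  then show ?thesis
    by (simp add: process_vN_def comm_def)
qed

text \<open>Cyclicity holds since the vectors \<open>act x \<Omega>\<close>, with \<open>act x\<close> in the von Neumann algebra, form the dense
  image of \<open>B\<close>. A vector annihilated by the copies is annihilated by all words, hence by \<open>B\<close>.\<close>

lemma proc_in_processes: "proc \<in> processes J A"
proof -
  have hom: "(\<lambda>a. act (i j a)) \<in> star_hom A (bounded_ops completion)" if j: "j \<in> J" for j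
    using star_homD[OF copy_hom[OF j]] star_homD[OF act_star_hom] by (intro star_homI) metis+
  have nondeg: "\<xi> = \<zero>\<^bsub>completion\<^esub>"
    if xi: "\<xi> \<in> carrier completion" and 0: "\<And>j a. \<lbrakk>j \<in> J; a \<in> carrier A\<rbrakk> \<Longrightarrow> act (i j a) \<xi> = \<zero>\<^bsub>completion\<^esub>" for \<xi>
  proof (rule act_nondegenerate[OF xi])
    fix x assume x: "x \<in> carrier B"
    have word: "act (word_mult B i u) \<xi> = \<zero>\<^bsub>completion\<^esub>" if "u \<in> words J A" for u
      using that
    proof (induction rule: words_induct)
      case (Cons j a u)
      then show ?case
        using xi C.bounded_maps_zero[OF act_bounded] by (simp add: word_mult_Cons R.rep_mult)
    qed (simp add: 0)
    show "act x \<xi> = \<zero>\<^bsub>completion\<^esub>"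
    proof (rule C.ip_eqI_left)
      fix w assume w: "w \<in> carrier completion"
      have "ip completion (act x \<xi>) w = 0"
      proof (rule functional_eq_if_eq_on_words[where f' = "\<lambda>_. 0", OF _ _ _ _ _ _ _ x])
        fix y assume y: "y \<in> carrier B"
        have "cmod (ip completion (act y \<xi>) w) \<le> hnorm completion (act y \<xi>) * hnorm completion w"
          using C.ip_CS xi y w by simp
        also have "\<dots> \<le> cnorm B y * hnorm completion \<xi> * hnorm completion w"
          using R.rep_norm[OF y xi] C.N_nonneg[OF w] by (rule mult_right_mono)
        finally show "cmod (ip completion (act y \<xi>) w) \<le> (hnorm completion \<xi> * hnorm completion w) * cnorm B y"
          by (simp add: mult_ac)
        show "cmod 0 \<le> (hnorm completion \<xi> * hnorm completion w) * cnorm B y"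
          using C.N_nonneg[OF xi] C.N_nonneg[OF w] B.cnorm_nonneg[OF y] by simp
      qed (use xi w word in \<open>simp_all add: R.rep_add R.rep_smult C.s_linear\<close>)
      then show "ip completion (act x \<xi>) w = ip completion \<zero>\<^bsub>completion\<^esub> w"
        using w by simp
    qed (use x xi in simp_all)
  qed
  let ?S = "{T vacuum | T. T \<in> process_vN J A proc}"
  have S: "?S \<subseteq> carrier completion"
    using C.op_closed by (auto simp: process_vN_def commutant_def)
  have "C.ms.mtopology closure_of ?S = carrier completion"
  proof
    show "carrier completion \<subseteq> C.ms.mtopology closure_of ?S"
    proof
      fix \<xi> assume xi: "\<xi> \<in> carrier completion"
      have "\<exists>y\<in>?S. hnorm completion (\<xi> \<ominus>\<^bsub>completion\<^esub> y) < e" if e: "e > 0" for e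
      proof -
        obtain v where v: "v \<in> carrier B" "hnorm completion (\<xi> \<ominus>\<^bsub>completion\<^esub> emb v) < e"
          using emb_near[OF xi e] by blast
        have "emb v \<in> ?S"
          using act_vacuum[OF v(1), symmetric] act_in_vN[OF v(1)] by blast
        then show ?thesis
          using v(2) by blast
      qed
      then show "\<xi> \<in> C.ms.mtopology closure_of ?S"
        using C.closure_of_iff[OF S] xi by blast
    qed
    show "C.ms.mtopology closure_of ?S \<subseteq> carrier completion"
      using C.closure_of_iff[OF S] by blast
  qed
  then have dense: "hilbert_topology completion closure_of ?S = carrier completion"
    unfolding C.hdist_eq .
  show ?thesis
    unfolding processes_def mem_Collect_eq
    unfolding proc_simps
    using hilbert_completion hom vacuum_closed hnorm_vacuum dense nondeg by blast
qed

lemma process_rep_proc: "process_rep A B J i proc act"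
  by (intro process_rep.intro process_rep_axioms.intro generated_copies_axioms)
    (simp_all add: proc_in_processes act_star_hom)

lemma state_proc: "process_rep.state B proc act = \<phi>"
proof (rule extensionalityI[of _ "carrier B"])
  interpret PR: process_rep A B J i proc act
    by (rule process_rep_proc)
  show "PR.state \<in> extensional (carrier B)"
    by (simp add: PR.state_def)
  show "\<phi> \<in> extensional (carrier B)"
    by (rule statesD(1)[OF state])
  show "PR.state x = \<phi> x" if "x \<in> carrier B" for x
    using that by (simp add: PR.state_def vacuum_moment)
qed

end

section \<open>Free products\<close>

lemma free_productD:
  assumes "free_product TYPE('d) J A (B :: 'b cstar) i"
  shows "cstar_algebra B" "j \<in> J \<Longrightarrow> i j \<in> star_hom A B"
    and "\<lbrakk>cstar_subalgebra S B; (\<Union>j\<in>J. i j ` carrier A) \<subseteq> S\<rbrakk> \<Longrightarrow> S = carrier B"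
proof -
  note * = assms [unfolded free_product_def]
  show "cstar_algebra B" "j \<in> J \<Longrightarrow> i j \<in> star_hom A B"
    using conjunct1[OF *] conjunct1[OF conjunct2[OF *]] by simp_all
  show "\<lbrakk>cstar_subalgebra S B; (\<Union>j\<in>J. i j ` carrier A) \<subseteq> S\<rbrakk> \<Longrightarrow> S = carrier B"
    using spec[OF conjunct1[OF conjunct2[OF conjunct2[OF *]]], of S] by simp
qed

lemma generated_copies_free_product:
  assumes "cstar_algebra A" "free_product TYPE('d) J A B i"
  shows "generated_copies A B J i"
  by (intro generated_copies.intro generated_copies_axioms.intro assms(1) free_productD[OF assms(2)])

lemma free_lift:
  fixes D :: "'d cstar"
  assumes "free_product TYPE('d) J A B i" and "cstar_algebra D" and "\<And>j. j \<in> J \<Longrightarrow> \<Phi> j \<in> star_hom A D"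
  shows "free_lift J A B i D \<Phi> \<in> star_hom B D"
    and "\<lbrakk>j \<in> J; a \<in> carrier A\<rbrakk> \<Longrightarrow> free_lift J A B i D \<Phi> (i j a) = \<Phi> j a"
proof -
  have "\<exists>!\<Psi>. \<Psi> \<in> star_hom B D \<inter> extensional (carrier B) \<and> (\<forall>j\<in>J. \<forall>a\<in>carrier A. \<Psi> (i j a) = \<Phi> j a)"
    using spec[OF spec[OF conjunct2[OF conjunct2[OF conjunct2[OF assms(1) [unfolded free_product_def]]]]],
        of D \<Phi>] assms(2,3) by simp
  from theI'[OF this] show "free_lift J A B i D \<Phi> \<in> star_hom B D"
    "\<lbrakk>j \<in> J; a \<in> carrier A\<rbrakk> \<Longrightarrow> free_lift J A B i D \<Phi> (i j a) = \<Phi> j a"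
    unfolding free_lift_def by blast+
qed

lemma star_hom_word_mult:
  assumes h: "h \<in> star_hom B D" and B: "cstar_algebra B"
    and i: "\<And>j a. \<lbrakk>j \<in> J; a \<in> carrier A\<rbrakk> \<Longrightarrow> i j a \<in> carrier B"
    and eq: "\<And>j a. \<lbrakk>j \<in> J; a \<in> carrier A\<rbrakk> \<Longrightarrow> h (i j a) = k j a"
    and w: "w \<in> words J A"
  shows "h (word_mult B i w) = word_mult D k w"
proof -
  have "word_mult B i w \<in> carrier B \<and> h (word_mult B i w) = word_mult D k w"
    using w
  proof (induction rule: words_induct)
    case (Cons j a w)
    then show ?case
      using i eq star_homD(2)[OF h] cstar_algebra.mult_closed[OF B] by (simp add: word_mult_Cons)
  qed (simp_all add: i eq)
  then show ?thesis ..
qed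

lemma word_mult_relabel: "word_mult B i (map (\<lambda>(j, a). (g j, a)) w) = word_mult B (\<lambda>j. i (g j)) w"
  unfolding word_mult_def by (simp add: case_prod_beta' comp_def)

lemma words_relabel:
  assumes "g permutes J"
  shows "w \<in> words J A \<Longrightarrow> map (\<lambda>(j, a). (g j, a)) w \<in> words J A"
  using permutes_in_image[OF assms] by (fastforce simp: words_def)

lemma (in unital_cstar_algebra) star_one: "star A \<one> = \<one>"
proof -
  have "star A \<one> = star A (star A \<one> \<otimes> \<one>)"
    using star_mult[of "star A \<one>" "\<one>"] unit_closed by (simp add: unit_right)
  then show ?thesis
    using unit_closed by (simp add: unit_right)
qed

context process_rep
begin

text \<open>A unital process also extends to a unital representation of \<open>C\<close> on the same space. Its vector
  state \<open>\<psi>\<close> satisfies \<open>\<psi> \<circ> \<rho> = \<phi>\<close>, as both sides agree on words.\<close>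

lemma state_factorizes:
  assumes C: "unital_free_product TYPE('h \<Rightarrow> 'h) J A C k"
    and unital: "unital_process J A p"
    and \<rho>: "\<rho> \<in> star_hom B C" "\<And>j a. \<lbrakk>j \<in> J; a \<in> carrier A\<rbrakk> \<Longrightarrow> \<rho> (i j a) = k j a"
  shows "\<exists>\<psi>\<in>states C. \<forall>x\<in>carrier B. state x = \<psi> (\<rho> x)"
proof -
  have "unital_cstar_algebra C"
    using C by (simp add: unital_free_product_def)
  then interpret C: unital_cstar_algebra C .
  have k: "k j \<in> star_hom A C" if "j \<in> J" for j
    using bspec[OF conjunct1[OF conjunct2[OF C [unfolded unital_free_product_def]]] that]
    by (simp add: unital_star_hom_def)
  have "rep p j \<in> unital_star_hom A (bounded_ops H)" if "j \<in> J" for j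
    using processesD(2)[OF process that] unital that
    unfolding unital_star_hom_def unital_process_def by blast
  then have "unital_cstar_algebra (bounded_ops H) \<and> (\<forall>j\<in>J. rep p j \<in> unital_star_hom A (bounded_ops H))"
    using R.H.cstar_bounded_ops by blast
  then have "\<exists>!\<Theta>. \<Theta> \<in> unital_star_hom C (bounded_ops H) \<inter> extensional (carrier C) \<and>
      (\<forall>j\<in>J. \<forall>a\<in>carrier A. \<Theta> (k j a) = rep p j a)"
    by (rule mp[OF spec[OF spec[OF conjunct2[OF conjunct2[OF conjunct2[OF C [unfolded unital_free_product_def]]]]]]])
  then obtain \<Theta> where \<Theta>: "\<Theta> \<in> unital_star_hom C (bounded_ops H)"
      and \<Theta>k: "\<And>j a. \<lbrakk>j \<in> J; a \<in> carrier A\<rbrakk> \<Longrightarrow> \<Theta> (k j a) = rep p j a"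
    by (auto dest: ex1_implies_ex)
  have \<Theta>1: "\<Theta> \<in> star_hom C (bounded_ops H)" "\<Theta> \<one>\<^bsub>C\<^esub> = \<one>\<^bsub>bounded_ops H\<^esub>"
    using \<Theta> by (auto simp: unital_star_hom_def)
  interpret T: cstar_rep C H \<Theta>
    by (intro cstar_rep.intro cstar_rep_axioms.intro C.cstar_algebra_axioms processesD(1)[OF process] \<Theta>1(1))
  define \<psi> where "\<psi> = (\<lambda>x\<in>carrier C. ip H (\<Theta> x \<Omega>) \<Omega>)"
  have "T.nondegenerate"
    unfolding T.nondegenerate_def using \<Theta>1(2) C.unit_closed by force
  then have \<psi>: "\<psi> \<in> states C"
    unfolding \<psi>_def by (rule T.vector_state[OF _ vac_closed processesD(4)[OF process]])
  interpret \<rho>: cstar_hom B C \<rho>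
    by (intro cstar_hom.intro cstar_hom_axioms.intro B.cstar_algebra_axioms C.cstar_algebra_axioms \<rho>(1))
  have st: "state \<in> states B"
    using has_state by (simp add: has_state_def)
  have "state x = \<psi> (\<rho> x)" if x: "x \<in> carrier B" for x
  proof (rule functional_eq_if_eq_on_words[where K = 1, OF statesD(2,3)[OF st] _ _ _ _ _ x])
    show "cmod (state x) \<le> 1 * cnorm B x" if "x \<in> carrier B" for x
      using B.state_bound[OF st that] by simp
    show "cmod (\<psi> (\<rho> x)) \<le> 1 * cnorm B x" if "x \<in> carrier B" for x
      using C.state_bound[OF \<psi>, of "\<rho> x"] \<rho>.contractive[OF that] that by simp
    fix w assume w: "w \<in> words J A"
    have "\<rho> (word_mult B i w) = word_mult C k w"
      by (rule star_hom_word_mult[OF \<rho>(1) B.cstar_algebra_axioms _ \<rho>(2) w]) auto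
    moreover have "\<Theta> (word_mult C k w) = word_mult (bounded_ops H) (rep p) w"
      by (rule star_hom_word_mult[OF \<Theta>1(1) C.cstar_algebra_axioms _ \<Theta>k w])
        (use star_homD(1)[OF k] in blast)+
    moreover have "word_mult C k w \<in> carrier C"
      using calculation(1) \<rho>.hom_simps(1)[OF word_closed[OF w]] by simp
    ultimately show "state (word_mult B i w) = \<psi> (\<rho> (word_mult B i w))"
      using has_state w by (simp add: has_state_def \<psi>_def moment_def)
  qed (simp_all add: statesD(2,3)[OF \<psi>])
  then show ?thesis
    using \<psi> by blast
qed

text \<open>Let \<open>u = i\<^sub>j(1)\<close>. Since \<open>\<rho> u = 1\<close>, the element \<open>z = u b - b\<close> is in the kernel of \<open>\<rho>\<close> and
  \<open>\<parallel>\<Psi>(z)\<Omega>\<parallel>\<^sup>2 = \<psi>(\<rho>(z\<^sup>* z)) = 0\<close>. So \<open>\<Psi>(u)\<close> fixes the dense set \<open>\<Psi>(B)\<Omega>\<close>.\<close>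

lemma unital_if_state_factorizes:
  assumes A: "unital_cstar_algebra A" and C: "unital_cstar_algebra C"
    and k: "\<And>j. j \<in> J \<Longrightarrow> k j \<in> unital_star_hom A C"
    and \<rho>: "\<rho> \<in> star_hom B C" "\<And>j a. \<lbrakk>j \<in> J; a \<in> carrier A\<rbrakk> \<Longrightarrow> \<rho> (i j a) = k j a"
    and \<psi>: "\<psi> \<in> states C" and eq: "\<And>x. x \<in> carrier B \<Longrightarrow> state x = \<psi> (\<rho> x)"
  shows "unital_process J A p"
  unfolding unital_process_def
proof
  interpret A: unital_cstar_algebra A by (rule A)
  interpret C: unital_cstar_algebra C by (rule C)
  interpret \<rho>: cstar_hom B C \<rho>
    by (intro cstar_hom.intro cstar_hom_axioms.intro B.cstar_algebra_axioms C.cstar_algebra_axioms \<rho>(1))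
  fix j assume j: "j \<in> J"
  define u where "u = i j \<one>\<^bsub>A\<^esub>"
  have u: "u \<in> carrier B" "star B u = u" "\<rho> u = \<one>\<^bsub>C\<^esub>"
    using j A.unit_closed star_homD(5)[OF copy_hom[OF j], of "\<one>\<^bsub>A\<^esub>"] \<rho>(2)[OF j, of "\<one>\<^bsub>A\<^esub>"] k[OF j]
    by (auto simp: u_def A.star_one unital_star_hom_def)
  have fix_orbit: "\<Psi> u (\<Psi> b \<Omega>) = \<Psi> b \<Omega>" if b: "b \<in> carrier B" for b
  proof -
    define z where "z = u \<otimes> b \<ominus> b"
    have z: "z \<in> carrier B" "\<rho> z = \<zero>\<^bsub>C\<^esub>"
      using u b by (simp_all add: z_def \<rho>.hom_diff C.unit_left)
    have "ip H (\<Psi> z \<Omega>) (\<Psi> z \<Omega>) = state (star B z \<otimes> z)"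
      using R.rep_star[of "star B z" "\<Psi> z \<Omega>" \<Omega>] z(1) by (simp add: state_def R.rep_mult)
    also have "\<dots> = 0"
      using z eq[of "star B z \<otimes> z"] statesD(3)[OF \<psi>, of "\<zero>\<^bsub>C\<^esub>" 0] by simp
    finally have "\<Psi> z \<Omega> = \<zero>\<^bsub>H\<^esub>"
      using R.H.ip_eq_0 z(1) by simp
    then show ?thesis
      using u(1) b by (simp add: z_def R.rep_diff R.rep_mult R.H.diff_0_iff)
  qed
  have "\<Psi> u v = v" if v: "v \<in> carrier H" for v
  proof (rule R.H.dense_eqI[of "carrier B" "\<lambda>b. \<Psi> b \<Omega>"])
    show "ip H (\<Psi> u v) (\<Psi> b \<Omega>) = ip H v (\<Psi> b \<Omega>)" if b: "b \<in> carrier B" for b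
      using R.rep_star[of u v "\<Psi> b \<Omega>"] u b v by (simp add: fix_orbit)
  qed (use cyclic u v in \<open>auto simp: R.orbit_def\<close>)
  then have "\<Psi> u = \<one>\<^bsub>bounded_ops H\<^esub>"
    using u(1) by (intro R.H.op_eqI) simp_all
  then show "rep p j \<one>\<^bsub>A\<^esub> = \<one>\<^bsub>bounded_ops H\<^esub>"
    using lift[OF j A.unit_closed] by (simp add: u_def)
qed

text \<open>The automorphism \<open>\<beta>\<^sub>g\<close> relabels words, so exchangeability is the equality of \<open>\<phi> \<circ> \<beta>\<^sub>g\<close> and \<open>\<phi>\<close> on
  words, and this propagates to \<open>B\<close> because \<open>\<beta>\<^sub>g\<close> is contractive.\<close>

lemma exchangeable_iff_symmetric:
  assumes B: "free_product TYPE('b) J A B i"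
  shows "exchangeable J A p \<longleftrightarrow> symmetric_state J A B i state"
proof -
  have st: "state \<in> states B" and mom: "\<And>w. w \<in> words J A \<Longrightarrow> state (word_mult B i w) = moment p w"
    using has_state by (auto simp: has_state_def)
  have "(\<forall>w\<in>words J A. moment p w = moment p (map (\<lambda>(j, a). (g j, a)) w)) \<longleftrightarrow>
      (\<forall>x\<in>carrier B. state (perm_aut J A B i g x) = state x)" if g: "g \<in> finitary_perms J" for g
  proof -
    have perm: "g permutes J"
      using g by (simp add: finitary_perms_def)
    have gJ: "i (g j) \<in> star_hom A B" if "j \<in> J" for j
      using that permutes_in_image[OF perm] by (simp add: copy_hom)
    define \<beta> where "\<beta> = perm_aut J A B i g"
    have \<beta>: "\<beta> \<in> star_hom B B" "\<And>j a. \<lbrakk>j \<in> J; a \<in> carrier A\<rbrakk> \<Longrightarrow> \<beta> (i j a) = i (g j) a"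
      unfolding \<beta>_def perm_aut_def using free_lift[OF B B.cstar_algebra_axioms gJ] by auto
    interpret \<beta>: cstar_hom B B \<beta>
      by (intro cstar_hom.intro cstar_hom_axioms.intro B.cstar_algebra_axioms \<beta>(1))
    have word: "state (\<beta> (word_mult B i w)) = moment p (map (\<lambda>(j, a). (g j, a)) w)"
      if w: "w \<in> words J A" for w
    proof -
      have "\<beta> (word_mult B i w) = word_mult B (\<lambda>j. i (g j)) w"
        by (rule star_hom_word_mult[OF \<beta>(1) B.cstar_algebra_axioms _ \<beta>(2) w]) auto
      then show ?thesis
        using mom[OF words_relabel[OF perm w]] by (simp add: word_mult_relabel)
    qed
    show ?thesis
    proof
      assume eq: "\<forall>w\<in>words J A. moment p w = moment p (map (\<lambda>(j, a). (g j, a)) w)"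
      have "state (\<beta> x) = state x" if x: "x \<in> carrier B" for x
      proof (rule functional_eq_if_eq_on_words[where K = 1, OF _ _ _ statesD(2,3)[OF st] _ _ x])
        show "cmod (state x) \<le> 1 * cnorm B x" if "x \<in> carrier B" for x
          using B.state_bound[OF st that] by simp
        show "cmod (state (\<beta> x)) \<le> 1 * cnorm B x" if "x \<in> carrier B" for x
          using B.state_bound[OF st, of "\<beta> x"] \<beta>.contractive[OF that] that by simp
        show "state (\<beta> (word_mult B i w)) = state (word_mult B i w)" if "w \<in> words J A" for w
          using word[OF that] mom[OF that] eq that by simp
      qed (simp_all add: statesD(2,3)[OF st])
      then show "\<forall>x\<in>carrier B. state (perm_aut J A B i g x) = state x"
        by (simp add: \<beta>_def)
    next
      assume eq: "\<forall>x\<in>carrier B. state (perm_aut J A B i g x) = state x"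
      show "\<forall>w\<in>words J A. moment p w = moment p (map (\<lambda>(j, a). (g j, a)) w)"
      proof
        fix w assume w: "w \<in> words J A"
        have "moment p w = state (\<beta> (word_mult B i w))"
          using eq word_closed[OF w] mom[OF w] by (simp add: \<beta>_def)
        then show "moment p w = moment p (map (\<lambda>(j, a). (g j, a)) w)"
          using word[OF w] by simp
      qed
    qed
  qed
  then show ?thesis
    unfolding exchangeable_def symmetric_state_def by blast
qed

end

section \<open>The correspondence\<close>

theorem theorem3p4:
  fixes J :: "'j set" and A :: "'a cstar"
    and B :: "'b cstar" and i :: "'j \<Rightarrow> 'a \<Rightarrow> 'b"
    and C :: "'c cstar" and k :: "'j \<Rightarrow> 'a \<Rightarrow> 'c"
  assumes "cstar_algebra A"
    and "free_product TYPE('h \<Rightarrow> 'h) J A B i"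
    and "free_product TYPE('b) J A B i"
    and "free_product TYPE('c) J A B i"
    and "(UNIV :: ('b \<Rightarrow> complex) set) \<lesssim> (UNIV :: 'h set)"
  shows "(\<forall>p \<in> (processes J A :: ('j, 'a, 'h) process set). \<exists>!\<phi>. has_state J A B i p \<phi>) \<and>
    equiv (processes J A) (process_equiv J A :: (('j, 'a, 'h) process \<times> ('j, 'a, 'h) process) set) \<and>
    (process_state J A B i respects
      (process_equiv J A :: (('j, 'a, 'h) process \<times> ('j, 'a, 'h) process) set)) \<and>
    bij_betw (class_state J A B i)
      ((processes J A :: ('j, 'a, 'h) process set) // process_equiv J A) (states B) \<and>
    (unital_cstar_algebra A \<and> unital_free_product TYPE('h \<Rightarrow> 'h) J A C k \<longrightarrow>
      class_state J A B i `
        {K \<in> (processes J A :: ('j, 'a, 'h) process set) // process_equiv J A.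
          \<exists>p\<in>K. unital_process J A p} =
      {\<phi> \<in> states B. \<exists>\<psi>\<in>states C. \<forall>x\<in>carrier B. \<phi> x = \<psi> (free_lift J A B i C k x)}) \<and>
    (\<forall>K \<in> (processes J A :: ('j, 'a, 'h) process set) // process_equiv J A.
      (\<exists>p\<in>K. exchangeable J A p) \<longleftrightarrow> symmetric_state J A B i (class_state J A B i K))"
proof -
  let ?P = "processes J A :: ('j, 'a, 'h) process set"
  let ?E = "process_equiv J A :: (('j, 'a, 'h) process \<times> ('j, 'a, 'h) process) set"
  let ?ps = "process_state J A B i :: ('j, 'a, 'h) process \<Rightarrow> 'b \<Rightarrow> complex"
  let ?cs = "class_state J A B i :: ('j, 'a, 'h) process set \<Rightarrow> 'b \<Rightarrow> complex"
  interpret G: generated_copies A B J i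
    by (rule generated_copies_free_product[OF assms(1,2)])
  have lift: "\<exists>\<Psi>. process_rep A B J i p \<Psi>" if p: "p \<in> ?P" for p
  proof -
    interpret H: hilbert_space "hspace p"
      by (rule processesD(1)[OF p])
    have "cstar_algebra (bounded_ops (hspace p))"
      using H.cstar_bounded_ops unital_cstar_algebra.axioms(1) by blast
    note * = free_lift[OF assms(2) this processesD(2)[OF p]]
    show ?thesis
      by (rule exI[of _ "free_lift J A B i (bounded_ops (hspace p)) (rep p)"])
        (intro process_rep.intro process_rep_axioms.intro G.generated_copies_axioms p *)
  qed
  have unique: "\<exists>!\<phi>. has_state J A B i p \<phi>" if p: "p \<in> ?P" for p
  proof -
    obtain \<Psi> where "process_rep A B J i p \<Psi>"
      using lift[OF p] by blast
    then interpret process_rep A B J i p \<Psi> .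
    show ?thesis
      using has_state has_state_unique by blast
  qed
  have ps: "?ps p = process_rep.state B p \<Psi>" if "process_rep A B J i p \<Psi>" for p \<Psi>
  proof -
    interpret process_rep A B J i p \<Psi> by (rule that)
    show ?thesis
      unfolding process_state_def using has_state has_state_unique by (rule the_equality)
  qed
  have ps_states: "?ps p \<in> states B" if p: "p \<in> ?P" for p
    using theI'[OF unique[OF p]] by (simp add: process_state_def has_state_def)
  have equiv_iff: "unitarily_equivalent J A p q \<longleftrightarrow> ?ps p = ?ps q" if p: "p \<in> ?P" and q: "q \<in> ?P" for p q
  proof -
    obtain \<Psi> \<Phi> where P: "process_rep A B J i p \<Psi>" and Q: "process_rep A B J i q \<Phi>"
      using lift[OF p] lift[OF q] by blast
    interpret PQ: process_rep_pair A B J i p \<Psi> q \<Phi>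
      by (intro process_rep_pair.intro P Q)
    show ?thesis
      unfolding ps[OF P] ps[OF Q]
      using PQ.unitarily_equivalent_if_state_eq unitarily_equivalent_moments[OF p q] PQ.state_eq_iff
      by blast
  qed
  \<comment> \<open>The equivalence is the kernel of the map from processes to states; the rest is formal.\<close>
  have E: "?E = {(p, q). p \<in> ?P \<and> q \<in> ?P \<and> ?ps p = ?ps q}"
    unfolding process_equiv_def using equiv_iff by blast
  have surj: "\<exists>p\<in>?P. ?ps p = \<phi>" if \<phi>: "\<phi> \<in> states B" for \<phi>
  proof -
    obtain g :: "('b \<Rightarrow> complex) \<Rightarrow> 'h" where g: "inj g"
      using assms(5) by (auto simp: lepoll_def)
    interpret gns_process A B J i \<phi> g
      by (intro gns_process.intro gns.intro gns_axioms.intro G.generated_copies_axioms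
          G.B.cstar_algebra_axioms \<phi> g)
    show ?thesis
      using proc_in_processes ps[OF process_rep_proc] state_proc by metis
  qed
  have equiv: "equiv ?P ?E"
    unfolding E by (auto simp: equiv_def refl_on_def sym_def trans_def)
  have respects: "?ps respects ?E"
    unfolding E by (simp add: congruent_def)
  have cs_eq: "?cs K = ?ps p" if K: "K \<in> ?P // ?E" and p: "p \<in> K" for K p
  proof -
    have "?ps ` K = {?ps p}"
      using K p unfolding quotient_def E by auto
    then show ?thesis
      by (simp add: class_state_def)
  qed
  have class_ex: "\<exists>p\<in>K. p \<in> ?P" if "K \<in> ?P // ?E" for K
    using that unfolding quotient_def E by auto
  have class_sub: "p \<in> ?P" if "K \<in> ?P // ?E" "p \<in> K" for K p
    using that unfolding quotient_def E by auto
  have class_of: "?E `` {p} \<in> ?P // ?E" "p \<in> ?E `` {p}" if "p \<in> ?P" for p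
    using that unfolding quotient_def E by auto
  have bij: "bij_betw ?cs (?P // ?E) (states B)"
    unfolding bij_betw_def
  proof
    show "inj_on ?cs (?P // ?E)"
    proof (rule inj_onI)
      fix K L assume K: "K \<in> ?P // ?E" and L: "L \<in> ?P // ?E" and eq: "?cs K = ?cs L"
      obtain p q where p: "p \<in> K" "p \<in> ?P" and q: "q \<in> L" "q \<in> ?P"
        using class_ex[OF K] class_ex[OF L] by blast
      then have "(p, q) \<in> ?E"
        using cs_eq[OF K p(1)] cs_eq[OF L q(1)] eq unfolding E by simp
      then show "K = L"
        using quotient_eqI[OF equiv K L p(1) q(1)] by blast
    qed
    show "?cs ` (?P // ?E) = states B"
    proof
      show "?cs ` (?P // ?E) \<subseteq> states B"
        using cs_eq class_ex ps_states by force
      show "states B \<subseteq> ?cs ` (?P // ?E)"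
      proof
        fix \<phi> assume "\<phi> \<in> states B"
        then obtain p where p: "p \<in> ?P" "?ps p = \<phi>"
          using surj by blast
        then show "\<phi> \<in> ?cs ` (?P // ?E)"
          using cs_eq[OF class_of[OF p(1)]] class_of[OF p(1)] by (metis imageI)
      qed
    qed
  qed
  have unital: "?cs ` {K \<in> ?P // ?E. \<exists>p\<in>K. unital_process J A p} =
      {\<phi> \<in> states B. \<exists>\<psi>\<in>states C. \<forall>x\<in>carrier B. \<phi> x = \<psi> (free_lift J A B i C k x)}"
    if A: "unital_cstar_algebra A" and C: "unital_free_product TYPE('h \<Rightarrow> 'h) J A C k"
  proof -
    have C1: "unital_cstar_algebra C" and k: "\<And>j. j \<in> J \<Longrightarrow> k j \<in> unital_star_hom A C"
      using C by (auto simp: unital_free_product_def)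
    have k1: "\<And>j. j \<in> J \<Longrightarrow> k j \<in> star_hom A C"
      using k by (simp add: unital_star_hom_def)
    have \<rho>: "free_lift J A B i C k \<in> star_hom B C"
        "\<And>j a. \<lbrakk>j \<in> J; a \<in> carrier A\<rbrakk> \<Longrightarrow> free_lift J A B i C k (i j a) = k j a"
      by (rule free_lift[OF assms(4) unital_cstar_algebra.axioms(1)[OF C1]]; simp add: k1)+
    have unital_iff: "unital_process J A p \<longleftrightarrow>
        (\<exists>\<psi>\<in>states C. \<forall>x\<in>carrier B. ?ps p x = \<psi> (free_lift J A B i C k x))" if p: "p \<in> ?P" for p
    proof -
      obtain \<Psi> where P: "process_rep A B J i p \<Psi>"
        using lift[OF p] by blast
      interpret process_rep A B J i p \<Psi> by (rule P)
      show ?thesis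
        unfolding ps[OF P]
        using state_factorizes[OF C _ \<rho>] unital_if_state_factorizes[OF A C1 k \<rho>] by blast
    qed
    show ?thesis
    proof (intro equalityI subsetI)
      fix \<phi> assume "\<phi> \<in> ?cs ` {K \<in> ?P // ?E. \<exists>p\<in>K. unital_process J A p}"
      then obtain K p where K: "K \<in> ?P // ?E" "p \<in> K" "unital_process J A p" "\<phi> = ?cs K"
        by blast
      have p: "p \<in> ?P"
        by (rule class_sub[OF K(1,2)])
      have "\<phi> = ?ps p"
        using K(4) cs_eq[OF K(1,2)] by simp
      then show "\<phi> \<in> {\<phi> \<in> states B. \<exists>\<psi>\<in>states C. \<forall>x\<in>carrier B. \<phi> x = \<psi> (free_lift J A B i C k x)}"
        using ps_states[OF p] unital_iff[OF p] K(3) by blast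
    next
      fix \<phi> assume \<phi>: "\<phi> \<in> {\<phi> \<in> states B. \<exists>\<psi>\<in>states C. \<forall>x\<in>carrier B. \<phi> x = \<psi> (free_lift J A B i C k x)}"
      then obtain p where p: "p \<in> ?P" "?ps p = \<phi>"
        using surj by blast
      have "unital_process J A p"
        using unital_iff[OF p(1)] \<phi> p(2) by blast
      then show "\<phi> \<in> ?cs ` {K \<in> ?P // ?E. \<exists>p\<in>K. unital_process J A p}"
        using class_of[OF p(1)] cs_eq[OF class_of[OF p(1)]] p(2)
        by (intro image_eqI[of _ _ "?E `` {p}"]) auto
    qed
  qed
  have exch: "(\<exists>p\<in>K. exchangeable J A p) \<longleftrightarrow> symmetric_state J A B i (?cs K)" if K: "K \<in> ?P // ?E" for K
  proof -
    have iff: "exchangeable J A p \<longleftrightarrow> symmetric_state J A B i (?cs K)" if pK: "p \<in> K" for p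
    proof -
      obtain \<Psi> where P: "process_rep A B J i p \<Psi>"
        using lift[OF class_sub[OF K pK]] by blast
      interpret process_rep A B J i p \<Psi> by (rule P)
      show ?thesis
        unfolding cs_eq[OF K pK] ps[OF P] by (rule exchangeable_iff_symmetric[OF assms(3)])
    qed
    then show ?thesis
      using class_ex[OF K] by blast
  qed
  show ?thesis
  proof (intro conjI ballI impI, goal_cases)
    case (1 p)
    then show ?case by (rule unique)
  next
    case 2
    show ?case by (rule equiv)
  next
    case 3
    show ?case by (rule respects)
  next
    case 4
    show ?case by (rule bij)
  next
    case 5
    then show ?case by (intro unital) simp_all
  next
    case (6 K)
    then show ?case by (rule exch)
  qed
qed

end
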